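(* Let $\mathcal{U}$ be the set consisting of all unary numerical relations together with the order $\le$. Then (a) $\mathrm{RI}(\mathrm{FO}_{\mathcal{U}})\equiv\mathrm{FO}_{\le}$, and (b) $\mathrm{RI}(\mathrm{FO}_{+})\equiv\mathrm{FO}_{\le}$, where $+$ denotes the ternary numerical relation $\{(i,j,k)\in\mathbb{N}^3: i+j=k\}$.
   Context: A numerical relation is a relation on $\mathbb{N}$. All structures are finite with finite relational vocabulary. A br-$\tau$-model is a pair $(\mathfrak{M},f)$ with $\mathfrak{M}$ a finite $\tau$-structure and $f\colon\mathrm{Dom}(\mathfrak{M})\to\{0,\dots,|\mathrm{Dom}(\mathfrak{M})|-1\}$ a bijection; a numerical relation $S$ is interpreted in it as $S^f=\{\bar a: f(\bar a)\in S\}$. Two br-models $(\mathfrak{M},f),(\mathfrak{N},g)$ are br-isomorphic if there is an isomorphism $h\colon\mathfrak{M}\to\mathfrak{N}$ with $f=g\circ h$. For a set $\mathcal{B}$ of numerical relations, $\mathrm{FO}_{\mathcal{B}}$ is first-order logic whose $\tau$-sentences may also use the symbols in $\mathcal{B}$, evaluated in $(\mathfrak{M},f)$ via the $S^f$. For logics with built-in relations, $\mathcal{L}\le\mathcal{L}'$ means every class of br-$\tau$-models (any $\tau$) definable by an $\mathcal{L}$-sentence is definable by an $\mathcal{L}'$-sentence; $\equiv$ means both directions. A br-quantifier $Q$ of vocabulary $\tau$ is given by a class $K_Q$ of br-$\tau$-models closed under br-isomorphism; $Q(\bar x_R\psi_R)_{R\in\tau}$ holds in $(\mathfrak{M},f)$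 iff $(\mathrm{Dom}(\mathfrak{M}),(\psi_R^{\mathfrak{M},f})_{R\in\tau},f)\in K_Q$; $\mathrm{FO}_{\mathcal{B}}(\mathcal{Q})$ adds this formula formation rule for each $Q\in\mathcal{Q}$; $Q$ is definable in a logic if $K_Q$ is. The relativization of $(\mathfrak{M},f)$ to a nonempty $U\subseteq\mathrm{Dom}(\mathfrak{M})$ is $(\mathfrak{M}|U,f_U)$, where $\mathfrak{M}|U$ is the induced substructure and $f_U\colon U\to\{0,\dots,|U|-1\}$ is the unique bijection with $f_U(a)\le f_U(b)\iff f(a)\le f(b)$. $Q$ is universe independent if $(\mathfrak{M},f)\in K_Q\iff(\mathfrak{M},f)|U\in K_Q$ whenever $R^{\mathfrak{M}}\subseteq U^{\mathrm{arity}(R)}$ for all $R\in\tau$. For a logic $\mathcal{L}_{\mathcal{B}}$ in which $\le$ is definable, the regular interior is $\mathrm{RI}(\mathcal{L}_{\mathcal{B}})=\mathrm{FO}_{\le}(\mathcal{Q}_u)$, where $\mathcal{Q}_u$ is the class of all universe independent br-quantifiers definable in $\mathcal{L}_{\mathcal{B}}$. *)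

theory Defs
  imports "HOL-Library.FuncSet" "HOL-Library.Infinite_Typeclass"
begin

text \<open>A finite relational vocabulary is the list of the arities of its relation symbols; the
  symbols themselves are the positions in that list. A numerical relation is a pair of its arity
  and a set of tuples of that length, so that the empty relation has a determined arity.\<close>

type_synonym vocab = "nat list"

type_synonym numrel = "nat \<times> nat list set"

definition le_rel :: numrel where
  "le_rel = (2, {[i, j] | i j. i \<le> j})"

definition plus_rel :: numrel where
  "plus_rel = (3, {[i, j, k] | i j k. i + j = k})"

definition unary_rels :: "numrel set" where
  "unary_rels = {(1, {[i] | i. i \<in> A}) | A. True}"


section \<open>Br-models\<close>

text \<open>The value of \<open>rank\<close> outside \<open>Dom\<close> is irrelevant: models that differ only there are
  br-isomorphic.\<close>

record 'a br_struct =
  Dom :: "'a set"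
  rels :: "'a list set list"
  rank :: "'a \<Rightarrow> nat"

definition tuples :: "'a set \<Rightarrow> nat \<Rightarrow> 'a list set" where
  "tuples A r = {t. length t = r \<and> set t \<subseteq> A}"

definition br_model :: "vocab \<Rightarrow> 'a br_struct \<Rightarrow> bool" where
  "br_model \<tau> M \<longleftrightarrow>
     finite (Dom M) \<and> Dom M \<noteq> {} \<and>
     length (rels M) = length \<tau> \<and>
     (\<forall>i < length \<tau>. rels M ! i \<subseteq> tuples (Dom M) (\<tau> ! i)) \<and>
     bij_betw (rank M) (Dom M) {..<card (Dom M)}"

definition br_iso :: "vocab \<Rightarrow> 'a br_struct \<Rightarrow> 'a br_struct \<Rightarrow> bool" where
  "br_iso \<tau> M N \<longleftrightarrow> (\<exists>h.
     bij_betw h (Dom M) (Dom N) \<and>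
     (\<forall>i < length \<tau>. \<forall>t \<in> tuples (Dom M) (\<tau> ! i). t \<in> rels M ! i \<longleftrightarrow> map h t \<in> rels N ! i) \<and>
     (\<forall>a \<in> Dom M. rank M a = rank N (h a)))"

definition rank_on :: "('a \<Rightarrow> nat) \<Rightarrow> 'a set \<Rightarrow> 'a \<Rightarrow> nat" where
  "rank_on f U = (THE g. g \<in> extensional U \<and> bij_betw g U {..<card U} \<and>
     (\<forall>a \<in> U. \<forall>b \<in> U. g a \<le> g b \<longleftrightarrow> f a \<le> f b))"

definition relativize :: "'a br_struct \<Rightarrow> 'a set \<Rightarrow> 'a br_struct" where
  "relativize M U = \<lparr>Dom = U, rels = map (\<lambda>R. {t \<in> R. set t \<subseteq> U}) (rels M),
     rank = rank_on (rank M) U\<rparr>"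


section \<open>Br-quantifiers\<close>

type_synonym 'a br_quant = "vocab \<times> 'a br_struct set"

definition br_quantifier :: "'a br_quant \<Rightarrow> bool" where
  "br_quantifier Q \<longleftrightarrow>
     (\<forall>M \<in> snd Q. br_model (fst Q) M) \<and>
     (\<forall>M N. M \<in> snd Q \<and> br_model (fst Q) N \<and> br_iso (fst Q) M N \<longrightarrow> N \<in> snd Q)"

definition universe_independent :: "'a br_quant \<Rightarrow> bool" where
  "universe_independent Q \<longleftrightarrow>
     (\<forall>M U. br_model (fst Q) M \<and> U \<noteq> {} \<and> U \<subseteq> Dom M \<and>
        (\<forall>i < length (fst Q). rels M ! i \<subseteq> tuples U (fst Q ! i)) \<longrightarrow>
        (M \<in> snd Q \<longleftrightarrow> relativize M U \<in> snd Q))"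


section \<open>First-order logic with built-in relations and br-quantifiers\<close>

text \<open>\<open>Qnt Q [(x\<^sub>0, \<psi>\<^sub>0), \<dots>]\<close> lists one variable tuple and one formula for each
  symbol of the vocabulary of \<open>Q\<close>, in order; the tuple \<open>x\<^sub>i\<close> is bound in \<open>\<psi>\<^sub>i\<close> only.\<close>

datatype 'a fm =
    Eq nat nat
  | Rel nat "nat list"
  | Num numrel "nat list"
  | Neg "'a fm"
  | Conj "'a fm" "'a fm"
  | Ex nat "'a fm"
  | Qnt "'a br_quant" "(nat list \<times> 'a fm) list"

fun fv :: "'a fm \<Rightarrow> nat set" where
  "fv (Eq x y) = {x, y}"
| "fv (Rel i xs) = set xs"
| "fv (Num S xs) = set xs"
| "fv (Neg \<phi>) = fv \<phi>"
| "fv (Conj \<phi> \<psi>) = fv \<phi> \<union> fv \<psi>"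
| "fv (Ex x \<phi>) = fv \<phi> - {x}"
| "fv (Qnt Q args) = (\<Union>(xs, \<psi>) \<in> set args. fv \<psi> - set xs)"

fun wf_fm :: "numrel set \<Rightarrow> 'a br_quant set \<Rightarrow> vocab \<Rightarrow> 'a fm \<Rightarrow> bool" where
  "wf_fm B \<Q> \<tau> (Eq x y) \<longleftrightarrow> True"
| "wf_fm B \<Q> \<tau> (Rel i xs) \<longleftrightarrow> i < length \<tau> \<and> length xs = \<tau> ! i"
| "wf_fm B \<Q> \<tau> (Num S xs) \<longleftrightarrow> S \<in> B \<and> length xs = fst S"
| "wf_fm B \<Q> \<tau> (Neg \<phi>) \<longleftrightarrow> wf_fm B \<Q> \<tau> \<phi>"
| "wf_fm B \<Q> \<tau> (Conj \<phi> \<psi>) \<longleftrightarrow> wf_fm B \<Q> \<tau> \<phi> \<and> wf_fm B \<Q> \<tau> \<psi>"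
| "wf_fm B \<Q> \<tau> (Ex x \<phi>) \<longleftrightarrow> wf_fm B \<Q> \<tau> \<phi>"
| "wf_fm B \<Q> \<tau> (Qnt Q args) \<longleftrightarrow>
     Q \<in> \<Q> \<and> map (\<lambda>(xs, \<psi>). length xs) args = fst Q \<and>
     (\<forall>(xs, \<psi>) \<in> set args. distinct xs \<and> wf_fm B \<Q> \<tau> \<psi>)"

definition upds :: "(nat \<Rightarrow> 'a) \<Rightarrow> nat list \<Rightarrow> 'a list \<Rightarrow> nat \<Rightarrow> 'a" where
  "upds s xs as v = (case map_of (zip xs as) v of None \<Rightarrow> s v | Some a \<Rightarrow> a)"

fun sat :: "'a br_struct \<Rightarrow> (nat \<Rightarrow> 'a) \<Rightarrow> 'a fm \<Rightarrow> bool" where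
  "sat M s (Eq x y) \<longleftrightarrow> s x = s y"
| "sat M s (Rel i xs) \<longleftrightarrow> map s xs \<in> rels M ! i"
| "sat M s (Num S xs) \<longleftrightarrow> map (\<lambda>x. rank M (s x)) xs \<in> snd S"
| "sat M s (Neg \<phi>) \<longleftrightarrow> \<not> sat M s \<phi>"
| "sat M s (Conj \<phi> \<psi>) \<longleftrightarrow> sat M s \<phi> \<and> sat M s \<psi>"
| "sat M s (Ex x \<phi>) \<longleftrightarrow> (\<exists>a \<in> Dom M. sat M (s(x := a)) \<phi>)"
| "sat M s (Qnt Q args) \<longleftrightarrow>
     \<lparr>Dom = Dom M,
      rels = map (\<lambda>(xs, \<psi>). {as \<in> tuples (Dom M) (length xs). sat M (upds s xs as) \<psi>}) args,
      rank = rank M\<rparr> \<in> snd Q"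

definition models :: "'a br_struct \<Rightarrow> 'a fm \<Rightarrow> bool" where
  "models M \<phi> \<longleftrightarrow> (\<forall>s. range s \<subseteq> Dom M \<longrightarrow> sat M s \<phi>)"


section \<open>Comparison of logics and the regular interior\<close>

text \<open>A logic assigns to every vocabulary its set of sentences. The domains are finite subsets of
  the type \<open>'a\<close>; every finite br-model has a copy there as soon as that type is infinite.\<close>

type_synonym 'a logic = "vocab \<Rightarrow> 'a fm set"

definition FO :: "numrel set \<Rightarrow> 'a br_quant set \<Rightarrow> 'a logic" where
  "FO B \<Q> \<tau> = {\<phi>. wf_fm B \<Q> \<tau> \<phi> \<and> fv \<phi> = {}}"

definition definable_in :: "'a logic \<Rightarrow> vocab \<Rightarrow> 'a br_struct set \<Rightarrow> bool" where
  "definable_in L \<tau> K \<longleftrightarrow> (\<exists>\<phi> \<in> L \<tau>. K = {M. br_model \<tau> M \<and> models M \<phi>})"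

definition logic_le :: "'a logic \<Rightarrow> 'a logic \<Rightarrow> bool" where
  "logic_le L L' \<longleftrightarrow> (\<forall>\<tau> K. definable_in L \<tau> K \<longrightarrow> definable_in L' \<tau> K)"

definition logic_equiv :: "'a logic \<Rightarrow> 'a logic \<Rightarrow> bool" where
  "logic_equiv L L' \<longleftrightarrow> logic_le L L' \<and> logic_le L' L"

definition RI :: "'a logic \<Rightarrow> 'a logic" where
  "RI L = FO {le_rel}
     {Q. br_quantifier Q \<and> universe_independent Q \<and> definable_in L (fst Q) (snd Q)}"


section \<open>Relativized ranks exist and are unique\<close>

lemma strict_iff_of_le_iff:
  fixes f g :: "'a \<Rightarrow> nat"
  assumes "\<forall>a \<in> U. \<forall>b \<in> U. g a \<le> g b \<longleftrightarrow> f a \<le> f b" "a \<in> U" "b \<in> U"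
  shows "g a < g b \<longleftrightarrow> f a < f b"
  using assms by (meson linorder_not_le)

lemma order_bij_is_count:
  fixes g :: "'a \<Rightarrow> nat"
  assumes bij: "bij_betw g U {..<card U}" and a: "a \<in> U"
  shows "g a = card {b \<in> U. g b < g a}"
proof -
  have inj: "inj_on g U" and im: "g ` U = {..<card U}"
    using bij by (auto simp: bij_betw_def)
  have "g ` {b \<in> U. g b < g a} = {..<g a}"
  proof
    show "{..<g a} \<subseteq> g ` {b \<in> U. g b < g a}"
    proof
      fix k assume "k \<in> {..<g a}"
      moreover have "g a < card U" using a im by blast
      ultimately have "k \<in> g ` U" using im by auto
      then show "k \<in> g ` {b \<in> U. g b < g a}" using \<open>k \<in> {..<g a}\<close> by auto
    qed
  qed auto
  moreover have "inj_on g {b \<in> U. g b < g a}"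
    using inj by (rule inj_on_subset) auto
  ultimately have "card {b \<in> U. g b < g a} = card {..<g a}"
    by (metis card_image)
  then show ?thesis by simp
qed

lemma count_is_order_bij:
  fixes f :: "'a \<Rightarrow> nat"
  assumes fin: "finite U" and inj: "inj_on f U"
  defines "g \<equiv> restrict (\<lambda>a. card {b \<in> U. f b < f a}) U"
  shows "bij_betw g U {..<card U}" "\<forall>a \<in> U. \<forall>b \<in> U. g a \<le> g b \<longleftrightarrow> f a \<le> f b"
proof -
  have less: "g a < g b" if "a \<in> U" "b \<in> U" "f a < f b" for a b
  proof -
    have "{c \<in> U. f c < f a} \<subset> {c \<in> U. f c < f b}"
      using that by auto
    then show ?thesis
      using that fin by (auto simp: g_def intro!: psubset_card_mono)
  qed
  show le: "\<forall>a \<in> U. \<forall>b \<in> U. g a \<le> g b \<longleftrightarrow> f a \<le> f b"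
  proof (intro ballI iffI)
    fix a b assume ab: "a \<in> U" "b \<in> U"
    show "f a \<le> f b" if "g a \<le> g b"
      using less[OF ab(2) ab(1)] that by linarith
    show "g a \<le> g b" if "f a \<le> f b"
      using less[OF ab] that inj ab by (cases "f a = f b") (auto dest: inj_onD)
  qed
  have ginj: "inj_on g U"
    using le inj by (metis inj_on_def order_antisym order_refl)
  have "g a < card U" if "a \<in> U" for a
  proof -
    have "{b \<in> U. f b < f a} \<subset> U" using that by auto
    then show ?thesis
      using fin that by (auto simp: g_def intro!: psubset_card_mono)
  qed
  then have "g ` U \<subseteq> {..<card U}" by auto
  then have "g ` U = {..<card U}"
    using ginj by (simp add: card_image card_subset_eq)
  with ginj show "bij_betw g U {..<card U}" by (simp add: bij_betw_def)
qed

lemma rank_on_eq: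
  assumes fin: "finite U" and inj: "inj_on f U"
  shows "rank_on f U = restrict (\<lambda>a. card {b \<in> U. f b < f a}) U"
  unfolding rank_on_def
proof (rule the_equality)
  show "restrict (\<lambda>a. card {b \<in> U. f b < f a}) U \<in> extensional U \<and>
    bij_betw (restrict (\<lambda>a. card {b \<in> U. f b < f a}) U) U {..<card U} \<and>
    (\<forall>a \<in> U. \<forall>b \<in> U. restrict (\<lambda>a. card {b \<in> U. f b < f a}) U a
       \<le> restrict (\<lambda>a. card {b \<in> U. f b < f a}) U b \<longleftrightarrow> f a \<le> f b)"
    using count_is_order_bij[OF assms] by blast
next
  fix g :: "'a \<Rightarrow> nat"
  assume g: "g \<in> extensional U \<and> bij_betw g U {..<card U} \<and>
    (\<forall>a \<in> U. \<forall>b \<in> U. g a \<le> g b \<longleftrightarrow> f a \<le> f b)"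
  show "g = restrict (\<lambda>a. card {b \<in> U. f b < f a}) U"
  proof (rule extensionalityI[of _ U])
    fix a assume a: "a \<in> U"
    have "g a = card {b \<in> U. g b < g a}"
      using g a by (intro order_bij_is_count) auto
    also have "{b \<in> U. g b < g a} = {b \<in> U. f b < f a}"
      using strict_iff_of_le_iff[of U g f] g a by blast
    finally show "g a = restrict (\<lambda>a. card {b \<in> U. f b < f a}) U a"
      using a by simp
  qed (use g in auto)
qed

lemma br_model_relativize:
  assumes M: "br_model \<tau> M" and U: "U \<noteq> {}" "U \<subseteq> Dom M"
  shows "br_model \<tau> (relativize M U)"
proof -
  have fin: "finite U" using M U finite_subset by (auto simp: br_model_def)
  have inj: "inj_on (rank M) U"
    using M U by (auto simp: br_model_def bij_betw_def intro: inj_on_subset)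
  show ?thesis
    using M U fin count_is_order_bij(1)[OF fin inj]
    by (auto simp: br_model_def relativize_def rank_on_eq[OF fin inj] tuples_def)
qed

end

theory Submission
  imports Defs "HOL-Library.Ramsey"
begin

text \<open>By universe independence, a model may be replaced by any model obtained by adding isolated
  elements, so that the element of rank \<open>i\<close> gets the rank \<open>p i\<close> for an increasing \<open>p\<close> of our choice.
  It suffices to find, for every formula, a \<open>p\<close> for which truth in the padded model is definable in
  the original model from the order alone.

  For unary relations, Ramsey's theorem yields \<open>p\<close> such that the gaps between consecutive values are
  Ehrenfeucht--Fraisse equivalent colored words. Hence all gaps can be replaced by copies of a single
  word, and the result is interpretable in the original model.

  For addition, let \<open>p i = B ^ (i + 1)\<close> with \<open>B\<close> large. As in Cooper's elimination of quantifiers,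
  every quantifier can be restricted to quotients, with fixed denominator, of sums of boundedly many
  signed powers of \<open>B\<close>. The sign of such a sum depends only on the order of the exponents.\<close>

section \<open>Abstract satisfaction and back-and-forth systems\<close>

text \<open>Definable quantifiers can be substituted away, so only the universe independent
  quantifiers themselves have to be defined from the order. The freedom lies in \<open>p\<close>: it
  may depend on the sentence, and a single sentence has bounded quantifier depth and mentions
  finitely many unary relations, hence finitely many colors. The obstacle is that the padded model
  is larger than the original one, for addition even exponentially. Its elements must therefore be
  named by a label from a finite set and a tuple of elements of the original model, with label set
  and tuple length independent of the model. For colored words, a tuple of length 1 suffices, since
  the label is a position in the repeated word. For addition, the label holds the coefficients of a
  sum of powers and the tuple holds the exponents. Cooper's method also produces congruences;
  \<open>B\<close> is chosen divisible by a common denominator, so that these depend on the label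
  alone.\<close>

fun qd :: "'a fm \<Rightarrow> nat" where
  "qd (Neg \<phi>) = qd \<phi>"
| "qd (Conj \<phi> \<psi>) = max (qd \<phi>) (qd \<psi>)"
| "qd (Ex x \<phi>) = Suc (qd \<phi>)"
| "qd _ = 0"

text \<open>The range \<open>U r\<close> of a quantifier may depend on the quantifier depth \<open>r\<close> of its scope. The
  value on \<open>Qnt\<close> is junk.\<close>

fun isat :: "(nat \<Rightarrow> 'b set) \<Rightarrow> (nat \<Rightarrow> 'b list \<Rightarrow> bool) \<Rightarrow> (numrel \<Rightarrow> 'b list \<Rightarrow> bool)
    \<Rightarrow> (nat \<Rightarrow> 'b) \<Rightarrow> 'a fm \<Rightarrow> bool" where
  "isat U R N s (Eq x y) \<longleftrightarrow> s x = s y"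
| "isat U R N s (Rel i xs) \<longleftrightarrow> R i (map s xs)"
| "isat U R N s (Num S xs) \<longleftrightarrow> N S (map s xs)"
| "isat U R N s (Neg \<phi>) \<longleftrightarrow> \<not> isat U R N s \<phi>"
| "isat U R N s (Conj \<phi> \<psi>) \<longleftrightarrow> isat U R N s \<phi> \<and> isat U R N s \<psi>"
| "isat U R N s (Ex x \<phi>) \<longleftrightarrow> (\<exists>a \<in> U (qd \<phi>). isat U R N (s(x := a)) \<phi>)"
| "isat U R N s (Qnt Q args) \<longleftrightarrow> True"

lemma sat_isat:
  assumes "wf_fm B {} \<tau> \<phi>"
  shows "sat M s \<phi> \<longleftrightarrow>
    isat (\<lambda>_. Dom M) (\<lambda>i t. t \<in> rels M ! i) (\<lambda>S t. map (rank M) t \<in> snd S) s \<phi>"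
  using assms by (induction \<phi> arbitrary: s) (auto simp: comp_def)

text \<open>\<open>I r\<close> relates positions from which \<open>r\<close> more rounds can be
  survived. \<open>mono\<close> serves conjunctions, whose shallower member has rounds to spare.
  Positions are total assignments, so free variables need no bookkeeping. Moves are considered only
  for \<open>r < m\<close>, since for addition the ranges are built downwards from the depth of the
  sentence.\<close>

lemma isat_game:
  fixes I :: "nat \<Rightarrow> (nat \<Rightarrow> 'b) \<Rightarrow> (nat \<Rightarrow> 'c) \<Rightarrow> bool"
  assumes mono: "\<And>r s t. r < m \<Longrightarrow> I (Suc r) s t \<Longrightarrow> I r s t"
    and forth: "\<And>r s t a x. r < m \<Longrightarrow> I (Suc r) s t \<Longrightarrow> a \<in> U r \<Longrightarrow> \<exists>b \<in> U' r. I r (s(x := a)) (t(x := b))"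
    and backward: "\<And>r s t b x. r < m \<Longrightarrow> I (Suc r) s t \<Longrightarrow> b \<in> U' r \<Longrightarrow> \<exists>a \<in> U r. I r (s(x := a)) (t(x := b))"
    and eq: "\<And>s t x y. I 0 s t \<Longrightarrow> s x = s y \<longleftrightarrow> t x = t y"
    and rel: "\<And>s t i xs. I 0 s t \<Longrightarrow> i < length \<tau> \<Longrightarrow> length xs = \<tau> ! i \<Longrightarrow> R i (map s xs) \<longleftrightarrow> R' i (map t xs)"
    and num: "\<And>s t S xs. I 0 s t \<Longrightarrow> S \<in> B \<Longrightarrow> length xs = fst S \<Longrightarrow> N S (map s xs) \<longleftrightarrow> N' S (map t xs)"
    and wf: "wf_fm B {} \<tau> \<phi>" and depth: "qd \<phi> \<le> m" and I: "I (qd \<phi>) s t"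
  shows "isat U R N s \<phi> \<longleftrightarrow> isat U' R' N' t \<phi>"
proof -
  have down: "I j s t" if "j \<le> k" "k \<le> m" "I k s t" for j k s t
    using that
  proof (induction rule: dec_induct)
    case (step n)
    then show ?case using mono[of n s t] by simp
  qed simp
  show ?thesis
    using wf depth I
  proof (induction \<phi> arbitrary: s t)
    case (Conj \<phi> \<psi>)
    have "I (qd \<phi>) s t" "I (qd \<psi>) s t"
      using Conj.prems by (auto intro: down[of _ "max (qd \<phi>) (qd \<psi>)"])
    with Conj show ?case by auto
  next
    case (Ex x \<phi>)
    have r: "qd \<phi> < m" and I: "I (Suc (qd \<phi>)) s t" using Ex.prems by auto
    have "isat U R N (s(x := a)) \<phi> \<longleftrightarrow> isat U' R' N' (t(x := b)) \<phi>"
      if "I (qd \<phi>) (s(x := a)) (t(x := b))" for a b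
      using Ex that by auto
    then show ?case
      using forth[OF r I, of _ x] backward[OF r I, of _ x] by (simp; meson)
  qed (auto simp: eq rel num)
qed

section \<open>Dependence of a formula on its variables and its symbols\<close>

lemma sat_fv_cong:
  assumes "\<And>v. v \<in> fv \<phi> \<Longrightarrow> s v = t v"
  shows "sat M s \<phi> \<longleftrightarrow> sat M t \<phi>"
  using assms
proof (induction \<phi> arbitrary: s t)
  case (Rel i xs)
  have "map s xs = map t xs" using Rel by auto
  then show ?case by (simp only: sat.simps)
next
  case (Num S xs)
  have "map (\<lambda>x. rank M (s x)) xs = map (\<lambda>x. rank M (t x)) xs" using Num by auto
  then show ?case by (simp only: sat.simps)
next
  case (Ex x \<phi>)
  have "sat M (s(x := a)) \<phi> \<longleftrightarrow> sat M (t(x := a)) \<phi>" for a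
    using Ex.prems by (intro Ex.IH) auto
  then show ?case by simp
next
  case (Conj \<phi> \<psi>)
  have "sat M s \<phi> \<longleftrightarrow> sat M t \<phi>" "sat M s \<psi> \<longleftrightarrow> sat M t \<psi>"
    using Conj.prems by (auto intro!: Conj.IH)
  then show ?case by simp
next
  case (Neg \<phi>)
  have "sat M s \<phi> \<longleftrightarrow> sat M t \<phi>"
    using Neg.prems by (intro Neg.IH) auto
  then show ?case by simp
next
  case (Qnt Q args)
  have "sat M (upds s xs as) \<psi> \<longleftrightarrow> sat M (upds t xs as) \<psi>"
    if arg: "(xs, \<psi>) \<in> set args" and as: "length as = length xs" for xs \<psi> as
  proof (rule Qnt.IH[OF arg])
    show "\<psi> \<in> Basic_BNFs.snds (xs, \<psi>)" by simp
  next
    fix v assume v: "v \<in> fv \<psi>"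
    show "upds s xs as v = upds t xs as v"
    proof (cases "v \<in> set xs")
      case True
      then obtain a where "map_of (zip xs as) v = Some a"
        using as by (metis map_of_zip_is_Some)
      then show ?thesis by (simp add: upds_def)
    next
      case False
      then have "s v = t v" using v arg by (intro Qnt.prems) auto
      then show ?thesis by (simp add: upds_def split: option.split)
    qed
  qed
  then have "map (\<lambda>(xs, \<psi>). {as \<in> tuples (Dom M) (length xs). sat M (upds s xs as) \<psi>}) args =
    map (\<lambda>(xs, \<psi>). {as \<in> tuples (Dom M) (length xs). sat M (upds t xs as) \<psi>}) args"
    by (intro map_cong) (auto simp: tuples_def)
  then show ?case by (simp only: sat.simps)
qed auto

lemma wf_fm_mono: "wf_fm B \<Q> \<tau> \<phi> \<Longrightarrow> B \<subseteq> B' \<Longrightarrow> \<Q> \<subseteq> \<Q>' \<Longrightarrow> wf_fm B' \<Q>' \<tau> \<phi>"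
  by (induction \<phi>) fastforce+

text \<open>This replaces the infinite supply of unary relations by finitely many, which will become
  finitely many colors.\<close>

lemma wf_fm_finite_support:
  assumes "wf_fm B {} \<tau> \<phi>"
  shows "\<exists>B'. B' \<subseteq> B \<and> finite B' \<and> wf_fm B' {} \<tau> \<phi>"
  using assms
proof (induction \<phi>)
  case (Num S xs)
  then show ?case by (intro exI[of _ "{S}"]) auto
next
  case (Conj \<phi> \<psi>)
  then obtain B1 B2 where "B1 \<subseteq> B" "finite B1" "wf_fm B1 {} \<tau> \<phi>" "B2 \<subseteq> B" "finite B2" "wf_fm B2 {} \<tau> \<psi>"
    by auto
  then show ?case
    by (intro exI[of _ "B1 \<union> B2"]) (auto elim: wf_fm_mono)
qed (auto intro!: exI[of _ "{}"])

lemma finite_fv: "finite (fv \<phi>)"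
  by (induction \<phi>) auto


section \<open>Predicates definable from the order\<close>

text \<open>Definability is attached to predicates on models and assignments instead of formulas, so
  that later constructions combine closure properties and not syntax.\<close>

definition definable_pred :: "vocab \<Rightarrow> ('a br_struct \<Rightarrow> (nat \<Rightarrow> 'a) \<Rightarrow> bool) \<Rightarrow> bool" where
  "definable_pred \<tau> X \<longleftrightarrow> (\<exists>\<phi>. wf_fm {le_rel} {} \<tau> \<phi> \<and>
     (\<forall>M s. br_model \<tau> M \<and> range s \<subseteq> Dom M \<longrightarrow> (sat M s \<phi> \<longleftrightarrow> X M s)))"

lemma definable_predI:
  assumes "wf_fm {le_rel} {} \<tau> \<phi>" "\<And>M s. br_model \<tau> M \<Longrightarrow> range s \<subseteq> Dom M \<Longrightarrow> sat M s \<phi> \<longleftrightarrow> X M s"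
  shows "definable_pred \<tau> X"
  using assms unfolding definable_pred_def by blast

lemma definable_pred_cong:
  assumes "definable_pred \<tau> X" "\<And>M s. br_model \<tau> M \<Longrightarrow> range s \<subseteq> Dom M \<Longrightarrow> X M s \<longleftrightarrow> Y M s"
  shows "definable_pred \<tau> Y"
  using assms unfolding definable_pred_def by (metis (no_types, lifting))

lemma definable_Neg:
  assumes "definable_pred \<tau> X"
  shows "definable_pred \<tau> (\<lambda>M s. \<not> X M s)"
proof -
  obtain \<phi> where "wf_fm {le_rel} {} \<tau> \<phi>"
    "\<And>M s. br_model \<tau> M \<Longrightarrow> range s \<subseteq> Dom M \<Longrightarrow> sat M s \<phi> \<longleftrightarrow> X M s"
    using assms unfolding definable_pred_def by blast
  then show ?thesis by (intro definable_predI[of _ "Neg \<phi>"]) auto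
qed

lemma definable_Conj:
  assumes "definable_pred \<tau> X" "definable_pred \<tau> Y"
  shows "definable_pred \<tau> (\<lambda>M s. X M s \<and> Y M s)"
proof -
  obtain \<phi> where "wf_fm {le_rel} {} \<tau> \<phi>"
    "\<And>M s. br_model \<tau> M \<Longrightarrow> range s \<subseteq> Dom M \<Longrightarrow> sat M s \<phi> \<longleftrightarrow> X M s"
    using assms(1) unfolding definable_pred_def by blast
  moreover obtain \<psi> where "wf_fm {le_rel} {} \<tau> \<psi>"
    "\<And>M s. br_model \<tau> M \<Longrightarrow> range s \<subseteq> Dom M \<Longrightarrow> sat M s \<psi> \<longleftrightarrow> Y M s"
    using assms(2) unfolding definable_pred_def by blast
  ultimately show ?thesis by (intro definable_predI[of _ "Conj \<phi> \<psi>"]) auto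
qed

lemma definable_Disj:
  assumes "definable_pred \<tau> X" "definable_pred \<tau> Y"
  shows "definable_pred \<tau> (\<lambda>M s. X M s \<or> Y M s)"
  using definable_Neg[OF definable_Conj[OF assms[THEN definable_Neg]]] by simp

lemma definable_Ex:
  assumes "definable_pred \<tau> X"
  shows "definable_pred \<tau> (\<lambda>M s. \<exists>a \<in> Dom M. X M (s(x := a)))"
proof -
  obtain \<phi> where \<phi>: "wf_fm {le_rel} {} \<tau> \<phi>"
    "\<And>M s. br_model \<tau> M \<Longrightarrow> range s \<subseteq> Dom M \<Longrightarrow> sat M s \<phi> \<longleftrightarrow> X M s"
    using assms unfolding definable_pred_def by blast
  have "sat M (s(x := a)) \<phi> \<longleftrightarrow> X M (s(x := a))"
    if "br_model \<tau> M" "range s \<subseteq> Dom M" "a \<in> Dom M" for M s a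
    using that by (intro \<phi>) auto
  with \<phi>(1) show ?thesis by (intro definable_predI[of _ "Ex x \<phi>"]) auto
qed

lemma definable_Eq: "definable_pred \<tau> (\<lambda>M s. s x = s y)"
  by (rule definable_predI[of _ "Eq x y"]) auto

lemma definable_Rel:
  "i < length \<tau> \<Longrightarrow> length xs = \<tau> ! i \<Longrightarrow> definable_pred \<tau> (\<lambda>M s. map s xs \<in> rels M ! i)"
  by (rule definable_predI[of _ "Rel i xs"]) auto

lemma definable_le: "definable_pred \<tau> (\<lambda>M s. rank M (s x) \<le> rank M (s y))"
  by (rule definable_predI[of _ "Num le_rel [x, y]"]) (auto simp: le_rel_def)

lemma definable_const: "definable_pred \<tau> (\<lambda>M s. P)"
  using definable_Eq[of \<tau> 0 0] definable_Neg[OF definable_Eq[of \<tau> 0 0]] by (cases P) auto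

lemma definable_finite_Disj:
  assumes "finite A" "\<And>a. a \<in> A \<Longrightarrow> definable_pred \<tau> (X a)"
  shows "definable_pred \<tau> (\<lambda>M s. \<exists>a \<in> A. X a M s)"
  using assms by (induction A) (simp_all add: definable_const definable_Disj)

lemma definable_finite_Conj:
  assumes "finite A" "\<And>a. a \<in> A \<Longrightarrow> definable_pred \<tau> (X a)"
  shows "definable_pred \<tau> (\<lambda>M s. \<forall>a \<in> A. X a M s)"
  using assms by (induction A) (simp_all add: definable_const definable_Conj)

definition block_upd :: "(nat \<Rightarrow> 'a) \<Rightarrow> nat \<Rightarrow> 'a list \<Rightarrow> nat \<Rightarrow> 'a" where
  "block_upd s m t v = (if m \<le> v \<and> v < m + length t then t ! (v - m) else s v)"

lemma definable_Ex_block: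
  assumes "definable_pred \<tau> X"
  shows "definable_pred \<tau> (\<lambda>M s. \<exists>t \<in> tuples (Dom M) k. X M (block_upd s m t))"
proof (induction k arbitrary: m)
  case 0
  have "block_upd s m [] = s" for s :: "nat \<Rightarrow> 'a" and m by (auto simp: block_upd_def fun_eq_iff)
  then show ?case using assms by (simp add: tuples_def)
next
  case (Suc k)
  have upd: "block_upd (s(m := a)) (Suc m) t = block_upd s m (a # t)" for s :: "nat \<Rightarrow> 'a" and a m t
    by (auto simp: block_upd_def fun_eq_iff nth_Cons' Suc_diff_Suc)
  show ?case
  proof (rule definable_pred_cong[OF definable_Ex[OF Suc[of "Suc m"], of m]])
    fix M and s :: "nat \<Rightarrow> 'a"
    show "(\<exists>a\<in>Dom M. \<exists>t\<in>tuples (Dom M) k. X M (block_upd (s(m := a)) (Suc m) t)) \<longleftrightarrow>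
      (\<exists>t\<in>tuples (Dom M) (Suc k). X M (block_upd s m t))"
      unfolding upd
    proof
      assume "\<exists>a\<in>Dom M. \<exists>t\<in>tuples (Dom M) k. X M (block_upd s m (a # t))"
      then obtain a t where "a \<in> Dom M" "t \<in> tuples (Dom M) k" "X M (block_upd s m (a # t))"
        by auto
      then show "\<exists>t\<in>tuples (Dom M) (Suc k). X M (block_upd s m t)"
        by (intro bexI[of _ "a # t"]) (auto simp: tuples_def)
    next
      assume "\<exists>t\<in>tuples (Dom M) (Suc k). X M (block_upd s m t)"
      then obtain t where t: "t \<in> tuples (Dom M) (Suc k)" "X M (block_upd s m t)" by auto
      then obtain a u where "t = a # u" by (auto simp: tuples_def length_Suc_conv)
      with t show "\<exists>a\<in>Dom M. \<exists>t\<in>tuples (Dom M) k. X M (block_upd s m (a # t))"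
        by (intro bexI[of _ a] bexI[of _ u]) (auto simp: tuples_def)
    qed
  qed
qed

text \<open>The defining formula may have free variables. Closing it by existential quantifiers is
  harmless, because its truth does not depend on the assignment and the domain is nonempty.\<close>

lemma definable_in_FO_le:
  assumes "definable_pred \<tau> (\<lambda>M s. P M)" "K = {M. br_model \<tau> M \<and> P M}"
  shows "definable_in (FO {le_rel} {}) \<tau> K"
proof -
  obtain \<phi> where \<phi>: "wf_fm {le_rel} {} \<tau> \<phi>"
    "\<And>M s. br_model \<tau> M \<Longrightarrow> range s \<subseteq> Dom M \<Longrightarrow> sat M s \<phi> \<longleftrightarrow> P M"
    using assms(1) unfolding definable_pred_def by blast
  define \<psi> where "\<psi> xs = foldr Ex xs \<phi>" for xs
  have wf: "wf_fm {le_rel} {} \<tau> (\<psi> xs)" for xs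
    using \<phi>(1) by (induction xs) (auto simp: \<psi>_def)
  have fv: "fv (\<psi> xs) = fv \<phi> - set xs" for xs
    by (induction xs) (auto simp: \<psi>_def)
  have sat: "sat M s (\<psi> xs) \<longleftrightarrow> P M" if "br_model \<tau> M" "range s \<subseteq> Dom M" for M s xs
    using that(2)
  proof (induction xs arbitrary: s)
    case Nil
    then show ?case using \<phi>(2) that by (simp add: \<psi>_def)
  next
    case (Cons x xs)
    have "sat M (s(x := a)) (\<psi> xs) \<longleftrightarrow> P M" if "a \<in> Dom M" for a
      using Cons.prems that by (intro Cons.IH) auto
    moreover have "Dom M \<noteq> {}" using \<open>br_model \<tau> M\<close> by (auto simp: br_model_def)
    ultimately show ?case by (auto simp: \<psi>_def)
  qed
  obtain xs where xs: "set xs = fv \<phi>" using finite_fv finite_list by blast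
  have "models M (\<psi> xs) \<longleftrightarrow> P M" if M: "br_model \<tau> M" for M
  proof -
    obtain a where "a \<in> Dom M" using M by (auto simp: br_model_def)
    then have "range (\<lambda>_. a) \<subseteq> Dom M" by auto
    with sat[OF M] show ?thesis unfolding models_def by meson
  qed
  then show ?thesis
    unfolding definable_in_def FO_def using wf fv xs assms(2) by (intro bexI[of _ "\<psi> xs"]) auto
qed

text \<open>Satisfaction in a structure whose elements are coded by a label from a finite set and \<open>d\<close>
  elements of \<open>M\<close>: the variable \<open>v\<close> of the formula becomes the block of variables
  \<open>v * d, \<dots>, v * d + d - 1\<close>.\<close>

lemma definable_isat:
  fixes g :: "'a br_struct \<Rightarrow> 'l \<Rightarrow> 'a list \<Rightarrow> 'b" and d :: nat
  defines "val \<equiv> \<lambda>\<rho> M s v. g M (\<rho> v) (map s [v * d..<v * d + d])"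
  assumes F: "\<And>r. r < m \<Longrightarrow> finite (F r)" "\<And>r. r < m \<Longrightarrow> F r \<subseteq> FF"
    and U: "\<And>M r. br_model \<tau> M \<Longrightarrow> r < m \<Longrightarrow> U M r = {g M l t | l t. l \<in> F r \<and> t \<in> tuples (Dom M) d \<and> valid M l t}"
    and valid: "\<And>l x. l \<in> FF \<Longrightarrow> definable_pred \<tau> (\<lambda>M s. valid M l (map s [x * d..<x * d + d]))"
    and eq: "\<And>\<rho> x y. range \<rho> \<subseteq> FF \<Longrightarrow> definable_pred \<tau> (\<lambda>M s. val \<rho> M s x = val \<rho> M s y)"
    and rel: "\<And>\<rho> i xs. range \<rho> \<subseteq> FF \<Longrightarrow> i < length \<tau> \<Longrightarrow> length xs = \<tau> ! i \<Longrightarrow>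
      definable_pred \<tau> (\<lambda>M s. R M i (map (val \<rho> M s) xs))"
    and num: "\<And>\<rho> S xs. range \<rho> \<subseteq> FF \<Longrightarrow> S \<in> B \<Longrightarrow> length xs = fst S \<Longrightarrow>
      definable_pred \<tau> (\<lambda>M s. N M S (map (val \<rho> M s) xs))"
    and wf: "wf_fm B {} \<tau> \<phi>" and depth: "qd \<phi> \<le> m" and \<rho>: "range \<rho> \<subseteq> FF"
  shows "definable_pred \<tau> (\<lambda>M s. isat (U M) (R M) (N M) (val \<rho> M s) \<phi>)"
  using wf depth \<rho>
proof (induction \<phi> arbitrary: \<rho>)
  case (Ex x \<phi>)
  have r: "qd \<phi> < m" using Ex.prems by simp
  \<comment> \<open>Rebinding the variable \<open>x\<close> amounts to relabelling it and
    overwriting its block; the other blocks are disjoint from it and stay intact.\<close>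
  have upd: "(val \<rho> M s)(x := g M l t) = val (\<rho>(x := l)) M (block_upd s (x * d) t)"
    if "length t = d" for \<rho> and M :: "'a br_struct" and s l t
  proof
    fix v
    have same: "map (block_upd s (x * d) t) [x * d..<x * d + d] = t"
      using that by (intro nth_equalityI) (auto simp: block_upd_def)
    have other: "map (block_upd s (x * d) t) [v * d..<v * d + d] = map s [v * d..<v * d + d]"
      if "v \<noteq> x"
    proof -
      have "\<not> (x * d \<le> u \<and> u < x * d + d)" if u: "v * d \<le> u" "u < v * d + d" for u
      proof
        assume u': "x * d \<le> u \<and> u < x * d + d"
        have "d > 0" using u by auto
        then have "u div d = v" "u div d = x"
          using u u' by (auto intro!: div_nat_eqI simp: algebra_simps)
        with \<open>v \<noteq> x\<close> show False by simp
      qed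
      with \<open>length t = d\<close> show ?thesis by (intro map_cong) (auto simp: block_upd_def)
    qed
    show "((val \<rho> M s)(x := g M l t)) v = val (\<rho>(x := l)) M (block_upd s (x * d) t) v"
    proof (cases "v = x")
      case True
      then show ?thesis by (simp only: val_def fun_upd_same same)
    next
      case False
      then show ?thesis
        by (simp only: val_def fun_upd_other[OF False] other[OF False])
    qed
  qed
  have self: "map (block_upd s (x * d) t) [x * d..<x * d + d] = t" if "length t = d" for s and t :: "'a list"
    using that by (intro nth_equalityI) (auto simp: block_upd_def)
  \<comment> \<open>The label of \<open>x\<close> is not stored in the model: it is chosen by a
    disjunction over a finite set, and only the \<open>d\<close> coordinates are quantified.\<close>
  have "definable_pred \<tau> (\<lambda>M s. \<exists>l \<in> F (qd \<phi>). \<exists>t \<in> tuples (Dom M) d.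
      valid M l (map (block_upd s (x * d) t) [x * d..<x * d + d]) \<and>
      isat (U M) (R M) (N M) (val (\<rho>(x := l)) M (block_upd s (x * d) t)) \<phi>)"
  proof (intro definable_finite_Disj F r)
    fix l assume l: "l \<in> F (qd \<phi>)"
    with F(2)[OF r] have "l \<in> FF" by auto
    with Ex.prems have "range (\<rho>(x := l)) \<subseteq> FF" by auto
    then have "definable_pred \<tau> (\<lambda>M s. valid M l (map s [x * d..<x * d + d]) \<and>
      isat (U M) (R M) (N M) (val (\<rho>(x := l)) M s) \<phi>)"
      using Ex.prems \<open>l \<in> FF\<close> by (intro definable_Conj valid Ex.IH) auto
    then show "definable_pred \<tau> (\<lambda>M s. \<exists>t \<in> tuples (Dom M) d.
      valid M l (map (block_upd s (x * d) t) [x * d..<x * d + d]) \<and>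
      isat (U M) (R M) (N M) (val (\<rho>(x := l)) M (block_upd s (x * d) t)) \<phi>)"
      by (rule definable_Ex_block)
  qed
  then show ?case
  proof (rule definable_pred_cong)
    fix M :: "'a br_struct" and s assume M: "br_model \<tau> M"
    show "(\<exists>l \<in> F (qd \<phi>). \<exists>t \<in> tuples (Dom M) d.
      valid M l (map (block_upd s (x * d) t) [x * d..<x * d + d]) \<and>
      isat (U M) (R M) (N M) (val (\<rho>(x := l)) M (block_upd s (x * d) t)) \<phi>) \<longleftrightarrow>
      isat (U M) (R M) (N M) (val \<rho> M s) (Ex x \<phi>)"
      using upd[where M = M] self by (auto simp: U[OF M r] tuples_def) metis+
  qed
qed (auto simp: eq rel num definable_Neg definable_Conj)

section \<open>Padding\<close>

text \<open>Truth of \<open>\<phi>\<close> in the model of size \<open>p (card (Dom M))\<close> obtained from \<open>M\<close> by adding isolated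
  elements in such a way that the element of rank \<open>i\<close> gets the rank \<open>p i\<close>.\<close>

definition padded_sat :: "(nat \<Rightarrow> nat) \<Rightarrow> 'a br_struct \<Rightarrow> 'a fm \<Rightarrow> bool" where
  "padded_sat p M \<phi> \<longleftrightarrow> isat (\<lambda>_. {..<p (card (Dom M))})
     (\<lambda>i t. t \<in> map (p \<circ> rank M) ` (rels M ! i)) (\<lambda>S t. t \<in> snd S) (\<lambda>_. 0) \<phi>"

definition is_padding :: "(nat \<Rightarrow> nat) \<Rightarrow> 'a br_struct \<Rightarrow> 'a br_struct \<Rightarrow> bool" where
  "is_padding p M M' \<longleftrightarrow> Dom M \<subseteq> Dom M' \<and> rels M' = rels M \<and>
     card (Dom M') = p (card (Dom M)) \<and> (\<forall>a \<in> Dom M. rank M' a = p (rank M a))"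

lemma br_modelD:
  assumes "br_model \<tau> M"
  shows "finite (Dom M)" "Dom M \<noteq> {}" "bij_betw (rank M) (Dom M) {..<card (Dom M)}"
    "inj_on (rank M) (Dom M)" "i < length \<tau> \<Longrightarrow> rels M ! i \<subseteq> tuples (Dom M) (\<tau> ! i)"
    "a \<in> Dom M \<Longrightarrow> rank M a < card (Dom M)"
  using assms by (auto simp: br_model_def bij_betw_def)

text \<open>The new elements come from the infinite type and take exactly the ranks below
  \<open>p n\<close> that \<open>p\<close> skips. Their number \<open>p n - n\<close> is a true
  difference, as a strictly increasing \<open>p\<close> satisfies
  \<open>n \<le> p n\<close>.\<close>

lemma padding_exists:
  fixes M :: "'a::infinite br_struct"
  assumes M: "br_model \<tau> M" and p: "strict_mono p"
  shows "\<exists>M'. br_model \<tau> M' \<and> is_padding p M M'"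
proof -
  define n where "n = card (Dom M)"
  note fin = br_modelD(1)[OF M]
  have np: "n \<le> p n" using p by (rule strict_mono_imp_increasing)
  have pinj: "inj p" using p by (rule strict_mono_imp_inj_on)
  have "infinite (UNIV - Dom M)" using fin infinite_UNIV by (simp add: Diff_infinite_finite)
  then obtain E where E: "finite E" "card E = p n - n" "E \<subseteq> UNIV - Dom M"
    by (meson infinite_arbitrarily_large)
  define T where "T = {..<p n} - p ` {..<n}"
  have sub: "p ` {..<n} \<subseteq> {..<p n}" using p by (auto simp: strict_mono_def)
  have "card T = p n - n"
    unfolding T_def using sub pinj by (simp add: card_Diff_subset card_image inj_on_subset)
  then obtain e where e: "bij_betw e E T"
    using E(1,2) finite_same_card_bij[of E T] by (auto simp: T_def)
  define f where "f a = (if a \<in> Dom M then p (rank M a) else e a)" for a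
  define M' where "M' = M\<lparr>Dom := Dom M \<union> E, rank := f\<rparr>"
  have card: "card (Dom M \<union> E) = p n"
    using E fin np by (subst card_Un_disjoint) (auto simp: n_def)
  have "bij_betw (p \<circ> rank M) (Dom M) (p ` {..<n})"
    using pinj unfolding n_def
    by (intro bij_betw_trans[OF br_modelD(3)[OF M]] inj_on_imp_bij_betw) (auto intro: inj_on_subset)
  then have "bij_betw f (Dom M) (p ` {..<n})"
    by (rule bij_betw_cong[THEN iffD1, rotated]) (auto simp: f_def)
  moreover have "bij_betw f E T"
    using e by (rule bij_betw_cong[THEN iffD1, rotated]) (use E in \<open>auto simp: f_def\<close>)
  ultimately have "bij_betw f (Dom M \<union> E) (p ` {..<n} \<union> T)"
    by (rule bij_betw_combine) (auto simp: T_def)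
  moreover have "p ` {..<n} \<union> T = {..<p n}" using sub by (auto simp: T_def)
  moreover have "tuples (Dom M) r \<subseteq> tuples (Dom M \<union> E) r" for r by (auto simp: tuples_def)
  ultimately have "br_model \<tau> M'"
    using M E(1) card by (auto simp: br_model_def M'_def subset_iff)
  moreover have "is_padding p M M'"
    using card by (auto simp: is_padding_def M'_def f_def n_def)
  ultimately show ?thesis by blast
qed

lemma models_sentence:
  assumes "fv \<phi> = {}" "range s \<subseteq> Dom M"
  shows "models M \<phi> \<longleftrightarrow> sat M s \<phi>"
  using assms sat_fv_cong[of \<phi>] unfolding models_def by (metis empty_iff)

text \<open>\<open>rank M'\<close> is an isomorphism from the padding onto the initial segment on
  which \<open>padded_sat\<close> is evaluated, so the game invariant needs no depth.\<close>

lemma models_padding: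
  assumes M: "br_model \<tau> M" and M': "br_model \<tau> M'" and pad: "is_padding p M M'"
    and \<phi>: "wf_fm B {} \<tau> \<phi>" "fv \<phi> = {}"
  shows "models M' \<phi> \<longleftrightarrow> padded_sat p M \<phi>"
proof -
  define f where "f = rank M'"
  have f: "bij_betw f (Dom M') {..<card (Dom M')}" "inj_on f (Dom M')"
    using br_modelD[OF M'] by (simp_all add: f_def)
  have fM: "f a = p (rank M a)" if "a \<in> Dom M" for a
    using pad that by (auto simp: f_def is_padding_def)
  have sub: "Dom M \<subseteq> Dom M'" using pad by (simp add: is_padding_def)
  \<comment> \<open>The assignment constantly 0 in \<open>padded_sat\<close> has to correspond to an
    element, the one of rank 0.\<close>
  have "0 < card (Dom M')" using br_modelD[OF M'] by (simp add: card_gt_0_iff)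
  then obtain a where a: "a \<in> Dom M'" "f a = 0"
    using f(1) unfolding bij_betw_def by (metis imageE lessThan_iff)
  define s where "s = (\<lambda>_::nat. a)"
  have "models M' \<phi> \<longleftrightarrow> sat M' s \<phi>"
    using a \<phi> by (intro models_sentence) (auto simp: s_def)
  also have "\<dots> \<longleftrightarrow> isat (\<lambda>_. Dom M') (\<lambda>i t. t \<in> rels M' ! i) (\<lambda>S t. map f t \<in> snd S) s \<phi>"
    unfolding f_def by (rule sat_isat[OF \<phi>(1)])
  also have "\<dots> \<longleftrightarrow> padded_sat p M \<phi>"
    unfolding padded_sat_def
  proof (rule isat_game[where I = "\<lambda>_ s t. range s \<subseteq> Dom M' \<and> t = f \<circ> s" and m = "qd \<phi>", OF _ _ _ _ _ _ \<phi>(1)])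
    fix s and t :: "nat \<Rightarrow> nat" and b and x :: nat
    assume st: "range s \<subseteq> Dom M' \<and> t = f \<circ> s" and "b \<in> {..<p (card (Dom M))}"
    then have "b \<in> {..<card (Dom M')}" using pad by (simp add: is_padding_def)
    then obtain a where "a \<in> Dom M'" "f a = b" using f(1) unfolding bij_betw_def by (metis imageE)
    then show "\<exists>a\<in>Dom M'. range (s(x := a)) \<subseteq> Dom M' \<and> t(x := b) = f \<circ> s(x := a)"
      using st by (intro bexI[of _ a]) auto
  next
    fix s and t :: "nat \<Rightarrow> nat" and a and x :: nat
    assume st: "range s \<subseteq> Dom M' \<and> t = f \<circ> s" and "a \<in> Dom M'"
    moreover from this have "f a \<in> {..<p (card (Dom M))}"
      using f(1) pad unfolding bij_betw_def is_padding_def by (metis image_eqI)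
    ultimately show "\<exists>b\<in>{..<p (card (Dom M))}. range (s(x := a)) \<subseteq> Dom M' \<and> t(x := b) = f \<circ> s(x := a)"
      by (intro bexI[of _ "f a"]) auto
  next
    fix s and t :: "nat \<Rightarrow> nat" and x y :: nat
    assume st: "range s \<subseteq> Dom M' \<and> t = f \<circ> s"
    then show "s x = s y \<longleftrightarrow> t x = t y"
      using f(2) by (auto dest!: inj_onD)
  next
    fix s and t :: "nat \<Rightarrow> nat" and i and xs :: "nat list"
    assume st: "range s \<subseteq> Dom M' \<and> t = f \<circ> s" and i: "i < length \<tau>"
    have eq: "map (p \<circ> rank M) u = map f u" if "u \<in> rels M ! i" for u
    proof -
      have "set u \<subseteq> Dom M" using that br_modelD(5)[OF M i] by (auto simp: tuples_def)
      then show ?thesis by (auto simp: subset_iff fM)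
    qed
    have "map f u = map f (map s xs) \<longleftrightarrow> u = map s xs" if "u \<in> rels M ! i" for u
    proof
      assume "map f u = map f (map s xs)"
      moreover have "inj_on f (set u \<union> set (map s xs))"
        using that st br_modelD(5)[OF M i] sub
        by (intro inj_on_subset[OF f(2)]) (auto simp: tuples_def)
      ultimately show "u = map s xs" by (rule map_inj_on)
    qed simp
    then have "map t xs = map (p \<circ> rank M) u \<longleftrightarrow> u = map s xs" if "u \<in> rels M ! i" for u
      unfolding eq[OF that] using that st by (metis map_map)
    then show "map s xs \<in> rels M' ! i \<longleftrightarrow> map t xs \<in> map (p \<circ> rank M) ` (rels M ! i)"
      using pad unfolding is_padding_def image_iff by metis
  qed (use a in \<open>auto simp: s_def comp_def\<close>)
  finally show ?thesis .
qed

text \<open>Cutting the padding back to the old elements restores the old ranks: a rank counts the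
  elements below, and an increasing \<open>p\<close> keeps the order of the old elements.\<close>

lemma padding_in_quantifier:
  assumes Q: "br_quantifier Q" "universe_independent Q"
    and M: "br_model (fst Q) M" and M': "br_model (fst Q) M'"
    and p: "strict_mono p" and pad: "is_padding p M M'"
  shows "M \<in> snd Q \<longleftrightarrow> M' \<in> snd Q"
proof -
  let ?U = "Dom M" and ?R = "relativize M' (Dom M)"
  have sub: "?U \<subseteq> Dom M'" and rels: "rels M' = rels M" using pad by (simp_all add: is_padding_def)
  have "inj_on (rank M') ?U" using br_modelD(4)[OF M'] sub by (rule inj_on_subset)
  moreover have "{b \<in> ?U. rank M' b < rank M' a} = {b \<in> ?U. rank M b < rank M a}" if "a \<in> ?U" for a
    using that pad p by (auto simp: is_padding_def strict_mono_less)
  ultimately have rank: "rank ?R a = rank M a" if "a \<in> ?U" for a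
    using that br_modelD(1)[OF M] order_bij_is_count[OF br_modelD(3)[OF M] that]
    by (simp add: relativize_def rank_on_eq)
  have R: "rels ?R ! i = rels M ! i" if "i < length (fst Q)" for i
    using M that br_modelD(5)[OF M that] rels by (auto simp: relativize_def br_model_def tuples_def)
  have model: "br_model (fst Q) ?R"
    using M' br_modelD(2)[OF M] sub by (rule br_model_relativize)
  have dom: "Dom ?R = ?U" by (simp add: relativize_def)
  \<comment> \<open>The ranks agree on the domain but may differ outside it, hence an isomorphism
    instead of an equation.\<close>
  have "br_iso (fst Q) M ?R" "br_iso (fst Q) ?R M"
    unfolding br_iso_def dom using rank R by (auto intro!: exI[of _ id])
  then have "M \<in> snd Q \<longleftrightarrow> ?R \<in> snd Q"
    using Q(1) M model unfolding br_quantifier_def by blast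
  also have "\<dots> \<longleftrightarrow> M' \<in> snd Q"
    using Q(2) M' br_modelD(2)[OF M] sub br_modelD(5)[OF M] rels
    unfolding universe_independent_def by metis
  finally show ?thesis .
qed


section \<open>Eliminating definable quantifiers\<close>

text \<open>Substitution without renaming: \<open>x\<close> is quantified again and equated with
  \<open>z\<close>, which for \<open>x \<noteq> z\<close> still has its old value.\<close>

lemma definable_assign:
  assumes "definable_pred \<tau> X" "x \<noteq> z"
  shows "definable_pred \<tau> (\<lambda>M s. X M (s(x := s z)))"
proof (rule definable_pred_cong)
  show "definable_pred \<tau> (\<lambda>M s. \<exists>a \<in> Dom M. (s(x := a)) x = (s(x := a)) z \<and> X M (s(x := a)))"
    using assms(1) by (intro definable_Ex definable_Conj definable_Eq)
qed (use assms(2) in auto)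

text \<open>Disjointness of the two lists makes the simultaneous substitution equal to a sequence of
  single ones.\<close>

lemma definable_upds:
  assumes "definable_pred \<tau> X" "length xs = length zs" "set xs \<inter> set zs = {}"
  shows "definable_pred \<tau> (\<lambda>M s. X M (upds s xs (map s zs)))"
  using assms(2,1,3)
proof (induction xs zs arbitrary: X rule: list_induct2)
  case Nil
  have "upds s [] [] = s" for s :: "nat \<Rightarrow> 'a" by (simp add: upds_def fun_eq_iff)
  then show ?case using Nil by simp
next
  case (Cons x xs z zs)
  have "upds s (x # xs) (map s (z # zs)) = (upds s xs (map s zs))(x := upds s xs (map s zs) z)"
    for s :: "nat \<Rightarrow> 'a"
  proof -
    have "map_of (zip xs (map s zs)) z = None"
      using Cons.prems Cons.hyps by (simp add: map_of_zip_is_None)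
    then show ?thesis by (auto simp: upds_def fun_eq_iff)
  qed
  moreover have "definable_pred \<tau> (\<lambda>M s. X M (s(x := s z)))"
    using Cons.prems by (intro definable_assign) auto
  then have "definable_pred \<tau> (\<lambda>M s. X M ((upds s xs (map s zs))(x := upds s xs (map s zs) z)))"
    using Cons.prems by (intro Cons.IH[where X = "\<lambda>M s. X M (s(x := s z))"]) auto
  ultimately show ?case by (simp only:)
qed

section \<open>Structures interpreted by formulas\<close>

definition interp :: "(nat list \<times> 'a fm) list \<Rightarrow> 'a br_struct \<Rightarrow> (nat \<Rightarrow> 'a) \<Rightarrow> 'a br_struct" where
  "interp args M s = \<lparr>Dom = Dom M,
     rels = map (\<lambda>(xs, \<psi>). {as \<in> tuples (Dom M) (length xs). sat M (upds s xs as) \<psi>}) args,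
     rank = rank M\<rparr>"

lemma dom_interp: "Dom (interp args M s) = Dom M"
  by (simp add: interp_def)

lemma interp_cong:
  assumes "\<And>xs \<psi> as. (xs, \<psi>) \<in> set args \<Longrightarrow> as \<in> tuples (Dom M) (length xs) \<Longrightarrow>
    sat M (upds s xs as) \<psi> \<longleftrightarrow> sat M (upds t xs as) \<psi>"
  shows "interp args M s = interp args M t"
  using assms unfolding interp_def by fastforce

text \<open>The variables of \<open>\<theta>\<close> are shifted beyond those of the interpreting formulas.\<close>

lemma definable_sat_interp:
  assumes args: "\<And>xs \<psi>. (xs, \<psi>) \<in> set args \<Longrightarrow> wf_fm {le_rel} {} \<tau> \<psi> \<and> (\<forall>v \<in> fv \<psi> \<union> set xs. v < n)"
    and \<theta>: "wf_fm {le_rel} {} (map (\<lambda>(xs, \<psi>). length xs) args) \<theta>"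
  shows "definable_pred \<tau> (\<lambda>M s. sat (interp args M s) (\<lambda>v. s (v + n)) \<theta>)"
  using \<theta>
proof (induction \<theta>)
  case (Eq x y)
  then show ?case by (simp add: definable_Eq)
next
  case (Rel i ys)
  obtain xs \<psi> where arg: "args ! i = (xs, \<psi>)" by fastforce
  have i: "i < length args" and len: "length ys = length xs" using Rel arg by auto
  have mem: "(xs, \<psi>) \<in> set args" using arg i by (metis nth_mem)
  have "definable_pred \<tau> (\<lambda>M s. sat M s \<psi>)"
    using args[OF mem] by (intro definable_predI[of _ \<psi>]) auto
  then have "definable_pred \<tau> (\<lambda>M s. sat M (upds s xs (map s (map (\<lambda>v. v + n) ys))) \<psi>)"
    using len args[OF mem] by (intro definable_upds) fastforce+
  then show ?case
  proof (rule definable_pred_cong)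
    fix M :: "'a br_struct" and s :: "nat \<Rightarrow> 'a" assume "range s \<subseteq> Dom M"
    then show "sat M (upds s xs (map s (map (\<lambda>v. v + n) ys))) \<psi> \<longleftrightarrow>
        sat (interp args M s) (\<lambda>v. s (v + n)) (Rel i ys)"
      using i arg len by (auto simp: interp_def tuples_def comp_def)
  qed
next
  case (Num S ys)
  then show ?case
    by (intro definable_predI[of _ "Num S (map (\<lambda>v. v + n) ys)"]) (auto simp: interp_def comp_def)
next
  case (Neg \<theta>)
  then show ?case by (simp add: definable_Neg)
next
  case (Conj \<theta> \<theta>')
  then show ?case by (simp add: definable_Conj)
next
  case (Ex x \<theta>)
  have "interp args M (s(x + n := a)) = interp args M s" for M :: "'a br_struct" and s a
  proof (rule interp_cong)
    fix xs \<psi> and as :: "'a list" assume "(xs, \<psi>) \<in> set args"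
    then show "sat M (upds (s(x + n := a)) xs as) \<psi> \<longleftrightarrow> sat M (upds s xs as) \<psi>"
      using args[of xs \<psi>] by (intro sat_fv_cong) (auto simp: upds_def split: option.split)
  qed
  moreover have "(\<lambda>v. (s(x + n := a)) (v + n)) = (\<lambda>v. s (v + n))(x := a)" for s :: "nat \<Rightarrow> 'a" and a
    by (auto simp: fun_eq_iff)
  moreover have "definable_pred \<tau> (\<lambda>M s. \<exists>a \<in> Dom M. sat (interp args M (s(x + n := a))) (\<lambda>v. (s(x + n := a)) (v + n)) \<theta>)"
    using Ex.prems by (intro definable_Ex[where x = "x + n" and X = "\<lambda>M s. sat (interp args M s) (\<lambda>v. s (v + n)) \<theta>"] Ex.IH) auto
  ultimately show ?case by (simp add: dom_interp)
qed simp

lemma br_model_interp: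
  assumes "br_model \<tau> M"
  shows "br_model (map (\<lambda>(xs, \<psi>). length xs) args) (interp args M s)"
  using assms by (auto simp: br_model_def interp_def split: prod.split)

text \<open>Quantifiers are eliminated from the inside out. In the case \<open>Qnt\<close>, the
  induction hypothesis supplies pure order formulas for the arguments, and the sentence that defines
  \<open>Q\<close> is evaluated in the structure that they interpret.\<close>

lemma definable_sat:
  assumes \<Q>: "\<And>Q. Q \<in> \<Q> \<Longrightarrow> definable_in (FO {le_rel} {}) (fst Q) (snd Q)"
    and "wf_fm {le_rel} \<Q> \<tau> \<phi>"
  shows "definable_pred \<tau> (\<lambda>M s. sat M s \<phi>)"
  using assms(2)
proof (induction \<phi>)
  case (Eq x y)
  then show ?case by (simp add: definable_Eq)
next
  case (Rel i xs)
  then show ?case by (simp add: definable_Rel)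
next
  case (Num S xs)
  then show ?case by (intro definable_predI[of _ "Num S xs"]) auto
next
  case (Neg \<phi>)
  then show ?case by (simp add: definable_Neg)
next
  case (Conj \<phi> \<psi>)
  then show ?case by (simp add: definable_Conj)
next
  case (Ex x \<phi>)
  then have "definable_pred \<tau> (\<lambda>M s. sat M s \<phi>)" by simp
  from definable_Ex[OF this] show ?case by simp
next
  case (Qnt Q args)
  have "\<exists>\<chi>. wf_fm {le_rel} {} \<tau> \<chi> \<and>
      (\<forall>M s. br_model \<tau> M \<and> range s \<subseteq> Dom M \<longrightarrow> (sat M s \<chi> \<longleftrightarrow> sat M s \<psi>))"
    if "(xs, \<psi>) \<in> set args" for xs \<psi>
    using Qnt.IH[OF that, of \<psi>] Qnt.prems that unfolding definable_pred_def by fastforce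
  then have "\<forall>\<psi> \<in> snd ` set args. \<exists>\<chi>. wf_fm {le_rel} {} \<tau> \<chi> \<and>
      (\<forall>M s. br_model \<tau> M \<and> range s \<subseteq> Dom M \<longrightarrow> (sat M s \<chi> \<longleftrightarrow> sat M s \<psi>))"
    by auto
  then have "\<exists>\<chi>. \<forall>\<psi> \<in> snd ` set args. wf_fm {le_rel} {} \<tau> (\<chi> \<psi>) \<and>
      (\<forall>M s. br_model \<tau> M \<and> range s \<subseteq> Dom M \<longrightarrow> (sat M s (\<chi> \<psi>) \<longleftrightarrow> sat M s \<psi>))"
    by (rule bchoice)
  then obtain \<chi> where \<chi>: "\<And>\<psi>. \<psi> \<in> snd ` set args \<Longrightarrow> wf_fm {le_rel} {} \<tau> (\<chi> \<psi>)"
    "\<And>\<psi> M s. \<psi> \<in> snd ` set args \<Longrightarrow> br_model \<tau> M \<Longrightarrow> range s \<subseteq> Dom M \<Longrightarrow>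
      sat M s (\<chi> \<psi>) \<longleftrightarrow> sat M s \<psi>"
    by blast
  define args' where "args' = map (\<lambda>(xs, \<psi>). (xs, \<chi> \<psi>)) args"
  have vocab: "map (\<lambda>(xs, \<psi>). length xs) args' = fst Q"
    using Qnt.prems by (auto simp: args'_def comp_def split_def)
  obtain \<theta> where \<theta>: "wf_fm {le_rel} {} (fst Q) \<theta>" "fv \<theta> = {}"
    "snd Q = {M. br_model (fst Q) M \<and> models M \<theta>}"
    using \<Q>[of Q] Qnt.prems by (auto simp: definable_in_def FO_def)
  define V where "V = (\<Union>(xs, \<psi>) \<in> set args'. fv \<psi> \<union> set xs)"
  have "finite V" by (auto simp: V_def finite_fv)
  then obtain n where n: "\<forall>v \<in> V. v < n"
    using finite_nat_set_iff_bounded by auto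
  have "definable_pred \<tau> (\<lambda>M s. sat (interp args' M s) (\<lambda>v. s (v + n)) \<theta>)"
  proof (rule definable_sat_interp)
    fix xs \<psi> assume "(xs, \<psi>) \<in> set args'"
    then show "wf_fm {le_rel} {} \<tau> \<psi> \<and> (\<forall>v\<in>fv \<psi> \<union> set xs. v < n)"
      using n \<chi>(1) by (fastforce simp: V_def args'_def)
  qed (use \<theta> vocab in simp)
  then show ?case
  proof (rule definable_pred_cong)
    fix M :: "'a br_struct" and s :: "nat \<Rightarrow> 'a" assume M: "br_model \<tau> M" and s: "range s \<subseteq> Dom M"
    have "interp args' M s = interp args M s"
    proof -
      have "sat M (upds s xs as) (\<chi> \<psi>) \<longleftrightarrow> sat M (upds s xs as) \<psi>"
        if arg: "(xs, \<psi>) \<in> set args" and as: "as \<in> tuples (Dom M) (length xs)" for xs \<psi> as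
      proof -
        have "upds s xs as v \<in> Dom M" for v
          using as s by (auto simp: upds_def tuples_def split: option.split dest!: map_of_SomeD set_zip_rightD)
        then show ?thesis using \<chi>(2)[OF _ M] arg by force
      qed
      then show ?thesis unfolding interp_def args'_def by fastforce
    qed
    moreover have "sat (interp args' M s) (\<lambda>v. s (v + n)) \<theta> \<longleftrightarrow> models (interp args' M s) \<theta>"
      using \<theta>(2) s by (intro models_sentence[symmetric]) (auto simp: interp_def)
    moreover have "br_model (fst Q) (interp args' M s)"
      using br_model_interp[OF M] vocab by metis
    ultimately show "sat (interp args' M s) (\<lambda>v. s (v + n)) \<theta> \<longleftrightarrow> sat M s (Qnt Q args)"
      using \<theta>(3) by (simp add: interp_def)
  qed
qed

lemma definable_in_FO_le_sentence:
  assumes "definable_pred \<tau> (\<lambda>M s. sat M s \<phi>)" "fv \<phi> = {}" "K = {M. br_model \<tau> M \<and> models M \<phi>}"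
  shows "definable_in (FO {le_rel} {}) \<tau> K"
proof (rule definable_in_FO_le[OF _ assms(3)])
  show "definable_pred \<tau> (\<lambda>M s. models M \<phi>)"
    by (rule definable_pred_cong[OF assms(1)]) (simp add: models_sentence assms(2))
qed

text \<open>By universe independence, the padding decides whether the original model belongs to
  \<open>Q\<close>, and \<open>collapse\<close> defines truth in the padding from the order. One
  \<open>p\<close> per sentence is enough, because \<open>Q\<close> is defined by a single
  sentence.\<close>

theorem RI_equiv_FO_le:
  fixes B :: "numrel set"
  assumes collapse: "\<And>\<tau> \<phi>. wf_fm B {} \<tau> (\<phi> :: 'a::infinite fm) \<Longrightarrow>
    \<exists>p. strict_mono p \<and> definable_pred \<tau> (\<lambda>M s. padded_sat p M \<phi>)"
  shows "logic_equiv (RI (FO B {} :: 'a logic)) (FO {le_rel} {})"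
proof -
  define \<Q> :: "'a br_quant set"
    where "\<Q> = {Q. br_quantifier Q \<and> universe_independent Q \<and> definable_in (FO B {}) (fst Q) (snd Q)}"
  have RI: "RI (FO B {}) = FO {le_rel} \<Q>" by (simp add: RI_def \<Q>_def)
  have \<Q>: "definable_in (FO {le_rel} {}) (fst Q) (snd Q)" if Q\<Q>: "Q \<in> \<Q>" for Q
  proof -
    have Q: "br_quantifier Q" "universe_independent Q" using Q\<Q> by (auto simp: \<Q>_def)
    obtain \<phi> where \<phi>: "wf_fm B {} (fst Q) \<phi>" "fv \<phi> = {}"
      "snd Q = {M. br_model (fst Q) M \<and> models M \<phi>}"
      using Q\<Q> unfolding \<Q>_def definable_in_def FO_def by blast
    obtain p where p: "strict_mono p" "definable_pred (fst Q) (\<lambda>M s. padded_sat p M \<phi>)"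
      using collapse[OF \<phi>(1)] by blast
    have "M \<in> snd Q \<longleftrightarrow> padded_sat p M \<phi>" if M: "br_model (fst Q) M" for M
    proof -
      obtain M' where M': "br_model (fst Q) M'" "is_padding p M M'"
        using padding_exists[OF M p(1)] by blast
      have "M \<in> snd Q \<longleftrightarrow> M' \<in> snd Q" using padding_in_quantifier Q M M' p(1) by blast
      also have "\<dots> \<longleftrightarrow> padded_sat p M \<phi>"
        using models_padding[OF M M' \<phi>(1,2)] M'(1) \<phi>(3) by auto
      finally show ?thesis .
    qed
    moreover have "br_model (fst Q) M" if "M \<in> snd Q" for M
      using Q(1) that unfolding br_quantifier_def by blast
    ultimately have "snd Q = {M. br_model (fst Q) M \<and> padded_sat p M \<phi>}" by blast
    then show ?thesis by (rule definable_in_FO_le[OF p(2)])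
  qed
  have "logic_le (FO {le_rel} \<Q>) (FO {le_rel} {})"
    unfolding logic_le_def
  proof (intro allI impI)
    fix \<tau> K assume "definable_in (FO {le_rel} \<Q>) \<tau> K"
    then obtain \<phi> where "wf_fm {le_rel} \<Q> \<tau> \<phi>" "fv \<phi> = {}" "K = {M. br_model \<tau> M \<and> models M \<phi>}"
      by (auto simp: definable_in_def FO_def)
    then show "definable_in (FO {le_rel} {}) \<tau> K"
      using definable_sat[OF \<Q>] definable_in_FO_le_sentence by blast
  qed
  moreover have "logic_le (FO {le_rel} {}) (FO {le_rel} \<Q>)"
    unfolding logic_le_def definable_in_def FO_def
    by (blast intro: wf_fm_mono)
  ultimately show ?thesis by (simp add: logic_equiv_def RI)
qed

section \<open>Colored orders\<close>

text \<open>Ehrenfeucht--Fraisse equivalence of the colored intervals \<open>[x, y)\<close> and \<open>[x', y')\<close>. A move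
  splits the interval, and a new interval starts with the chosen point.\<close>

fun weq :: "nat \<Rightarrow> (nat \<Rightarrow> 'k) \<Rightarrow> nat \<Rightarrow> nat \<Rightarrow> (nat \<Rightarrow> 'k) \<Rightarrow> nat \<Rightarrow> nat \<Rightarrow> bool" where
  "weq 0 c x y c' x' y' \<longleftrightarrow> c x = c' x'"
| "weq (Suc r) c x y c' x' y' \<longleftrightarrow> c x = c' x' \<and>
     (\<forall>z \<in> {x<..<y}. \<exists>z' \<in> {x'<..<y'}. weq r c x z c' x' z' \<and> weq r c z y c' z' y') \<and>
     (\<forall>z' \<in> {x'<..<y'}. \<exists>z \<in> {x<..<y}. weq r c x z c' x' z' \<and> weq r c z y c' z' y')"

lemma weq_color: "weq r c x y c' x' y' \<Longrightarrow> c x = c' x'"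
  by (cases r) auto

lemma weq_sym: "weq r c x y c' x' y' \<longleftrightarrow> weq r c' x' y' c x y"
  by (induction r arbitrary: x y x' y') auto

lemma weq_SucD: "weq (Suc r) c x y c' x' y' \<Longrightarrow> weq r c x y c' x' y'"
proof (induction r arbitrary: x y x' y')
  case (Suc r)
  from Suc.prems have "c x = c' x'" by (rule weq_color)
  moreover have "\<exists>z' \<in> {x'<..<y'}. weq r c x z c' x' z' \<and> weq r c z y c' z' y'" if "z \<in> {x<..<y}" for z
    using Suc.prems that by (subst (asm) weq.simps(2)) (blast intro: Suc.IH)
  moreover have "\<exists>z \<in> {x<..<y}. weq r c x z c' x' z' \<and> weq r c z y c' z' y'" if "z' \<in> {x'<..<y'}" for z'
    using Suc.prems that by (subst (asm) weq.simps(2)) (blast intro: Suc.IH)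
  ultimately show ?case by simp
qed simp

lemma weq_trans: "weq r c x y c' x' y' \<Longrightarrow> weq r c' x' y' c'' x'' y'' \<Longrightarrow> weq r c x y c'' x'' y''"
proof (induction r arbitrary: x y x' y' x'' y'')
  case (Suc r)
  have "c x = c'' x''" using Suc.prems by simp
  moreover have "\<exists>z'' \<in> {x''<..<y''}. weq r c x z c'' x'' z'' \<and> weq r c z y c'' z'' y''"
    if z: "z \<in> {x<..<y}" for z
  proof -
    obtain z' where "z' \<in> {x'<..<y'}" "weq r c x z c' x' z'" "weq r c z y c' z' y'"
      using Suc.prems(1) z unfolding weq.simps(2) by blast
    moreover from this obtain z'' where "z'' \<in> {x''<..<y''}" "weq r c' x' z' c'' x'' z''" "weq r c' z' y' c'' z'' y''"
      using Suc.prems(2) unfolding weq.simps(2) by blast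
    ultimately show ?thesis using Suc.IH by blast
  qed
  moreover have "\<exists>z \<in> {x<..<y}. weq r c x z c'' x'' z'' \<and> weq r c z y c'' z'' y''"
    if z: "z'' \<in> {x''<..<y''}" for z''
  proof -
    obtain z' where "z' \<in> {x'<..<y'}" "weq r c' x' z' c'' x'' z''" "weq r c' z' y' c'' z'' y''"
      using Suc.prems(2) z unfolding weq.simps(2) by blast
    moreover from this obtain z where "z \<in> {x<..<y}" "weq r c x z c' x' z'" "weq r c z y c' z' y'"
      using Suc.prems(1) unfolding weq.simps(2) by blast
    ultimately show ?thesis using Suc.IH by blast
  qed
  ultimately show ?case by simp
qed simp

text \<open>Equal colors at equal offsets allow every move to be copied. The interval is nonempty
  because already \<open>weq 0\<close> compares its first color.\<close>

lemma weq_shift: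
  assumes "0 < k" "\<And>j. j < k \<Longrightarrow> c' (x' + j) = c (x + j)"
  shows "weq r c x (x + k) c' x' (x' + k)"
  using assms
proof (induction r arbitrary: x x' k)
  case 0
  then show ?case using 0(2)[of 0] by simp
next
  case (Suc r)
  have split: "weq r c x (x + j) c' x' (x' + j) \<and> weq r c (x + j) (x + k) c' (x' + j) (x' + k)"
    if "0 < j" "j < k" for j
  proof -
    have "weq r c (x + j) (x + j + (k - j)) c' (x' + j) (x' + j + (k - j))"
      using that Suc.prems(2) by (intro Suc.IH) (auto simp: add.assoc)
    moreover have "weq r c x (x + j) c' x' (x' + j)"
      using that Suc.prems(2) by (intro Suc.IH) auto
    ultimately show ?thesis using that by simp
  qed
  have "c x = c' x'" using Suc.prems(2)[of 0] Suc.prems(1) by simp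
  moreover have "\<exists>z' \<in> {x'<..<x' + k}. weq r c x z c' x' z' \<and> weq r c z (x + k) c' z' (x' + k)"
    if "z \<in> {x<..<x + k}" for z
    using that split[of "z - x"] by (intro bexI[of _ "x' + (z - x)"]) auto
  moreover have "\<exists>z \<in> {x<..<x + k}. weq r c x z c' x' z' \<and> weq r c z (x + k) c' z' (x' + k)"
    if "z' \<in> {x'<..<x' + k}" for z'
    using that split[of "z' - x'"] by (intro bexI[of _ "x + (z' - x')"]) auto
  ultimately show ?case by simp
qed

text \<open>At level \<open>Suc r\<close>, an interval is determined by its first color and the set
  of pairs of level \<open>r\<close> types into which it can be split. This leaves finitely many
  possibilities.\<close>

lemma weq_finite_index:
  fixes c :: "nat \<Rightarrow> 'k"
  assumes c: "finite (range c)"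
  shows "\<exists>f :: nat \<times> nat \<Rightarrow> nat. finite (range f) \<and>
    (\<forall>x y x' y'. f (x, y) = f (x', y') \<longrightarrow> weq r c x y c x' y')"
proof -
  \<comment> \<open>The invariants of higher levels live in ever larger HOL types. Recoding them as
    naturals keeps one statement for all \<open>r\<close> and gives the numeric colors that Ramsey's
    theorem expects.\<close>
  have encode: "\<exists>f :: nat \<times> nat \<Rightarrow> nat. finite (range f) \<and> (\<forall>u v. f u = f v \<longrightarrow> G u = G v)"
    if "finite (range G)" for G :: "nat \<times> nat \<Rightarrow> 't"
  proof -
    obtain h :: "'t \<Rightarrow> nat" and n where "inj_on h (range G)"
      using finite_imp_inj_to_nat_seg[OF \<open>finite (range G)\<close>] by metis
    moreover have "finite (range (h \<circ> G))" using that by (metis finite_imageI image_comp)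
    ultimately show ?thesis by (intro exI[of _ "h \<circ> G"]) (auto dest: inj_onD)
  qed
  show ?thesis
  proof (induction r)
    case 0
    have "finite (range (c \<circ> fst))" by (rule finite_subset[OF _ c]) auto
    from encode[OF this] show ?case by auto
  next
    case (Suc r)
    then obtain f :: "nat \<times> nat \<Rightarrow> nat" where fin: "finite (range f)"
      and f: "\<And>x y x' y'. f (x, y) = f (x', y') \<Longrightarrow> weq r c x y c x' y'"
      by blast
    define G where "G = (\<lambda>(x, y). (c x, (\<lambda>z. (f (x, z), f (z, y))) ` {x<..<y}))"
    have "range G \<subseteq> range c \<times> Pow (range f \<times> range f)" by (auto simp: G_def)
    then have "finite (range G)" by (rule finite_subset) (simp add: c fin)
    moreover have "weq (Suc r) c x y c x' y'" if "G (x, y) = G (x', y')" for x y x' y'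
    proof -
      have "c x = c x'"
        and eq: "(\<lambda>z. (f (x, z), f (z, y))) ` {x<..<y} = (\<lambda>z. (f (x', z), f (z, y'))) ` {x'<..<y'}"
        using that by (auto simp: G_def)
      moreover have "\<exists>z' \<in> {x'<..<y'}. weq r c x z c x' z' \<and> weq r c z y c z' y'" if "z \<in> {x<..<y}" for z
      proof -
        have "(f (x, z), f (z, y)) \<in> (\<lambda>z. (f (x', z), f (z, y'))) ` {x'<..<y'}"
          using that eq by blast
        then obtain z' where "z' \<in> {x'<..<y'}" "f (x, z) = f (x', z')" "f (z, y) = f (z', y')" by auto
        then show ?thesis using f by blast
      qed
      moreover have "\<exists>z \<in> {x<..<y}. weq r c x z c x' z' \<and> weq r c z y c z' y'" if "z' \<in> {x'<..<y'}" for z'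
      proof -
        have "(f (x', z'), f (z', y')) \<in> (\<lambda>z. (f (x, z), f (z, y))) ` {x<..<y}"
          using that eq by blast
        then obtain z where "z \<in> {x<..<y}" "f (x, z) = f (x', z')" "f (z, y) = f (z', y')" by auto
        then show ?thesis using f by blast
      qed
      ultimately show ?thesis by simp
    qed
    ultimately show ?case using encode[of G] by blast
  qed
qed

text \<open>Ramsey's theorem is applied to pairs of points, colored by the type of the interval
  between them. Leaving out the point 0 makes the stretch before \<open>q 0\<close>
  nonempty.\<close>

lemma homogeneous_sequence:
  fixes c :: "nat \<Rightarrow> 'k"
  assumes "finite (range c)"
  obtains q where "strict_mono q" "0 < q 0" "\<And>i. weq r c (q i) (q (Suc i)) c (q 0) (q 1)"
proof -
  obtain f :: "nat \<times> nat \<Rightarrow> nat" where fin: "finite (range f)"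
    and f: "\<And>x y x' y'. f (x, y) = f (x', y') \<Longrightarrow> weq r c x y c x' y'"
    using weq_finite_index[OF assms] by metis
  obtain s where s: "\<And>u. f u < s"
    using fin finite_nat_set_iff_bounded by auto
  have "infinite {1::nat..}" by (simp add: infinite_Ici)
  then obtain Y t where Y: "Y \<subseteq> {1..}" "infinite Y"
    and t: "\<And>x y. x \<in> Y \<Longrightarrow> y \<in> Y \<Longrightarrow> x \<noteq> y \<Longrightarrow> f (Min {x, y}, Max {x, y}) = t"
    using Ramsey2[of "{1::nat..}" "\<lambda>X. f (Min X, Max X)" s] s by auto
  define q where "q = enumerate Y"
  have mono: "strict_mono q" using Y(2) by (simp add: q_def strict_mono_def)
  have q: "q i \<in> Y" for i using Y(2) by (simp add: q_def enumerate_in_set)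
  have "f (q i, q (Suc i)) = t" for i
  proof -
    have "q i < q (Suc i)" using mono by (simp add: strict_mono_def)
    then show ?thesis using t[OF q q, of i "Suc i"] by simp
  qed
  then show thesis
    using that[OF mono] q[of 0] Y(1) f by fastforce
qed

text \<open>The matched points \<open>H\<close> cut the two orders into intervals that are pairwise equivalent.\<close>

definition matching :: "nat \<Rightarrow> (nat \<Rightarrow> 'k) \<Rightarrow> (nat \<Rightarrow> 'k) \<Rightarrow> nat \<Rightarrow> nat \<Rightarrow> (nat \<times> nat) set \<Rightarrow> bool" where
  "matching r c c' L L' H \<longleftrightarrow> finite H \<and> (0, 0) \<in> H \<and> (L, L') \<in> H \<and>
     (\<forall>x x'. (x, x') \<in> H \<longrightarrow> x \<le> L \<and> x' \<le> L') \<and>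
     (\<forall>x x' y y'. (x, x') \<in> H \<longrightarrow> (y, y') \<in> H \<longrightarrow> (x < y \<longleftrightarrow> x' < y')) \<and>
     (\<forall>x x' y y'. (x, x') \<in> H \<longrightarrow> (y, y') \<in> H \<longrightarrow> x < y \<longrightarrow>
        (\<forall>z z'. (z, z') \<in> H \<longrightarrow> \<not> (x < z \<and> z < y)) \<longrightarrow> weq r c x y c' x' y')"

lemma matchingD:
  assumes "matching r c c' L L' H"
  shows "finite H" "(0, 0) \<in> H" "(L, L') \<in> H" "(x, x') \<in> H \<Longrightarrow> x \<le> L"
    "(x, x') \<in> H \<Longrightarrow> x' \<le> L'"
    "(x, x') \<in> H \<Longrightarrow> (y, y') \<in> H \<Longrightarrow> x < y \<longleftrightarrow> x' < y'"
    "(x, x') \<in> H \<Longrightarrow> (y, y') \<in> H \<Longrightarrow> x < y \<Longrightarrow>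
      (\<And>z z'. (z, z') \<in> H \<Longrightarrow> \<not> (x < z \<and> z < y)) \<Longrightarrow> weq r c x y c' x' y'"
  using assms unfolding matching_def by blast+

lemma matching_eq_iff:
  assumes "matching r c c' L L' H" "(x, x') \<in> H" "(y, y') \<in> H"
  shows "x = y \<longleftrightarrow> x' = y'"
  using matchingD(6)[OF assms(1,2,3)] matchingD(6)[OF assms(1,3,2)] by linarith

lemma matching_converse:
  assumes H: "matching r c c' L L' H"
  shows "matching r c' c L' L (H\<inverse>)"
proof -
  have sym: "weq r c' x' y' c x y"
    if "(x, x') \<in> H" "(y, y') \<in> H" "x' < y'" and gap: "\<forall>z z'. (z, z') \<in> H \<longrightarrow> \<not> (x' < z' \<and> z' < y')"
    for x x' y y'
  proof -
    have "\<not> (x < z \<and> z < y)" if "(z, z') \<in> H" for z z'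
      using that gap matchingD(6)[OF H \<open>(x, x') \<in> H\<close> that] matchingD(6)[OF H that \<open>(y, y') \<in> H\<close>] by blast
    moreover have "x < y" using that matchingD(6)[OF H] by blast
    ultimately show ?thesis using matchingD(7)[OF H that(1,2)] weq_sym by metis
  qed
  show ?thesis
    unfolding matching_def converse_iff
  proof (intro conjI allI impI)
    fix x x' y y'
    assume "(x', x) \<in> H" "(y', y) \<in> H" "x < y" "\<forall>z z'. (z', z) \<in> H \<longrightarrow> \<not> (x < z \<and> z < y)"
    then show "weq r c' x y c x' y'" by (intro sym) blast+
  qed (use matchingD[OF H] in \<open>auto simp: finite_converse\<close>)
qed

lemma matching_SucD: "matching (Suc r) c c' L L' H \<Longrightarrow> matching r c c' L L' H"
  unfolding matching_def using weq_SucD[of r c _ _ c'] by blast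

text \<open>The interval from \<open>x\<close> to the next matched point begins with the color of
  \<open>x\<close>. No interval begins at \<open>L\<close>, hence \<open>x < L\<close>.\<close>

lemma matching_color:
  assumes H: "matching r c c' L L' H" and x: "(x, x') \<in> H" "x < L"
  shows "c x = c' x'"
proof -
  define y where "y = Min {y \<in> fst ` H. x < y}"
  have fin: "finite {y \<in> fst ` H. x < y}" using matchingD(1)[OF H] by simp
  have "L \<in> {y \<in> fst ` H. x < y}" using matchingD(3)[OF H] x(2) by force
  then have y: "y \<in> {y \<in> fst ` H. x < y}"
    unfolding y_def using fin by (intro Min_in) auto
  then obtain y' where y': "(y, y') \<in> H" by auto
  have "\<not> (x < z \<and> z < y)" if "(z, z') \<in> H" for z z'
    using Min_le[OF fin, of z] that by (force simp: y_def)
  then have "weq r c x y c' x' y'" using matchingD(7)[OF H x(1) y'] y by blast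
  then show ?thesis by (rule weq_color)
qed

text \<open>The new point splits the interval between its nearest matched neighbors, whose
  equivalence supplies the answer. All other intervals merely lose a round.\<close>

lemma matching_forth:
  assumes H: "matching (Suc r) c c' L L' H" and a: "a < L"
  shows "\<exists>b H'. b < L' \<and> H \<subseteq> H' \<and> (a, b) \<in> H' \<and> matching r c c' L L' H'"
proof (cases "\<exists>b. (a, b) \<in> H")
  case True
  then obtain b where "(a, b) \<in> H" by blast
  then show ?thesis
    using a matchingD(6)[OF H, of a b L L'] matchingD(3)[OF H] matching_SucD[OF H] by blast
next
  case False
  define x where "x = Max {x \<in> fst ` H. x < a}"
  define y where "y = Min {y \<in> fst ` H. a < y}"
  have fin: "finite {x \<in> fst ` H. x < a}" "finite {y \<in> fst ` H. a < y}"
    using matchingD(1)[OF H] by simp_all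
  have "a \<noteq> 0" using False matchingD(2)[OF H] by metis
  then have "0 \<in> {x \<in> fst ` H. x < a}" "L \<in> {y \<in> fst ` H. a < y}"
    using matchingD(2,3)[OF H] a by force+
  then have ne: "{x \<in> fst ` H. x < a} \<noteq> {}" "{y \<in> fst ` H. a < y} \<noteq> {}" by (metis empty_iff)+
  have "x \<in> {x \<in> fst ` H. x < a}" "y \<in> {y \<in> fst ` H. a < y}"
    unfolding x_def y_def by (fact Max_in[OF fin(1) ne(1)] Min_in[OF fin(2) ne(2)])+
  then obtain x' y' where xy: "(x, x') \<in> H" "(y, y') \<in> H" "x < a" "a < y" by force
  have below: "u \<le> x" if "(u, u') \<in> H" "u < a" for u u'
    using Max_ge[OF fin(1), of u] that image_eqI[of u fst "(u, u')" H] by (simp add: x_def)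
  have above: "y \<le> u" if "(u, u') \<in> H" "a < u" for u u'
    using Min_le[OF fin(2), of u] that image_eqI[of u fst "(u, u')" H] by (simp add: y_def)
  have neq: "u \<noteq> a" if "(u, u') \<in> H" for u u' using False that by blast
  have "weq (Suc r) c x y c' x' y'"
  proof (rule matchingD(7)[OF H xy(1,2)])
    fix z z' assume z: "(z, z') \<in> H"
    show "\<not> (x < z \<and> z < y)"
      using below[OF z] above[OF z] neq[OF z] by linarith
  qed (use xy in simp)
  then obtain b where b: "x' < b" "b < y'" "weq r c x a c' x' b" "weq r c a y c' b y'"
    using xy(3,4) unfolding weq.simps(2) greaterThanLessThan_iff Ball_def Bex_def by blast
  have order: "u < a \<longleftrightarrow> u' < b" "a < u \<longleftrightarrow> b < u'" if u: "(u, u') \<in> H" for u u'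
  proof -
    have "u' \<le> x'" if "u < a"
      using below[OF u that] matchingD(6)[OF H xy(1) u] by linarith
    moreover have "y' \<le> u'" if "a < u"
      using above[OF u that] matchingD(6)[OF H u xy(2)] by linarith
    ultimately show "u < a \<longleftrightarrow> u' < b" "a < u \<longleftrightarrow> b < u'"
      using neq[OF u] b(1,2) by linarith+
  qed
  define H' where "H' = insert (a, b) H"
  have "matching r c c' L L' H'"
    unfolding matching_def
  proof (intro conjI allI impI)
    show "finite H'" "(0, 0) \<in> H'" "(L, L') \<in> H'" using matchingD[OF H] by (auto simp: H'_def)
  next
    fix u u' assume u: "(u, u') \<in> H'"
    have "b \<le> L'" using b(2) matchingD(5)[OF H xy(2)] by simp
    then show "u \<le> L" "u' \<le> L'"
      using u a matchingD(4,5)[OF H] by (auto simp: H'_def)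
  next
    fix u u' w w' assume "(u, u') \<in> H'" "(w, w') \<in> H'"
    then show "u < w \<longleftrightarrow> u' < w'"
      using order[of u u'] order[of w w'] matchingD(6)[OF H, of u u' w w'] by (auto simp: H'_def)
  next
    fix u u' w w'
    assume u: "(u, u') \<in> H'" and w: "(w, w') \<in> H'" and "u < w"
      and gap: "\<forall>z z'. (z, z') \<in> H' \<longrightarrow> \<not> (u < z \<and> z < w)"
    consider "(u, u') = (a, b)" "(w, w') \<in> H" | "(u, u') \<in> H" "(w, w') = (a, b)"
      | "(u, u') \<in> H" "(w, w') \<in> H"
      using u w \<open>u < w\<close> by (auto simp: H'_def)
    then show "weq r c u w c' u' w'"
    proof cases
      case 1
      then have "w = y" using above[of w w'] gap xy \<open>u < w\<close> by (force simp: H'_def)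
      then have "w' = y'" using matching_eq_iff[OF H 1(2) xy(2)] by simp
      then show ?thesis using b(4) 1(1) \<open>w = y\<close> by simp
    next
      case 2
      then have "u = x" using below[of u u'] gap xy \<open>u < w\<close> by (force simp: H'_def)
      then have "u' = x'" using matching_eq_iff[OF H 2(1) xy(1)] by simp
      then show ?thesis using b(3) 2(2) \<open>u = x\<close> by simp
    next
      case 3
      then have "weq (Suc r) c u w c' u' w'"
        using matchingD(7)[OF H 3 \<open>u < w\<close>] gap by (auto simp: H'_def)
      then show ?thesis by (rule weq_SucD)
    qed
  qed
  moreover have "b < L'" using b(2) matchingD(5)[OF H xy(2)] by simp
  ultimately show ?thesis unfolding H'_def by blast
qed

lemma matching_back:
  assumes H: "matching (Suc r) c c' L L' H" and b: "b < L'"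
  shows "\<exists>a H'. a < L \<and> H \<subseteq> H' \<and> (a, b) \<in> H' \<and> matching r c c' L L' H'"
proof -
  obtain a H' where "a < L" "H\<inverse> \<subseteq> H'" "(b, a) \<in> H'" "matching r c' c L' L H'"
    using matching_forth[OF matching_converse[OF H] b] by blast
  then show ?thesis
    using matching_converse[of r c' c L' L H'] by (intro exI[of _ a] exI[of _ "H'\<inverse>"]) auto
qed

text \<open>The marks \<open>m (Suc i)\<close> with \<open>i < n\<close> are the elements of the
  original model; \<open>m 0\<close> and \<open>m (Suc n)\<close> are the two ends of the word. All
  marks are matched from the start and stay matched, which preserves the relations of the
  model.\<close>

lemma marked_words_equiv:
  fixes m m' :: "nat \<Rightarrow> nat"
  assumes m: "strict_mono m" "m 0 = 0" and m': "strict_mono m'" "m' 0 = 0"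
    and gap: "\<And>i. i \<le> n \<Longrightarrow> weq k c (m i) (m (Suc i)) c' (m' i) (m' (Suc i))"
    and T: "\<And>i t. i < length \<tau> \<Longrightarrow> t \<in> T i \<Longrightarrow> set t \<subseteq> {..<n}"
    and num: "\<And>S (xs :: nat list) s t. S \<in> B \<Longrightarrow> length xs = fst S \<Longrightarrow> (\<And>x y. s x \<le> s y \<longleftrightarrow> t x \<le> t y) \<Longrightarrow>
      (\<And>x. c (s x) = c' (t x)) \<Longrightarrow> N S (map s xs) \<longleftrightarrow> N' S (map t xs)"
    and \<phi>: "wf_fm B {} \<tau> \<phi>" "qd \<phi> \<le> k"
  shows "isat (\<lambda>_. {..<m (Suc n)}) (\<lambda>i t. t \<in> map (m \<circ> Suc) ` T i) N (\<lambda>_. 0) \<phi> \<longleftrightarrow>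
    isat (\<lambda>_. {..<m' (Suc n)}) (\<lambda>i t. t \<in> map (m' \<circ> Suc) ` T i) N' (\<lambda>_. 0) \<phi>"
proof -
  define L where "L = m (Suc n)"
  define L' where "L' = m' (Suc n)"
  define H\<^sub>0 where "H\<^sub>0 = (\<lambda>i. (m i, m' i)) ` {..Suc n}"
  \<comment> \<open>The end \<open>L\<close> is matched but is no position of the word, hence
    \<open>s v < L\<close>.\<close>
  define I where "I = (\<lambda>r (s :: nat \<Rightarrow> nat) t. \<exists>H. matching r c c' L L' H \<and> H\<^sub>0 \<subseteq> H \<and>
    (\<forall>v. (s v, t v) \<in> H \<and> s v < L))"
  have "0 < L" using m by (metis L_def strict_mono_less zero_less_Suc)
  have H\<^sub>0: "matching k c c' L L' H\<^sub>0"
    unfolding matching_def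
  proof (intro conjI allI impI)
    show "finite H\<^sub>0" by (simp add: H\<^sub>0_def)
    show "(0, 0) \<in> H\<^sub>0" using m m' by (force simp: H\<^sub>0_def)
    show "(L, L') \<in> H\<^sub>0" by (auto simp: H\<^sub>0_def L_def L'_def)
  next
    fix x x' assume "(x, x') \<in> H\<^sub>0"
    then show "x \<le> L" "x' \<le> L'" using m(1) m'(1) by (auto simp: H\<^sub>0_def L_def L'_def strict_mono_less_eq)
  next
    fix x x' y y' assume "(x, x') \<in> H\<^sub>0" "(y, y') \<in> H\<^sub>0"
    then show "x < y \<longleftrightarrow> x' < y'" using m(1) m'(1) by (auto simp: H\<^sub>0_def strict_mono_less)
  next
    fix x x' y y'
    assume "(x, x') \<in> H\<^sub>0" "(y, y') \<in> H\<^sub>0" "x < y"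
      and none: "\<forall>z z'. (z, z') \<in> H\<^sub>0 \<longrightarrow> \<not> (x < z \<and> z < y)"
    then obtain i j where ij: "x = m i" "x' = m' i" "y = m j" "y' = m' j" "j \<le> Suc n"
      by (auto simp: H\<^sub>0_def)
    have "i < j" using \<open>x < y\<close> m(1) ij by (simp add: strict_mono_less)
    moreover have "\<not> Suc i < j"
    proof
      assume "Suc i < j"
      then have "(m (Suc i), m' (Suc i)) \<in> H\<^sub>0" using ij(5) by (auto simp: H\<^sub>0_def)
      with none show False using \<open>Suc i < j\<close> ij m(1) by (auto simp: strict_mono_less)
    qed
    ultimately have "j = Suc i" by simp
    then show "weq k c x y c' x' y'" using gap[of i] ij by simp
  qed
  have "isat (\<lambda>_. {..<L}) (\<lambda>i t. t \<in> map (m \<circ> Suc) ` T i) N (\<lambda>_. 0) \<phi> \<longleftrightarrow>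
    isat (\<lambda>_. {..<L'}) (\<lambda>i t. t \<in> map (m' \<circ> Suc) ` T i) N' (\<lambda>_. 0) \<phi>"
  proof (rule isat_game[where I = I and m = "qd \<phi>", OF _ _ _ _ _ _ \<phi>(1) order_refl])
    fix r s t assume "I (Suc r) s t"
    then show "I r s t" unfolding I_def using matching_SucD by blast
  next
    fix r s t a and x :: nat assume "I (Suc r) s t" "a \<in> {..<L}"
    then obtain H where H: "matching (Suc r) c c' L L' H" "H\<^sub>0 \<subseteq> H" "\<And>v. (s v, t v) \<in> H \<and> s v < L"
      unfolding I_def by blast
    obtain b H' where "b < L'" "H \<subseteq> H'" "(a, b) \<in> H'" "matching r c c' L L' H'"
      using matching_forth[OF H(1)] \<open>a \<in> {..<L}\<close> unfolding lessThan_iff by blast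
    then have "I r (s(x := a)) (t(x := b))"
      unfolding I_def using H(2,3) \<open>a \<in> {..<L}\<close> by (intro exI[of _ H']) auto
    then show "\<exists>b\<in>{..<L'}. I r (s(x := a)) (t(x := b))" using \<open>b < L'\<close> by auto
  next
    fix r s t b and x :: nat assume "I (Suc r) s t" "b \<in> {..<L'}"
    then obtain H where H: "matching (Suc r) c c' L L' H" "H\<^sub>0 \<subseteq> H" "\<And>v. (s v, t v) \<in> H \<and> s v < L"
      unfolding I_def by blast
    obtain a H' where "a < L" "H \<subseteq> H'" "(a, b) \<in> H'" "matching r c c' L L' H'"
      using matching_back[OF H(1)] \<open>b \<in> {..<L'}\<close> unfolding lessThan_iff by blast
    then have "I r (s(x := a)) (t(x := b))"
      unfolding I_def using H(2,3) by (intro exI[of _ H']) auto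
    then show "\<exists>a\<in>{..<L}. I r (s(x := a)) (t(x := b))" using \<open>a < L\<close> by auto
  next
    fix s t x y assume "I 0 s t"
    then show "s x = s y \<longleftrightarrow> t x = t y" unfolding I_def using matching_eq_iff by blast
  next
    fix s t i and xs :: "nat list" assume "I 0 s t" and i: "i < length \<tau>"
    then obtain H where H: "matching 0 c c' L L' H" "H\<^sub>0 \<subseteq> H" "\<And>v. (s v, t v) \<in> H"
      unfolding I_def by blast
    have "map s xs = map (m \<circ> Suc) u \<longleftrightarrow> map t xs = map (m' \<circ> Suc) u" if "u \<in> T i" for u
    proof -
      have "s x = m (Suc j) \<longleftrightarrow> t x = m' (Suc j)" if "j < n" for x j
      proof (rule matching_eq_iff[OF H(1) H(3)])
        show "(m (Suc j), m' (Suc j)) \<in> H" using H(2) that by (auto simp: H\<^sub>0_def)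
      qed
      moreover have "u ! j < n" if "j < length u" for j
        using T[OF i \<open>u \<in> T i\<close>] that by (auto dest: nth_mem)
      ultimately show ?thesis by (auto simp: list_eq_iff_nth_eq)
    qed
    then show "map s xs \<in> map (m \<circ> Suc) ` T i \<longleftrightarrow> map t xs \<in> map (m' \<circ> Suc) ` T i"
      unfolding image_iff by metis
  next
    fix s t S and xs :: "nat list" assume "I 0 s t" and S: "S \<in> B" "length xs = fst S"
    then obtain H where H: "matching 0 c c' L L' H" "\<And>v. (s v, t v) \<in> H \<and> s v < L"
      unfolding I_def by blast
    show "N S (map s xs) \<longleftrightarrow> N' S (map t xs)"
    proof (rule num[OF S])
      show "s x \<le> s y \<longleftrightarrow> t x \<le> t y" for x y
        using matchingD(6)[OF H(1), of "s y" "t y" "s x" "t x"] H(2) by (meson not_less)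
      show "c (s x) = c' (t x)" for x
        using matching_color[OF H(1)] H(2) by blast
    qed
  next
    have "matching r c c' L L' H\<^sub>0" if "r \<le> k" for r
      using that H\<^sub>0 by (induction rule: inc_induct) (auto intro: matching_SucD)
    then show "I (qd \<phi>) (\<lambda>_. 0) (\<lambda>_. 0)"
      unfolding I_def using \<phi>(2) \<open>0 < L\<close> matchingD(2)[OF H\<^sub>0] by blast
  qed
  then show ?thesis by (simp add: L_def L'_def)
qed


section \<open>Unary relations and the order\<close>

theorem collapse_unary:
  fixes \<phi> :: "'a fm"
  assumes "wf_fm (unary_rels \<union> {le_rel}) {} \<tau> \<phi>"
  shows "\<exists>p. strict_mono p \<and> definable_pred \<tau> (\<lambda>M s. padded_sat p M \<phi>)"
proof -
  obtain B where B: "B \<subseteq> unary_rels \<union> {le_rel}" "finite B" and \<phi>: "wf_fm B {} \<tau> \<phi>"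
    using wf_fm_finite_support[OF assms] by blast
  have unary: "\<exists>x. xs = [x]" if "S \<in> B" "S \<noteq> le_rel" "length xs = fst S" for S and xs :: "nat list"
  proof -
    have "S \<in> unary_rels" using B(1) that by blast
    then have "length xs = 1" using that(3) by (auto simp: unary_rels_def)
    then show ?thesis by (simp add: length_Suc_conv)
  qed
  \<comment> \<open>The order never enters a color, since its tuples have length two.\<close>
  define c where "c x = {S \<in> B. [x] \<in> snd S}" for x
  have "finite (range c)"
    by (rule finite_subset[of _ "Pow B"]) (auto simp: c_def B(2))
  then obtain q where q: "strict_mono q" "0 < q 0" "\<And>i. weq (qd \<phi>) c (q i) (q (Suc i)) c (q 0) (q 1)"
    using homogeneous_sequence[where r = "qd \<phi>"] by blast
  define w where "w = q 0"
  define b where "b = q 1 - w"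
  have "q 0 < q 1" using q(1) by (simp add: strict_mono_def)
  then have b: "0 < b" "q 1 = w + b" by (simp_all add: b_def w_def)
  have w: "0 < w" using q(2) by (simp add: w_def)
  \<comment> \<open>The new word is an initial stretch of length \<open>w\<close> followed by copies
    of the word between \<open>q 0\<close> and \<open>q 1\<close>, of length \<open>b\<close>. The
    mark \<open>q' i\<close> is the first letter of copy \<open>i\<close>.\<close>
  define q' where "q' i = w + i * b" for i
  define c' where "c' k = (if k < w then c k else c (w + (k - w) mod b))" for k
  \<comment> \<open>The periodic word is colored by \<open>c'\<close> and not by the unary relations
    themselves, so membership is read off from the color.\<close>
  define N' where "N' S t \<longleftrightarrow> (if S = le_rel then t \<in> snd S else \<exists>x. t = [x] \<and> S \<in> c' x)" for S t
  define U where "U M r = {..<w + card (Dom M) * b}" for M :: "'a br_struct" and r :: nat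
  define R where "R M i t \<longleftrightarrow> t \<in> map (q' \<circ> rank M) ` (rels M ! i)" for M :: "'a br_struct" and i t
  \<comment> \<open>A label below \<open>w\<close> is a position in the initial stretch and ignores
    \<open>t\<close>. A label from \<open>w\<close> to \<open>w + b - 1\<close> is a position in the
    copy that belongs to the element \<open>hd t\<close>.\<close>
  define g where "g M l t = (if l < w then l else l + rank M (hd t) * b)" for M :: "'a br_struct" and l t
  \<comment> \<open>The mark 0 is put in front of the sequences, so that the initial stretch is a
    gap as well; it is the same in both words.\<close>
  have gap: "weq (qd \<phi>) c (case_nat 0 q i) (case_nat 0 q (Suc i)) c' (case_nat 0 q' i) (case_nat 0 q' (Suc i))" for i
  proof (cases i)
    case 0
    then show ?thesis
      using weq_shift[of w c' 0 c 0] w by (simp add: c'_def q'_def w_def)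
  next
    case (Suc j)
    have "weq (qd \<phi>) c w (w + b) c' (q' j) (q' j + b)"
      using b by (intro weq_shift) (auto simp: c'_def q'_def add.commute)
    then have "weq (qd \<phi>) c (q j) (q (Suc j)) c' (q' j) (q' j + b)"
      using q(3)[of j] b(2) weq_trans unfolding w_def by metis
    then show ?thesis using Suc by (simp add: q'_def add.commute add.left_commute)
  qed
  have periodic: "padded_sat q M \<phi> \<longleftrightarrow> isat (U M) (R M) N' (\<lambda>_. 0) \<phi>" if M: "br_model \<tau> M" for M
  proof -
    have "isat (\<lambda>_. {..<case_nat 0 q (Suc (card (Dom M)))})
        (\<lambda>i t. t \<in> map (case_nat 0 q \<circ> Suc) ` map (rank M) ` (rels M ! i)) (\<lambda>S t. t \<in> snd S) (\<lambda>_. 0) \<phi> \<longleftrightarrow>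
      isat (\<lambda>_. {..<case_nat 0 q' (Suc (card (Dom M)))})
        (\<lambda>i t. t \<in> map (case_nat 0 q' \<circ> Suc) ` map (rank M) ` (rels M ! i)) N' (\<lambda>_. 0) \<phi>"
    proof (rule marked_words_equiv[where k = "qd \<phi>" and c = c and c' = c' and B = B and \<tau> = \<tau>])
      show "weq (qd \<phi>) c (case_nat 0 q i) (case_nat 0 q (Suc i)) c' (case_nat 0 q' i) (case_nat 0 q' (Suc i))" for i
        by (rule gap)
    next
      show "strict_mono (case_nat 0 q)" "strict_mono (case_nat 0 q')"
        using q(1,2) w b(1) by (auto simp: strict_mono_Suc_iff q'_def split: nat.split)
    next
      fix i t assume "i < length \<tau>" "t \<in> map (rank M) ` (rels M ! i)"
      then show "set t \<subseteq> {..<card (Dom M)}"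
        using br_modelD(5,6)[OF M] by (fastforce simp: tuples_def)
    next
      fix S and xs :: "nat list" and s t :: "nat \<Rightarrow> nat"
      assume S: "S \<in> B" "length xs = fst S" and st: "\<And>x y. s x \<le> s y \<longleftrightarrow> t x \<le> t y"
        "\<And>x. c (s x) = c' (t x)"
      show "map s xs \<in> snd S \<longleftrightarrow> N' S (map t xs)"
      proof (cases "S = le_rel")
        case True
        then obtain x y where "xs = [x, y]"
          using S(2) by (auto simp: le_rel_def length_Suc_conv numeral_2_eq_2)
        then show ?thesis using True st(1) by (auto simp: N'_def le_rel_def)
      next
        case False
        then obtain x where "xs = [x]"
          using unary S by blast
        then show ?thesis using False S(1) st(2)[symmetric] by (auto simp: N'_def c_def)
      qed
    qed (auto simp: \<phi>)
    moreover have "case_nat 0 q \<circ> Suc = q" "case_nat 0 q' \<circ> Suc = q'" by (simp_all add: fun_eq_iff)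
    moreover have "U M = (\<lambda>_. {..<q' (card (Dom M))})"
      "R M = (\<lambda>i t. t \<in> map (q' \<circ> rank M) ` (rels M ! i))"
      by (auto simp: U_def R_def q'_def fun_eq_iff)
    ultimately show ?thesis
      by (simp add: padded_sat_def image_image comp_def)
  qed
  \<comment> \<open>Offsets differ by less than \<open>b\<close>, so positions in the copies are
    ordered lexicographically.\<close>
  have block_le: "l + i * b \<le> l' + j * b \<longleftrightarrow> i < j \<or> i = j \<and> l \<le> l'"
    if "w \<le> l" "l < w + b" "w \<le> l'" "l' < w + b" for l l' i j
  proof -
    have "Suc i * b \<le> j * b" if "i < j" for i j using that by (intro mult_le_mono1) simp
    from this[of i j] this[of j i] show ?thesis using that by (cases i j rule: linorder_cases) auto
  qed
  have color: "c' (g M l t) = c l" if "l < w + b" for M :: "'a br_struct" and l t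
  proof (cases "l < w")
    case False
    then obtain j where j: "l = w + j" by (metis le_iff_add not_less)
    with that have "(j + rank M (hd t) * b) mod b = j" by simp
    with j show ?thesis by (simp add: c'_def g_def add.assoc)
  qed (simp add: c'_def g_def)
  have le: "definable_pred \<tau> (\<lambda>M s. g M l [s x] \<le> g M l' [s y])" if l: "l < w + b" "l' < w + b" for l l' x y
  proof (cases "l < w \<or> l' < w")
    case True
    then show ?thesis
      using l by (intro definable_pred_cong[OF definable_const[of _ "l \<le> l'"]]) (auto simp: g_def)
  next
    case False
    have "definable_pred \<tau> (\<lambda>M s. \<not> rank M (s y) \<le> rank M (s x) \<or>
        (rank M (s x) \<le> rank M (s y) \<and> rank M (s y) \<le> rank M (s x) \<and> l \<le> l'))"
      by (intro definable_Disj definable_Conj definable_Neg definable_le definable_const)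
    then show ?thesis
      by (rule definable_pred_cong) (use False l in \<open>auto simp: g_def block_le\<close>)
  qed
  \<comment> \<open>All variables start with label 0, which denotes position 0 because
    \<open>0 < w\<close>. This matches the initial assignment of \<open>padded_sat\<close>.\<close>
  have "definable_pred \<tau> (\<lambda>M s. isat (U M) (R M) N' (\<lambda>v. g M ((\<lambda>_. 0) v) (map s [v * 1..<v * 1 + 1])) \<phi>)"
  proof (rule definable_isat[where m = "qd \<phi>" and F = "\<lambda>_. {..<w + b}" and FF = "{..<w + b}"
        and valid = "\<lambda>_ _ _. True" and B = B])
    fix M :: "'a br_struct" and r assume M: "br_model \<tau> M"
    let ?G = "{g M l t | l t. l \<in> {..<w + b} \<and> t \<in> tuples (Dom M) 1 \<and> True}"
    show "U M r = ?G"
    proof (intro set_eqI iffI)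
      fix k assume k: "k \<in> U M r"
      show "k \<in> ?G"
      proof (cases "k < w")
        case True
        obtain a where "a \<in> Dom M" using br_modelD(2)[OF M] by auto
        then show ?thesis using True
          by (intro CollectI exI[of _ k] exI[of _ "[a]"]) (auto simp: g_def tuples_def)
      next
        case False
        have "(k - w) div b < card (Dom M)"
          using k False b(1) by (auto simp: U_def div_less_iff_less_mult)
        then obtain a where "a \<in> Dom M" "rank M a = (k - w) div b"
          using br_modelD(3)[OF M] unfolding bij_betw_def by (metis imageE lessThan_iff)
        then show ?thesis using False b(1)
          by (intro CollectI exI[of _ "w + (k - w) mod b"] exI[of _ "[a]"]) (auto simp: g_def tuples_def)
      qed
    next
      fix k assume "k \<in> ?G"
      then obtain l a where k: "k = g M l [a]" "l < w + b" "a \<in> Dom M"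
        by (auto simp: tuples_def length_Suc_conv)
      have "Suc (rank M a) * b \<le> card (Dom M) * b"
        using br_modelD(6)[OF M k(3)] by (intro mult_le_mono1) simp
      then show "k \<in> U M r" using k by (auto simp: U_def g_def)
    qed
  next
    fix \<rho> :: "nat \<Rightarrow> nat" and x y assume "range \<rho> \<subseteq> {..<w + b}"
    then have "definable_pred \<tau> (\<lambda>M s. g M (\<rho> x) [s x] \<le> g M (\<rho> y) [s y] \<and> g M (\<rho> y) [s y] \<le> g M (\<rho> x) [s x])"
      by (intro definable_Conj le) auto
    then show "definable_pred \<tau> (\<lambda>M s. g M (\<rho> x) (map s [x * 1..<x * 1 + 1]) = g M (\<rho> y) (map s [y * 1..<y * 1 + 1]))"
      by (rule definable_pred_cong) auto
  next
    fix \<rho> :: "nat \<Rightarrow> nat" and i and xs :: "nat list"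
    assume \<rho>: "range \<rho> \<subseteq> {..<w + b}" and i: "i < length \<tau>" "length xs = \<tau> ! i"
    \<comment> \<open>A position is a mark exactly if it is the first letter of a copy, that is, if
      its label is \<open>w\<close>.\<close>
    have "definable_pred \<tau> (\<lambda>M s. (\<forall>x \<in> set xs. \<rho> x = w) \<and> map s xs \<in> rels M ! i)"
      using i by (intro definable_Conj definable_const definable_Rel)
    then show "definable_pred \<tau> (\<lambda>M s. R M i (map (\<lambda>v. g M (\<rho> v) (map s [v * 1..<v * 1 + 1])) xs))"
    proof (rule definable_pred_cong)
      fix M :: "'a br_struct" and s :: "nat \<Rightarrow> 'a" assume M: "br_model \<tau> M" and s: "range s \<subseteq> Dom M"
      have val: "g M (\<rho> x) [s x] = q' (rank M a) \<longleftrightarrow> \<rho> x = w \<and> s x = a" if "a \<in> Dom M" for x a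
      proof -
        have "\<rho> x < w + b" "s x \<in> Dom M" using \<rho> s by auto
        then have "s x = a \<longleftrightarrow> rank M (s x) = rank M a"
          using br_modelD(4)[OF M] that by (auto dest: inj_onD)
        then show ?thesis
          using block_le[of "\<rho> x" w "rank M (s x)" "rank M a"] block_le[of w "\<rho> x" "rank M a" "rank M (s x)"]
            \<open>\<rho> x < w + b\<close> b(1) by (auto simp: g_def q'_def)
      qed
      have "map (\<lambda>x. g M (\<rho> x) [s x]) xs = map (q' \<circ> rank M) u \<longleftrightarrow> (\<forall>x \<in> set xs. \<rho> x = w) \<and> map s xs = u"
        if u: "u \<in> rels M ! i" for u
      proof -
        have "u ! j \<in> Dom M" if "j < length u" for j
          using u br_modelD(5)[OF M i(1)] that by (auto simp: tuples_def dest!: subsetD dest: nth_mem)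
        moreover have "g M w [a] = q' (rank M a)" for a by (simp add: g_def q'_def)
        ultimately show ?thesis by (auto simp: list_eq_iff_nth_eq val all_set_conv_all_nth)
      qed
      then show "(\<forall>x \<in> set xs. \<rho> x = w) \<and> map s xs \<in> rels M ! i \<longleftrightarrow>
          R M i (map (\<lambda>v. g M (\<rho> v) (map s [v * 1..<v * 1 + 1])) xs)"
        unfolding R_def image_iff by auto
    qed
  next
    fix \<rho> :: "nat \<Rightarrow> nat" and S and xs :: "nat list"
    assume \<rho>: "range \<rho> \<subseteq> {..<w + b}" and S: "S \<in> B" "length xs = fst S"
    show "definable_pred \<tau> (\<lambda>M s. N' S (map (\<lambda>v. g M (\<rho> v) (map s [v * 1..<v * 1 + 1])) xs))"
    proof (cases "S = le_rel")
      case True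
      then obtain x y where xs: "xs = [x, y]"
        using S(2) by (auto simp: le_rel_def length_Suc_conv numeral_2_eq_2)
      have "definable_pred \<tau> (\<lambda>M s. g M (\<rho> x) [s x] \<le> g M (\<rho> y) [s y])"
        using \<rho> by (intro le) auto
      then show ?thesis
        by (rule definable_pred_cong) (auto simp: N'_def True xs le_rel_def)
    next
      case False
      then obtain x where xs: "xs = [x]"
        using unary S by blast
      show ?thesis
        using \<rho> by (intro definable_pred_cong[OF definable_const[of _ "S \<in> c (\<rho> x)"]])
          (auto simp: N'_def False xs color image_subset_iff)
    qed
  qed (use b(1) \<phi> in \<open>auto simp: definable_const image_subset_iff\<close>)
  then have "definable_pred \<tau> (\<lambda>M s. padded_sat q M \<phi>)"
    by (rule definable_pred_cong) (use w in \<open>simp add: periodic g_def\<close>)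
  then show ?thesis using q(1) by blast
qed

section \<open>Linear forms\<close>

text \<open>Forms over the powers \<open>B ^ e\<close>, \<open>e \<le> n + 1\<close>, and over variables, as lists of monomials: in the
  padded models, the elements of the original model are \<open>B, \<dots>, B ^ n\<close> and the size is
  \<open>B ^ (n + 1)\<close>.\<close>

datatype atom = Base nat | Var nat

type_synonym form = "(int \<times> atom) list"

fun atom_val :: "nat \<Rightarrow> (nat \<Rightarrow> int) \<Rightarrow> atom \<Rightarrow> int" where
  "atom_val B s (Base e) = int B ^ e"
| "atom_val B s (Var v) = s v"

definition form_val :: "nat \<Rightarrow> (nat \<Rightarrow> int) \<Rightarrow> form \<Rightarrow> int" where
  "form_val B s f = (\<Sum>(\<epsilon>, a) \<leftarrow> f. \<epsilon> * atom_val B s a)"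

text \<open>Coefficients are signs or 0, so that the length of a form bounds the sum of their
  absolute values. Larger factors are expanded into repeated monomials by
  \<open>scale\<close>.\<close>

definition form_ok :: "nat \<Rightarrow> form \<Rightarrow> bool" where
  "form_ok n f \<longleftrightarrow> (\<forall>(\<epsilon>, a) \<in> set f. \<epsilon> \<in> {-1, 0, 1} \<and> (case a of Base e \<Rightarrow> e \<le> Suc n | Var v \<Rightarrow> True))"

lemma form_val_simps [simp]:
  "form_val B s [] = 0"
  "form_val B s ((\<epsilon>, a) # f) = \<epsilon> * atom_val B s a + form_val B s f"
  "form_val B s (f @ g) = form_val B s f + form_val B s g"
  by (simp_all add: form_val_def)

lemma form_ok_simps [simp]:
  "form_ok n []"
  "form_ok n ((\<epsilon>, a) # f) \<longleftrightarrow> \<epsilon> \<in> {-1, 0, 1} \<and> (case a of Base e \<Rightarrow> e \<le> Suc n | Var v \<Rightarrow> True) \<and> form_ok n f"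
  "form_ok n (f @ g) \<longleftrightarrow> form_ok n f \<and> form_ok n g"
  by (auto simp: form_ok_def)

definition scale :: "int \<Rightarrow> form \<Rightarrow> form" where
  "scale k f = concat (replicate (nat \<bar>k\<bar>) (map (\<lambda>(\<epsilon>, a). (sgn k * \<epsilon>, a)) f))"

lemma form_val_scale [simp]: "form_val B s (scale k f) = k * form_val B s f"
proof -
  have "form_val B s (map (\<lambda>(\<epsilon>, a). (sgn k * \<epsilon>, a)) f) = sgn k * form_val B s f"
    by (induction f) (auto simp: algebra_simps)
  then have "form_val B s (concat (replicate m (map (\<lambda>(\<epsilon>, a). (sgn k * \<epsilon>, a)) f))) = int m * (sgn k * form_val B s f)" for m
    by (induction m) (auto simp: algebra_simps)
  then show ?thesis by (simp add: scale_def mult.assoc[symmetric] abs_mult_sgn)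
qed

lemma form_ok_scale [simp]: "form_ok n f \<Longrightarrow> form_ok n (scale k f)"
  by (auto simp: form_ok_def scale_def sgn_if)

lemma length_scale [simp]: "length (scale k f) = nat \<bar>k\<bar> * length f"
  by (simp add: scale_def length_concat sum_list_replicate)

definition vcoeff :: "nat \<Rightarrow> form \<Rightarrow> int" where
  "vcoeff v f = (\<Sum>(\<epsilon>, a) \<leftarrow> f. if a = Var v then \<epsilon> else 0)"

definition drop_var :: "nat \<Rightarrow> form \<Rightarrow> form" where
  "drop_var v f = filter (\<lambda>(\<epsilon>, a). a \<noteq> Var v) f"

lemma form_val_upd: "form_val B (s(v := x)) f = vcoeff v f * x + form_val B s (drop_var v f)"
proof (induction f)
  case (Cons p f)
  obtain \<epsilon> a where "p = (\<epsilon>, a)" by fastforce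
  with Cons show ?case by (cases a) (auto simp: vcoeff_def drop_var_def algebra_simps)
qed (simp add: vcoeff_def drop_var_def)

lemma form_ok_drop_var [simp]: "form_ok n f \<Longrightarrow> form_ok n (drop_var v f)"
  by (auto simp: form_ok_def drop_var_def)

lemma length_drop_var: "length (drop_var v f) \<le> length f"
  by (simp add: drop_var_def)

lemma abs_vcoeff: "form_ok n f \<Longrightarrow> \<bar>vcoeff v f\<bar> \<le> int (length f)"
  by (induction f) (auto simp: vcoeff_def)


section \<open>Eliminating quantifiers over the padding\<close>

text \<open>The invariant of the game for addition: signs of short forms decide the atomic formulas,
  and residues keep the quotients integral when they are transferred.\<close>

definition similar :: "nat \<Rightarrow> nat \<Rightarrow> nat \<Rightarrow> nat \<Rightarrow> (nat \<Rightarrow> int) \<Rightarrow> (nat \<Rightarrow> int) \<Rightarrow> bool" where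
  "similar B n A m s t \<longleftrightarrow>
     (\<forall>f. form_ok n f \<and> length f \<le> A \<longrightarrow> sgn (form_val B s f) = sgn (form_val B t f)) \<and>
     (\<forall>v. int m dvd s v - t v)"

lemma similar_sym: "similar B n A m s t \<Longrightarrow> similar B n A m t s"
  unfolding similar_def by (metis dvd_diff_commute)

lemma similarD:
  assumes "similar B n A m s t"
  shows "form_ok n f \<Longrightarrow> length f \<le> A \<Longrightarrow> sgn (form_val B s f) = sgn (form_val B t f)"
    "int m dvd s v - t v"
  using assms by (auto simp: similar_def)

lemma similar_mono: "similar B n A m s t \<Longrightarrow> A' \<le> A \<Longrightarrow> m' dvd m \<Longrightarrow> similar B n A' m' s t"
  unfolding similar_def by (meson dvd_trans int_dvd_int_iff le_trans)

lemma form_val_cong_mod: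
  assumes "\<And>v. int m dvd s v - t v"
  shows "int m dvd form_val B s f - form_val B t f"
proof (induction f)
  case (Cons p f)
  obtain \<epsilon> a where p: "p = (\<epsilon>, a)" by fastforce
  have "int m dvd atom_val B s a - atom_val B t a" using assms by (cases a) auto
  then have "int m dvd \<epsilon> * (atom_val B s a - atom_val B t a) + (form_val B s f - form_val B t f)"
    using Cons by (intro dvd_add dvd_mult)
  then show ?case by (simp add: p algebra_simps)
qed simp

text \<open>Cooper's argument: moving \<open>x\<close> down in steps of \<open>m\<close>, the first form that changes its sign is
  almost zero.\<close>

lemma move_to_form:
  fixes s :: "nat \<Rightarrow> int" and x :: int
  assumes x: "0 \<le> x" and m: "0 < m" and A: "1 \<le> A"
  obtains x' a h where "0 \<le> x'" "x' \<le> x" "similar B n A m (s(v := x)) (s(v := x'))"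
    "a \<noteq> 0" "\<bar>a\<bar> \<le> int A" "form_ok n h" "length h \<le> A + A * m" "a * x' = form_val B s h"
proof -
  define good where "good y \<longleftrightarrow> 0 \<le> y \<and> y \<le> x \<and>
    (similar B n A m (s(v := x)) (s(v := y)) \<and> int m dvd x - y)" for y
  have "good x" using x by (simp add: good_def similar_def)
  then have "\<exists>k. good (int k)" using x by (intro exI[of _ "nat x"]) simp
  then obtain k where k: "good (int k)" "\<And>j. good (int j) \<Longrightarrow> k \<le> j"
    using LeastI_ex[of "\<lambda>k. good (int k)"] Least_le[of "\<lambda>k. good (int k)"] by blast
  define x' where "x' = int k"
  define y where "y = x' - int m"
  have x': "0 \<le> x'" "x' \<le> x" "similar B n A m (s(v := x)) (s(v := x'))" "int m dvd x - x'"
    using k(1) by (auto simp: good_def x'_def)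
  have "\<not> good y"
  proof
    assume good: "good y"
    then have y: "int (nat y) = y" by (simp add: good_def)
    then have "k \<le> nat y" using good by (intro k(2)) simp
    then have "int k \<le> y" using y by linarith
    then show False using m by (simp add: y_def x'_def)
  qed
  have "\<exists>a h. a \<noteq> 0 \<and> \<bar>a\<bar> \<le> int A \<and> form_ok n h \<and> length h \<le> A + A * m \<and> a * x' = form_val B s h"
  proof (cases "y < 0")
    case True
    \<comment> \<open>Near zero, \<open>x'\<close> itself is a constant form: as many copies of
      \<open>B ^ 0\<close> as its value.\<close>
    then have "x' \<le> int m" by (simp add: y_def)
    moreover have "m \<le> A * m" using A by simp
    ultimately have "nat x' \<le> A + A * m" using x'(1) by linarith
    then show ?thesis using x'(1) A
      by (intro exI[of _ 1] exI[of _ "scale x' [(1, Base 0)]"]) auto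
  next
    case False
    have "int m dvd (x - x') + int m" using x'(4) by (rule dvd_add) simp
    then have dvd: "int m dvd x - y" by (simp add: y_def algebra_simps)
    have "int m dvd (s(v := x)) u - (s(v := y)) u" for u using dvd by simp
    moreover have "\<not> similar B n A m (s(v := x)) (s(v := y))"
      using \<open>\<not> good y\<close> False dvd x'(2) by (auto simp: good_def y_def)
    ultimately obtain f where f: "form_ok n f" "length f \<le> A"
      "sgn (form_val B (s(v := x)) f) \<noteq> sgn (form_val B (s(v := y)) f)"
      unfolding similar_def by blast
    define a where "a = vcoeff v f"
    define e where "e = form_val B (s(v := x')) f"
    have a: "\<bar>a\<bar> \<le> int A" using abs_vcoeff[OF f(1), of v] f(2) by (simp add: a_def)
    have e: "e = a * x' + form_val B s (drop_var v f)" by (simp add: e_def a_def form_val_upd)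
    have "form_val B (s(v := y)) f = e - a * int m"
      by (simp add: e y_def form_val_upd a_def algebra_simps)
    moreover have "sgn (form_val B (s(v := x)) f) = sgn e"
      unfolding e_def using f(1,2) by (rule similarD(1)[OF x'(3)])
    ultimately have ne: "sgn e \<noteq> sgn (e - a * int m)" using f(3) by simp
    then have "a \<noteq> 0" by auto
    \<comment> \<open>A step by \<open>m\<close> changes the value by \<open>a * m\<close> and here
      also the sign, so \<open>e\<close> is that close to zero and can be spelled out with copies of
      \<open>B ^ 0\<close>.\<close>
    have "\<bar>e\<bar> \<le> \<bar>a * int m\<bar>" using ne by (auto simp: sgn_if split: if_splits)
    also have "\<dots> \<le> int A * int m" using a by (simp add: abs_mult mult_right_mono)
    finally have "nat \<bar>e\<bar> \<le> A * m" by (simp add: nat_le_iff)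
    define h where "h = scale e [(1, Base 0)] @ scale (-1) (drop_var v f)"
    have "length h \<le> A + A * m"
      using \<open>nat \<bar>e\<bar> \<le> A * m\<close> length_drop_var[of v f] f(2) by (simp add: h_def)
    moreover have "form_val B s h = a * x'" by (simp add: h_def e)
    moreover have "form_ok n h" using f(1) by (simp add: h_def)
    ultimately show ?thesis using \<open>a \<noteq> 0\<close> a by metis
  qed
  then show thesis using that x' by blast
qed

text \<open>After moving \<open>x\<close> to a point where \<open>a * x1\<close> is the value of a
  form \<open>h\<close> under \<open>s\<close>, the answer is the value of \<open>h\<close> under
  \<open>t\<close> divided by \<open>a\<close>. The modulus \<open>m'\<close> makes this quotient an
  integer with the right residue. Multiplying a form by \<open>a\<close> allows its variable
  \<open>v\<close> to be replaced by \<open>h\<close>; the bound on \<open>A'\<close> is the length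
  of the result.\<close>

lemma similar_extend:
  fixes s t :: "nat \<Rightarrow> int"
  assumes sim: "similar B n A' m' s t" and m: "0 < m" and A: "2 \<le> A"
    and A': "A * (A + A * m) + A * A \<le> A'" and m': "fact A * m dvd m'"
    and x: "0 \<le> x" "x < int B ^ Suc n"
  obtains x' a h where "0 \<le> x'" "x' < int B ^ Suc n" "similar B n A m (s(v := x)) (t(v := x'))"
    "a \<noteq> 0" "\<bar>a\<bar> \<le> int A" "form_ok n h" "length h \<le> A + A * m" "a * x' = form_val B t h"
proof -
  have "1 \<le> A" using A by simp
  then obtain x1 a h where x1: "0 \<le> x1" "x1 \<le> x" "similar B n A m (s(v := x)) (s(v := x1))"
    and a: "a \<noteq> 0" "\<bar>a\<bar> \<le> int A" and h: "form_ok n h" "length h \<le> A + A * m" "a * x1 = form_val B s h"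
    by (rule move_to_form[OF x(1) m])
  have am': "a * int m dvd int m'"
  proof -
    have "nat \<bar>a\<bar> dvd fact A" using a by (intro dvd_fact) auto
    then have "int (nat \<bar>a\<bar>) dvd int (fact A)" by (simp only: int_dvd_int_iff)
    then have "a dvd int (fact A)" by simp
    then have "a * int m dvd int (fact A) * int m" by (rule mult_dvd_mono) simp
    also have "\<dots> dvd int m'" using m' by (metis int_dvd_int_iff of_nat_mult)
    finally show ?thesis .
  qed
  have "int m' dvd form_val B s h - form_val B t h"
    using similarD(2)[OF sim] by (rule form_val_cong_mod)
  then have "a * int m dvd a * x1 - form_val B t h" using am' h(3) by (metis dvd_trans)
  then obtain k where k: "a * x1 - form_val B t h = a * int m * k" by (elim dvdE)
  define x' where "x' = x1 - int m * k"
  have x': "a * x' = form_val B t h" using k by (simp add: x'_def algebra_simps)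
  have signs: "sgn (form_val B (s(v := x1)) f) = sgn (form_val B (t(v := x')) f)"
    if f: "form_ok n f" "length f \<le> A" for f
  proof -
    define b where "b = vcoeff v f"
    define g where "g = scale b h @ scale a (drop_var v f)"
    have b: "\<bar>b\<bar> \<le> int A" using abs_vcoeff[OF f(1), of v] f(2) by (simp add: b_def)
    have "length g \<le> A * (A + A * m) + A * A"
      unfolding g_def using a b h(2) f(2) length_drop_var[of v f]
      by (auto intro!: add_mono mult_le_mono)
    then have "sgn (form_val B s g) = sgn (form_val B t g)"
      using h(1) f(1) A' by (intro similarD(1)[OF sim]) (auto simp: g_def)
    moreover have "form_val B s g = a * form_val B (s(v := x1)) f"
      by (simp add: g_def form_val_upd b_def h(3)[symmetric] algebra_simps)
    moreover have "form_val B t g = a * form_val B (t(v := x')) f"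
      by (simp add: g_def form_val_upd b_def x'[symmetric] algebra_simps)
    ultimately show ?thesis using a(1) by (auto simp: sgn_mult sgn_eq_0_iff)
  qed
  have "sgn (form_val B (s(v := x)) f) = sgn (form_val B (t(v := x')) f)"
    if "form_ok n f" "length f \<le> A" for f
    using signs[OF that] similarD(1)[OF x1(3) that] by simp
  moreover have "int m dvd (s(v := x)) u - (t(v := x')) u" for u
  proof (cases "u = v")
    case True
    have "int m dvd (x - x1) + int m * k"
      using similarD(2)[OF x1(3), of v] by (intro dvd_add) auto
    then show ?thesis using True by (simp add: x'_def algebra_simps)
  next
    case False
    have "m dvd m'" using m' by (rule dvd_mult_right)
    then show ?thesis using False similarD(2)[OF sim, of u] dvd_trans by fastforce
  qed
  ultimately have sim': "similar B n A m (s(v := x)) (t(v := x'))" by (simp add: similar_def)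
  \<comment> \<open>The bounds of the range are themselves sign conditions, on forms of length at
    most 2.\<close>
  have "sgn x = sgn x'"
    using similarD(1)[OF sim', of "[(1, Var v)]"] A by simp
  then have "0 \<le> x'" using x(1) by (auto simp: sgn_if split: if_splits)
  have "sgn (x - int B ^ Suc n) = sgn (x' - int B ^ Suc n)"
    using similarD(1)[OF sim', of "[(1, Var v), (-1, Base (Suc n))]"] A by simp
  then have "x' < int B ^ Suc n" using x(2) by (auto simp: sgn_if split: if_splits)
  show thesis by (rule that[OF \<open>0 \<le> x'\<close> \<open>x' < int B ^ Suc n\<close> sim' a h(1,2) x'])
qed


text \<open>\<open>lev r\<close> bounds the length of the forms and the modulus needed for quantifier depth \<open>r\<close>.\<close>

fun lev :: "nat \<Rightarrow> nat \<times> nat" where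
  "lev 0 = (3, 1)"
| "lev (Suc r) = (let (A, m) = lev r in (A * (A + A * m) + A * A, fact A * m))"

definition len_bd :: "nat \<Rightarrow> nat" where "len_bd r = fst (lev r)"
definition modulus :: "nat \<Rightarrow> nat" where "modulus r = snd (lev r)"

lemma lev_simps:
  "len_bd 0 = 3" "modulus 0 = 1"
  "len_bd (Suc r) = len_bd r * (len_bd r + len_bd r * modulus r) + len_bd r * len_bd r"
  "modulus (Suc r) = fact (len_bd r) * modulus r"
  by (simp_all add: len_bd_def modulus_def split: prod.split)

lemma lev_bounds: "3 \<le> len_bd r" "0 < modulus r" "len_bd r \<le> len_bd (Suc r)" "modulus r dvd modulus (Suc r)"
proof -
  show A: "3 \<le> len_bd r" for r
  proof (induction r)
    case (Suc r)
    then have "len_bd r * 1 \<le> len_bd r * len_bd r" by (intro mult_le_mono) auto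
    then show ?case using Suc unfolding lev_simps by linarith
  qed (simp add: lev_simps)
  have "len_bd r * 1 \<le> len_bd r * len_bd r" using A[of r] by (intro mult_le_mono) auto
  then show "len_bd r \<le> len_bd (Suc r)" unfolding lev_simps by linarith
  show "0 < modulus r" by (induction r) (simp_all add: lev_simps)
qed (simp add: lev_simps)

text \<open>The representatives of the elements that a quantifier of depth \<open>k\<close> can distinguish have the
  form \<open>y / den R k\<close>, where \<open>y\<close> is a sum of \<open>cnt R k\<close> signed powers of \<open>B\<close>. Here \<open>R\<close> is the depth
  of the sentence.\<close>

definition den :: "nat \<Rightarrow> nat \<Rightarrow> nat" where
  "den R k = (\<Prod>i \<in> {k..<R}. fact (len_bd i))"

lemma den_Suc: "k < R \<Longrightarrow> den R k = fact (len_bd k) * den R (Suc k)"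
  by (simp add: den_def prod.atLeast_Suc_lessThan)

lemma den_pos: "0 < den R k"
  by (simp add: den_def prod_pos)

lemma den_dvd: "den R k dvd den R 0"
  unfolding den_def by (rule prod_dvd_prod_subset) auto

function cnt :: "nat \<Rightarrow> nat \<Rightarrow> nat" where
  "cnt R k = (if k < R then fact (len_bd k) * (len_bd k + len_bd k * modulus k) *
     (cnt R (Suc k) + den R (Suc k)) else 1)"
  by auto
termination by (relation "measure (\<lambda>(R, k). R - k)") auto

declare cnt.simps [simp del]

section \<open>Representatives as quotients of sums of signed powers\<close>

definition pow_sums :: "nat \<Rightarrow> nat \<Rightarrow> nat \<Rightarrow> int set" where
  "pow_sums B n c = {form_val B (\<lambda>_. 0) f | f. form_ok n f \<and> length f \<le> c}"

lemma pow_sums_add: "x \<in> pow_sums B n c \<Longrightarrow> y \<in> pow_sums B n c' \<Longrightarrow> x + y \<in> pow_sums B n (c + c')"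
  unfolding pow_sums_def by clarsimp (metis add_mono form_ok_simps(3) form_val_simps(3) length_append)

lemma pow_sums_mult: "x \<in> pow_sums B n c \<Longrightarrow> nat \<bar>k\<bar> * c \<le> c' \<Longrightarrow> k * x \<in> pow_sums B n c'"
  unfolding pow_sums_def
  by clarsimp (metis form_ok_scale form_val_scale le_trans length_scale mult_le_mono2)

lemma pow_sums_mono: "x \<in> pow_sums B n c \<Longrightarrow> c \<le> c' \<Longrightarrow> x \<in> pow_sums B n c'"
  unfolding pow_sums_def by force

text \<open>After multiplication by \<open>D\<close>, a variable contributes at most
  \<open>c\<close> powers and a power contributes \<open>D\<close> copies of itself, hence
  \<open>c + D\<close> per monomial.\<close>

lemma form_val_pow_sums:
  assumes "form_ok n h" "\<And>v. int D * t v \<in> pow_sums B n c"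
  shows "int D * form_val B t h \<in> pow_sums B n (length h * (c + D))"
  using assms(1)
proof (induction h)
  case Nil
  then show ?case by (auto simp: pow_sums_def intro!: exI[of _ "[]"])
next
  case (Cons p h)
  obtain \<epsilon> a where p: "p = (\<epsilon>, a)" by fastforce
  have \<epsilon>: "nat \<bar>\<epsilon>\<bar> \<le> 1" using Cons.prems by (auto simp: p)
  have "int D * atom_val B t a \<in> pow_sums B n (c + D)"
  proof (cases a)
    case (Base e)
    have "form_val B (\<lambda>_. 0) [(1, Base e)] \<in> pow_sums B n 1"
      unfolding pow_sums_def using Cons.prems Base p by (intro CollectI exI[of _ "[(1, Base e)]"]) simp
    then have "int D * int B ^ e \<in> pow_sums B n (c + D)"
      by (intro pow_sums_mult) auto
    then show ?thesis by (simp add: Base)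
  next
    case (Var v)
    then show ?thesis using pow_sums_mono[OF assms(2)[of v]] by simp
  qed
  then have "\<epsilon> * (int D * atom_val B t a) \<in> pow_sums B n (c + D)"
    by (rule pow_sums_mult) (use \<epsilon> in \<open>metis mult_le_mono1 nat_mult_1\<close>)
  then have "\<epsilon> * (int D * atom_val B t a) + int D * form_val B t h \<in> pow_sums B n ((c + D) + length h * (c + D))"
    using Cons by (intro pow_sums_add) (auto simp: p)
  then show ?case by (simp add: p algebra_simps)
qed

definition reps :: "nat \<Rightarrow> nat \<Rightarrow> nat \<Rightarrow> nat \<Rightarrow> int set" where
  "reps B n R k = {x. 0 \<le> x \<and> x < int B ^ Suc n \<and> int (den R k) * x \<in> pow_sums B n (cnt R k)}"

text \<open>If \<open>a * x\<close> is a form in earlier representatives, then \<open>x\<close> is a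
  quotient by \<open>a\<close> times their denominator. As \<open>a\<close> divides
  \<open>fact (len_bd k)\<close>, the denominator \<open>den R k\<close> serves every possible
  \<open>a\<close>. Expanding by the cofactor multiplies the number of powers, which explains the
  recursion of \<open>cnt\<close>.\<close>

lemma reps_step:
  assumes t: "\<And>v. t v \<in> reps B n R (Suc k)" and k: "k < R" and x: "0 \<le> x" "x < int B ^ Suc n"
    and a: "a \<noteq> 0" "\<bar>a\<bar> \<le> int (len_bd k)"
    and h: "form_ok n h" "length h \<le> len_bd k + len_bd k * modulus k" "a * x = form_val B t h"
  shows "x \<in> reps B n R k"
proof -
  let ?c = "cnt R (Suc k)" and ?D = "den R (Suc k)" and ?F = "fact (len_bd k) :: nat"
  have "nat \<bar>a\<bar> dvd ?F" using a by (intro dvd_fact) auto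
  then have "int (nat \<bar>a\<bar>) dvd int ?F" by (simp only: int_dvd_int_iff)
  then have "a dvd int ?F" by simp
  then obtain d where d: "int ?F = a * d" by (elim dvdE)
  have "d \<noteq> 0" using d by (metis fact_nonzero mult_zero_right of_nat_eq_0_iff)
  have "\<bar>d\<bar> \<le> \<bar>a\<bar> * \<bar>d\<bar>" using mult_right_mono[of 1 "\<bar>a\<bar>" "\<bar>d\<bar>"] a(1) by simp
  also have "\<dots> = int ?F" using d by (metis abs_mult abs_of_nat)
  finally have "nat \<bar>d\<bar> \<le> ?F" by (simp add: nat_le_iff)
  have "int ?D * form_val B t h \<in> pow_sums B n (length h * (?c + ?D))"
    using t h(1) by (intro form_val_pow_sums) (auto simp: reps_def)
  then have "d * (int ?D * form_val B t h) \<in> pow_sums B n (cnt R k)"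
  proof (rule pow_sums_mult)
    show "nat \<bar>d\<bar> * (length h * (?c + ?D)) \<le> cnt R k"
      using \<open>nat \<bar>d\<bar> \<le> ?F\<close> h(2) k
      by (subst cnt.simps) (auto simp: mult.assoc intro!: mult_le_mono)
  qed
  moreover have "d * (int ?D * form_val B t h) = int (den R k) * x"
    using d by (simp add: den_Suc[OF k] h(3)[symmetric] algebra_simps)
  ultimately show ?thesis using x by (simp add: reps_def)
qed

lemma reps_antimono:
  assumes x: "x \<in> reps B n R (Suc k)" and k: "k < R"
  shows "x \<in> reps B n R k"
proof (rule reps_step[where t = "\<lambda>_. x" and a = 1 and h = "[(1, Var 0)]", OF x k])
  show "0 \<le> x" "x < int B ^ Suc n" using x by (simp_all add: reps_def)
qed (use lev_bounds(1)[of k] in simp_all)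

lemma reps_0: "0 < B \<Longrightarrow> 0 \<in> reps B n R k"
  by (auto simp: reps_def pow_sums_def intro!: exI[of _ "[]"])

text \<open>The longest atomic condition is \<open>x + y = z\<close>, a form of length 3. This is
  the origin of the value of \<open>len_bd 0\<close>.\<close>

lemma similar_atoms:
  assumes "similar B n 3 m s t"
  shows "s x = s y \<longleftrightarrow> t x = t y" "s x + s y = s z \<longleftrightarrow> t x + t y = t z"
    "e \<le> Suc n \<Longrightarrow> s x = int B ^ e \<longleftrightarrow> t x = int B ^ e"
proof -
  have iff: "form_val B s f = 0 \<longleftrightarrow> form_val B t f = 0" if "form_ok n f" "length f \<le> 3" for f
    using similarD(1)[OF assms that] by (metis sgn_eq_0_iff)
  show "s x = s y \<longleftrightarrow> t x = t y"
    using iff[of "[(1, Var x), (-1, Var y)]"] by simp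
  show "s x + s y = s z \<longleftrightarrow> t x + t y = t z"
    using iff[of "[(1, Var x), (1, Var y), (-1, Var z)]"] by (simp add: algebra_simps)
  show "s x = int B ^ e \<longleftrightarrow> t x = int B ^ e" if "e \<le> Suc n"
    using iff[of "[(1, Var x), (-1, Base e)]"] that by simp
qed

text \<open>The representatives are multiplied by \<open>D\<close>; this does not affect the homogeneous relations.\<close>

lemma plus_equiv_reps:
  fixes D :: nat
  assumes B: "0 < B" and D: "0 < D"
    and T: "\<And>i t. i < length \<tau> \<Longrightarrow> t \<in> T i \<Longrightarrow> set t \<subseteq> {..<n}"
    and \<phi>: "wf_fm {plus_rel} {} \<tau> \<phi>"
  shows "isat (\<lambda>_. {..<B ^ Suc n}) (\<lambda>i t. t \<in> map (\<lambda>j. B ^ Suc j) ` T i) (\<lambda>S t. t \<in> snd S) (\<lambda>_. 0) \<phi> \<longleftrightarrow>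
    isat (\<lambda>k. (*) (int D) ` reps B n (qd \<phi>) k) (\<lambda>i t. t \<in> map (\<lambda>j. int D * int B ^ Suc j) ` T i)
      (\<lambda>S t. \<exists>x y. t = [x, y, x + y]) (\<lambda>_. 0) \<phi>"
proof -
  let ?R = "qd \<phi>"
  define sim where "sim r s t \<longleftrightarrow> similar B n (len_bd r) (modulus r) (\<lambda>v. int (s v)) t" for r and s :: "nat \<Rightarrow> nat" and t
  define I where "I r s t \<longleftrightarrow> (\<exists>u. t = (\<lambda>v. int D * u v) \<and> sim r s u \<and> (\<forall>v. u v \<in> reps B n ?R r))"
    for r and s :: "nat \<Rightarrow> nat" and t :: "nat \<Rightarrow> int"
  have A2: "2 \<le> len_bd r" for r using lev_bounds(1)[of r] by simp
  have upd: "(\<lambda>v. int ((s(x := a)) v)) = (\<lambda>v. int (s v))(x := int a)" for s :: "nat \<Rightarrow> nat" and x a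
    by auto
  show ?thesis
  proof (rule isat_game[where I = I and m = ?R, OF _ _ _ _ _ _ \<phi> order_refl])
    fix r s t assume "r < ?R" "I (Suc r) s t"
    then show "I r s t"
      unfolding I_def sim_def using lev_bounds(3,4)[of r] by (metis reps_antimono similar_mono)
  next
    fix r s t a and x :: nat assume r: "r < ?R" and I: "I (Suc r) s t" and a: "a \<in> {..<B ^ Suc n}"
    obtain u where u: "t = (\<lambda>v. int D * u v)" "sim (Suc r) s u" "\<And>v. u v \<in> reps B n ?R (Suc r)"
      using I unfolding I_def by blast
    have "int a < int B ^ Suc n" using a by (metis lessThan_iff of_nat_less_iff of_nat_power)
    then obtain b c h where b: "0 \<le> b" "b < int B ^ Suc n"
        "similar B n (len_bd r) (modulus r) ((\<lambda>v. int (s v))(x := int a)) (u(x := b))"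
      and c: "c \<noteq> 0" "\<bar>c\<bar> \<le> int (len_bd r)" "form_ok n h" "length h \<le> len_bd r + len_bd r * modulus r"
        "c * b = form_val B u h"
      using similar_extend[OF u(2)[unfolded sim_def] lev_bounds(2)[of r] A2[of r], of "int a"]
      by (metis lev_simps(3,4) dvd_refl le_refl of_nat_0_le_iff)
    \<comment> \<open>An arbitrary element of the padding is answered by a quotient of a form by
      \<open>c\<close>, so restricting the range to such quotients loses nothing.\<close>
    have "b \<in> reps B n ?R r" using u(3) r b(1,2) c by (rule reps_step)
    moreover have "sim r (s(x := a)) (u(x := b))" unfolding sim_def upd by (rule b(3))
    ultimately have "I r (s(x := a)) (t(x := int D * b))"
      unfolding I_def using u(1,3) r reps_antimono
      by (intro exI[of _ "u(x := b)"]) (auto simp: fun_eq_iff)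
    with \<open>b \<in> reps B n ?R r\<close>
    show "\<exists>b\<in>(*) (int D) ` reps B n ?R r. I r (s(x := a)) (t(x := b))" by blast
  next
    fix r s t b and x :: nat
    assume r: "r < ?R" and I: "I (Suc r) s t" and "b \<in> (*) (int D) ` reps B n ?R r"
    then obtain b' where b': "b = int D * b'" "b' \<in> reps B n ?R r" by blast
    obtain u where u: "t = (\<lambda>v. int D * u v)" "sim (Suc r) s u" "\<And>v. u v \<in> reps B n ?R (Suc r)"
      using I unfolding I_def by blast
    have "0 \<le> b'" "b' < int B ^ Suc n" using b'(2) by (auto simp: reps_def)
    then obtain a where a: "0 \<le> a" "a < int B ^ Suc n"
        "similar B n (len_bd r) (modulus r) (u(x := b')) ((\<lambda>v. int (s v))(x := a))"
      using similar_extend[OF similar_sym[OF u(2)[unfolded sim_def]] lev_bounds(2)[of r] A2[of r], of b']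
      by (metis lev_simps(3,4) dvd_refl le_refl)
    have "nat a < B ^ Suc n" using a(1,2) by (simp add: nat_less_iff)
    moreover have "sim r (s(x := nat a)) (u(x := b'))"
      unfolding sim_def upd using similar_sym[OF a(3)] a(1) by simp
    then have "I r (s(x := nat a)) (t(x := b))"
      unfolding I_def using u(1,3) b' r reps_antimono
      by (intro exI[of _ "u(x := b')"]) (auto simp: fun_eq_iff)
    ultimately show "\<exists>a\<in>{..<B ^ Suc n}. I r (s(x := a)) (t(x := b))" by blast
  next
    fix s t and x y :: nat assume "I 0 s t"
    then obtain u where u: "t = (\<lambda>v. int D * u v)" "similar B n 3 1 (\<lambda>v. int (s v)) u"
      unfolding I_def sim_def by (auto simp: lev_simps)
    then show "s x = s y \<longleftrightarrow> t x = t y" using similar_atoms(1)[OF u(2), of x y] D by simp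
  next
    fix s t i and xs :: "nat list" assume "I 0 s t" and i: "i < length \<tau>"
    then obtain u where u: "t = (\<lambda>v. int D * u v)" "similar B n 3 1 (\<lambda>v. int (s v)) u"
      unfolding I_def sim_def by (auto simp: lev_simps)
    have "map s xs = map (\<lambda>j. B ^ Suc j) w \<longleftrightarrow> map t xs = map (\<lambda>j. int D * int B ^ Suc j) w" if "w \<in> T i" for w
    proof -
      have "s x = B ^ Suc j \<longleftrightarrow> t x = int D * int B ^ Suc j" if "j < n" for x j
      proof -
        have "s x = B ^ Suc j \<longleftrightarrow> int (s x) = int B ^ Suc j" by (metis of_nat_eq_iff of_nat_power)
        also have "\<dots> \<longleftrightarrow> u x = int B ^ Suc j" using that by (intro similar_atoms(3)[OF u(2)]) simp
        also have "\<dots> \<longleftrightarrow> t x = int D * int B ^ Suc j" using D by (simp add: u(1))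
        finally show ?thesis .
      qed
      moreover have "w ! j < n" if "j < length w" for j
        using T[OF i \<open>w \<in> T i\<close>] that by (auto dest: nth_mem)
      ultimately show ?thesis by (auto simp: list_eq_iff_nth_eq simp del: power_Suc)
    qed
    then show "map s xs \<in> map (\<lambda>j. B ^ Suc j) ` T i \<longleftrightarrow> map t xs \<in> map (\<lambda>j. int D * int B ^ Suc j) ` T i"
      unfolding image_iff by metis
  next
    fix s t S and xs :: "nat list" assume "I 0 s t" and S: "S \<in> {plus_rel}" "length xs = fst S"
    then obtain u where u: "t = (\<lambda>v. int D * u v)" "similar B n 3 1 (\<lambda>v. int (s v)) u"
      unfolding I_def sim_def by (auto simp: lev_simps)
    obtain x y z where xs: "xs = [x, y, z]"
      using S by (auto simp: plus_rel_def length_Suc_conv numeral_3_eq_3)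
    have "s x + s y = s z \<longleftrightarrow> int (s x) + int (s y) = int (s z)" by linarith
    also have "\<dots> \<longleftrightarrow> u x + u y = u z" by (rule similar_atoms(2)[OF u(2)])
    also have "\<dots> \<longleftrightarrow> t x + t y = t z" using D by (simp add: u(1) distrib_left[symmetric])
    finally show "map s xs \<in> snd S \<longleftrightarrow> (\<exists>x y. map t xs = [x, y, x + y])"
      using S(1) by (auto simp: xs plus_rel_def)
  next
    show "I ?R (\<lambda>_. 0) (\<lambda>_. 0)"
      unfolding I_def sim_def using reps_0[OF B] by (intro exI[of _ "\<lambda>_. 0"]) (auto simp: similar_def)
  qed
qed

section \<open>Order patterns determine signs\<close>

text \<open>The terms outside \<open>T\<close> have exponents below \<open>E\<close> and total
  weight below \<open>B\<close>. Together they stay below \<open>B ^ E\<close> and cannot outweigh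
  its nonzero collected coefficient.\<close>

lemma sgn_sum_powers_leading:
  fixes \<epsilon> :: "'i \<Rightarrow> int" and e :: "'i \<Rightarrow> nat"
  assumes J: "finite J" "T \<subseteq> J" and T: "\<And>j. j \<in> T \<Longrightarrow> e j = E" and rest: "\<And>j. j \<in> J - T \<Longrightarrow> e j < E"
    and B: "(\<Sum>j\<in>J. \<bar>\<epsilon> j\<bar>) < int B" and c: "(\<Sum>j\<in>T. \<epsilon> j) \<noteq> 0"
  shows "sgn (\<Sum>j\<in>J. \<epsilon> j * int B ^ e j) = sgn (\<Sum>j\<in>T. \<epsilon> j)"
proof -
  let ?c = "\<Sum>j\<in>T. \<epsilon> j" and ?r = "\<Sum>j\<in>J - T. \<epsilon> j * int B ^ e j"
  have "0 \<le> (\<Sum>j\<in>J. \<bar>\<epsilon> j\<bar>)" by (intro sum_nonneg) simp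
  then have B0: "0 < int B" using B by linarith
  have "(\<Sum>j\<in>J. \<epsilon> j * int B ^ e j) = ?r + (\<Sum>j\<in>T. \<epsilon> j * int B ^ e j)"
    by (rule sum.subset_diff[OF J(2,1)])
  also have "(\<Sum>j\<in>T. \<epsilon> j * int B ^ e j) = ?c * int B ^ E"
    by (simp add: T sum_distrib_right)
  finally have split: "(\<Sum>j\<in>J. \<epsilon> j * int B ^ e j) = ?r + ?c * int B ^ E" .
  have r: "\<bar>?r\<bar> < int B ^ E"
  proof (cases "J - T = {}")
    case False
    then obtain E' where E: "E = Suc E'" using rest by (metis all_not_in_conv less_nat_zero_code old.nat.exhaust)
    have "\<bar>?r\<bar> \<le> (\<Sum>j\<in>J - T. \<bar>\<epsilon> j\<bar> * int B ^ E')"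
    proof (rule order_trans[OF sum_abs sum_mono])
      fix j assume "j \<in> J - T"
      then have "int B ^ e j \<le> int B ^ E'"
        using rest[of j] E B0 by (intro power_increasing) auto
      then show "\<bar>\<epsilon> j * int B ^ e j\<bar> \<le> \<bar>\<epsilon> j\<bar> * int B ^ E'"
        by (simp add: abs_mult mult_left_mono)
    qed
    also have "\<dots> \<le> (\<Sum>j\<in>J. \<bar>\<epsilon> j\<bar> * int B ^ E')"
      using J B0 by (intro sum_mono2) auto
    also have "\<dots> < int B * int B ^ E'"
      unfolding sum_distrib_right[symmetric] using B B0 by (intro mult_strict_right_mono) auto
    finally show ?thesis by (simp add: E)
  next
    case True
    show ?thesis unfolding True using B0 by simp
  qed
  have "?c * int B ^ E \<ge> int B ^ E" if "?c > 0"
    using mult_right_mono[of 1 ?c "int B ^ E"] that B0 by simp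
  moreover have "?c * int B ^ E \<le> - (int B ^ E)" if "?c < 0"
    using mult_right_mono[of ?c "-1" "int B ^ E"] that B0 by simp
  ultimately show ?thesis
    unfolding split using r c by (cases "?c > 0") (auto simp: sgn_if)
qed

text \<open>The class of largest exponents is the same for \<open>e\<close> and \<open>e'\<close>.
  If its coefficients cancel, it is removed and the induction continues; otherwise it decides both
  signs.\<close>

lemma sgn_sum_powers_cong:
  fixes \<epsilon> :: "'i \<Rightarrow> int" and e e' :: "'i \<Rightarrow> nat"
  assumes "finite J" "(\<Sum>j\<in>J. \<bar>\<epsilon> j\<bar>) < int B"
    and "\<And>i j. i \<in> J \<Longrightarrow> j \<in> J \<Longrightarrow> e i \<le> e j \<longleftrightarrow> e' i \<le> e' j"
  shows "sgn (\<Sum>j\<in>J. \<epsilon> j * int B ^ e j) = sgn (\<Sum>j\<in>J. \<epsilon> j * int B ^ e' j)"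
  using assms
proof (induction J rule: finite_psubset_induct)
  case (psubset J)
  show ?case
  proof (cases "J = {}")
    case False
    then have "Max (e ` J) \<in> e ` J" using psubset.hyps by (intro Max_in) auto
    then obtain k where k: "k \<in> J" "\<And>j. j \<in> J \<Longrightarrow> e j \<le> e k"
      using psubset.hyps by (metis (no_types, lifting) Max_ge finite_imageI imageE imageI)
    have k': "e' j \<le> e' k" if "j \<in> J" for j using psubset.prems(2) k that by blast
    define T where "T = {j \<in> J. e j = e k}"
    have T': "T = {j \<in> J. e' j = e' k}"
    proof -
      have "e j = e k \<longleftrightarrow> e' j = e' k" if "j \<in> J" for j
        using psubset.prems(2)[OF k(1) that] k(2)[OF that] k'[OF that] by linarith
      then show ?thesis by (auto simp: T_def)
    qed
    have "k \<in> T" "T \<subseteq> J" using k(1) by (auto simp: T_def)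
    show ?thesis
    proof (cases "(\<Sum>j\<in>T. \<epsilon> j) = 0")
      case True
      have drop: "(\<Sum>j\<in>J. \<epsilon> j * int B ^ f j) = (\<Sum>j\<in>J - T. \<epsilon> j * int B ^ f j)"
        if "\<And>j. j \<in> T \<Longrightarrow> f j = f k" for f :: "'i \<Rightarrow> nat"
      proof -
        have "(\<Sum>j\<in>T. \<epsilon> j * int B ^ f j) = (\<Sum>j\<in>T. \<epsilon> j) * int B ^ f k"
          by (simp add: that sum_distrib_right)
        then show ?thesis using sum.subset_diff[OF \<open>T \<subseteq> J\<close> psubset.hyps(1), of "\<lambda>j. \<epsilon> j * int B ^ f j"] True
          by simp
      qed
      have "(\<Sum>j\<in>J - T. \<bar>\<epsilon> j\<bar>) \<le> (\<Sum>j\<in>J. \<bar>\<epsilon> j\<bar>)"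
        using psubset.hyps by (intro sum_mono2) auto
      then have "sgn (\<Sum>j\<in>J - T. \<epsilon> j * int B ^ e j) = sgn (\<Sum>j\<in>J - T. \<epsilon> j * int B ^ e' j)"
        using psubset.prems \<open>k \<in> T\<close> \<open>T \<subseteq> J\<close> by (intro psubset.IH) auto
      moreover have "\<And>j. j \<in> T \<Longrightarrow> e j = e k" by (simp add: T_def)
      moreover have "\<And>j. j \<in> T \<Longrightarrow> e' j = e' k" by (simp add: T')
      ultimately show ?thesis by (simp only: drop)
    next
      case False
      have "sgn (\<Sum>j\<in>J. \<epsilon> j * int B ^ e j) = sgn (\<Sum>j\<in>T. \<epsilon> j)"
        using psubset.hyps \<open>T \<subseteq> J\<close> psubset.prems(1) False k(2)
        by (intro sgn_sum_powers_leading[where E = "e k"]) (auto simp: T_def le_less)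
      moreover have "sgn (\<Sum>j\<in>J. \<epsilon> j * int B ^ e' j) = sgn (\<Sum>j\<in>T. \<epsilon> j)"
        using psubset.hyps \<open>T \<subseteq> J\<close> psubset.prems(1) False k'
        by (intro sgn_sum_powers_leading[where E = "e' k"]) (auto simp: T' le_less)
      ultimately show ?thesis by simp
    qed
  qed simp
qed

text \<open>Kind 0 stands for \<open>1\<close>, kind 1 for the element of the padded model that corresponds to
  \<open>a\<close>, and kind 2 for the size of the padded model.\<close>

definition expo :: "'a br_struct \<Rightarrow> nat \<Rightarrow> 'a \<Rightarrow> nat" where
  "expo M ty a = (if ty = 0 then 0 else if ty = 1 then Suc (rank M a) else Suc (card (Dom M)))"

type_synonym entry = "int \<times> nat \<times> nat"

section \<open>Definability of the signs of sums of powers\<close>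

definition ent_val :: "nat \<Rightarrow> 'a br_struct \<Rightarrow> (nat \<Rightarrow> 'a) \<Rightarrow> entry list \<Rightarrow> int" where
  "ent_val B M s es = (\<Sum>(\<epsilon>, ty, v) \<leftarrow> es. \<epsilon> * int B ^ expo M ty (s v))"

definition weight :: "entry list \<Rightarrow> int" where
  "weight es = (\<Sum>(\<epsilon>, ty, v) \<leftarrow> es. \<bar>\<epsilon>\<bar>)"

definition neg :: "entry list \<Rightarrow> entry list" where
  "neg es = map (\<lambda>(\<epsilon>, r). (- \<epsilon>, r)) es"

lemma ent_val_simps [simp]:
  "ent_val B M s [] = 0"
  "ent_val B M s ((\<epsilon>, ty, v) # es) = \<epsilon> * int B ^ expo M ty (s v) + ent_val B M s es"
  "ent_val B M s (es @ es') = ent_val B M s es + ent_val B M s es'"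
  by (simp_all add: ent_val_def)

lemma weight_simps [simp]:
  "weight [] = 0" "weight ((\<epsilon>, ty, v) # es) = \<bar>\<epsilon>\<bar> + weight es" "weight (es @ es') = weight es + weight es'"
  by (simp_all add: weight_def)

lemma ent_val_neg [simp]: "ent_val B M s (neg es) = - ent_val B M s es"
  by (induction es) (auto simp: neg_def)

lemma weight_neg [simp]: "weight (neg es) = weight es"
  by (induction es) (auto simp: neg_def)

text \<open>Exponents of kind 1 lie strictly between 0 and \<open>card (Dom M) + 1\<close>. Hence
  the kinds alone decide every comparison except that of two exponents of kind 1.\<close>

lemma definable_expo_le: "definable_pred \<tau> (\<lambda>M s. expo M ty (s x) \<le> expo M ty' (s y))"
proof (cases "ty = 1 \<and> ty' = 1")
  case True
  then show ?thesis by (intro definable_pred_cong[OF definable_le[of \<tau> x y]]) (auto simp: expo_def)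
next
  case False
  show ?thesis
  proof (rule definable_pred_cong[OF definable_const[of \<tau> "ty = 0 \<or> (ty = 1 \<and> ty' > 1) \<or> (ty > 1 \<and> ty' > 1)"]])
    fix M :: "'a br_struct" and s :: "nat \<Rightarrow> 'a" assume M: "br_model \<tau> M" and s: "range s \<subseteq> Dom M"
    have "rank M (s v) < card (Dom M)" for v using s by (intro br_modelD(6)[OF M]) auto
    from this[of x] this[of y] False
    show "(ty = 0 \<or> (ty = 1 \<and> ty' > 1) \<or> (ty > 1 \<and> ty' > 1)) \<longleftrightarrow> expo M ty (s x) \<le> expo M ty' (s y)"
      by (auto simp: expo_def)
  qed
qed

text \<open>The sign depends only on the order pattern of the exponents, and there are finitely many
  patterns. \<open>good\<close> collects those that some model realizes with a positive value; one
  realization speaks for all.\<close>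

lemma definable_ent_pos:
  assumes w: "weight es < int B"
  shows "definable_pred \<tau> (\<lambda>M s. 0 < ent_val B M s es)"
proof -
  define J where "J = {..<length es}"
  define coef where "coef i = fst (es ! i)" for i
  define ex where "ex M s i = expo M (fst (snd (es ! i))) (s (snd (snd (es ! i))))"
    for M :: "'a br_struct" and s i
  define good where "good = {\<pi> \<in> Pow (J \<times> J). \<exists>M s. br_model \<tau> M \<and> range s \<subseteq> Dom M \<and>
    (\<forall>p \<in> J \<times> J. p \<in> \<pi> \<longleftrightarrow> ex M s (fst p) \<le> ex M s (snd p)) \<and> 0 < ent_val B M s es}"
  have val: "ent_val B M s es = (\<Sum>i\<in>J. coef i * int B ^ ex M s i)" for M :: "'a br_struct" and s
    unfolding ent_val_def J_def coef_def ex_def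
    by (simp add: sum_list_sum_nth atLeast0LessThan split_def)
  have "weight es = (\<Sum>i\<in>J. \<bar>coef i\<bar>)"
    unfolding weight_def J_def coef_def by (simp add: sum_list_sum_nth atLeast0LessThan split_def)
  then have w': "(\<Sum>i\<in>J. \<bar>coef i\<bar>) < int B" using w by simp
  have "definable_pred \<tau> (\<lambda>M s. \<exists>\<pi> \<in> good. \<forall>p \<in> J \<times> J. p \<in> \<pi> \<longleftrightarrow> ex M s (fst p) \<le> ex M s (snd p))"
  proof (intro definable_finite_Disj definable_finite_Conj)
    show "finite good" by (simp add: good_def J_def)
    show "finite (J \<times> J)" by (simp add: J_def)
    have "definable_pred \<tau> (\<lambda>M s. ex M s i \<le> ex M s j)" for i j
      unfolding ex_def by (rule definable_expo_le)
    then show "definable_pred \<tau> (\<lambda>M s. p \<in> \<pi> \<longleftrightarrow> ex M s (fst p) \<le> ex M s (snd p))" for p \<pi>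
      by (cases "p \<in> \<pi>") (simp_all add: definable_Neg)
  qed
  then show ?thesis
  proof (rule definable_pred_cong)
    fix M :: "'a br_struct" and s :: "nat \<Rightarrow> 'a" assume M: "br_model \<tau> M" "range s \<subseteq> Dom M"
    show "(\<exists>\<pi> \<in> good. \<forall>p \<in> J \<times> J. p \<in> \<pi> \<longleftrightarrow> ex M s (fst p) \<le> ex M s (snd p)) \<longleftrightarrow> 0 < ent_val B M s es"
    proof
      assume "\<exists>\<pi> \<in> good. \<forall>p \<in> J \<times> J. p \<in> \<pi> \<longleftrightarrow> ex M s (fst p) \<le> ex M s (snd p)"
      then obtain \<pi> M' s' where \<pi>: "\<forall>p \<in> J \<times> J. p \<in> \<pi> \<longleftrightarrow> ex M s (fst p) \<le> ex M s (snd p)"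
        "\<forall>p \<in> J \<times> J. p \<in> \<pi> \<longleftrightarrow> ex M' s' (fst p) \<le> ex M' s' (snd p)" "0 < ent_val B M' s' es"
        unfolding good_def by blast
      have "ex M s i \<le> ex M s j \<longleftrightarrow> ex M' s' i \<le> ex M' s' j" if "i \<in> J" "j \<in> J" for i j
        using \<pi>(1,2) that by force
      then have "sgn (ent_val B M s es) = sgn (ent_val B M' s' es)"
        unfolding val using w' by (intro sgn_sum_powers_cong) (auto simp: J_def)
      then show "0 < ent_val B M s es" using \<pi>(3) by (auto simp: sgn_if split: if_splits)
    next
      assume "0 < ent_val B M s es"
      then have "{p \<in> J \<times> J. ex M s (fst p) \<le> ex M s (snd p)} \<in> good"
        unfolding good_def using M by blast
      then show "\<exists>\<pi> \<in> good. \<forall>p \<in> J \<times> J. p \<in> \<pi> \<longleftrightarrow> ex M s (fst p) \<le> ex M s (snd p)"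
        by (rule rev_bexI) blast
    qed
  qed
qed

lemma definable_ent_zero:
  assumes "weight es < int B"
  shows "definable_pred \<tau> (\<lambda>M s. ent_val B M s es = 0)"
proof (rule definable_pred_cong)
  show "definable_pred \<tau> (\<lambda>M s. \<not> 0 < ent_val B M s es \<and> \<not> 0 < ent_val B M s (neg es))"
    using assms by (intro definable_Conj definable_Neg definable_ent_pos) simp_all
qed auto


section \<open>Addition\<close>

type_synonym code = "(int \<times> nat) list"

text \<open>\<open>l\<close> is the finite part of a name, coefficients and kinds, and
  \<open>t\<close> supplies the elements. Since \<open>zip\<close> drops the surplus of
  \<open>t\<close>, one length of \<open>t\<close> serves codes of different lengths.\<close>

definition code_val :: "nat \<Rightarrow> 'a br_struct \<Rightarrow> code \<Rightarrow> 'a list \<Rightarrow> int" where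
  "code_val B M l t = (\<Sum>((\<epsilon>, ty), a) \<leftarrow> zip l t. \<epsilon> * int B ^ expo M ty a)"

definition entries :: "code \<Rightarrow> nat list \<Rightarrow> entry list" where
  "entries l vs = map (\<lambda>((\<epsilon>, ty), v). (\<epsilon>, ty, v)) (zip l vs)"

lemma code_val_map: "code_val B M l (map s vs) = ent_val B M s (entries l vs)"
  by (simp add: code_val_def entries_def ent_val_def zip_map2 comp_def split_def)

lemma weight_entries: "weight (entries l vs) \<le> (\<Sum>(\<epsilon>, ty) \<leftarrow> l. \<bar>\<epsilon>\<bar>)"
proof (induction l arbitrary: vs)
  case (Cons p l)
  have "0 \<le> (\<Sum>(\<epsilon>, ty) \<leftarrow> l. \<bar>\<epsilon>\<bar>)" by (intro sum_list_nonneg) auto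
  then show ?case using Cons[of "tl vs"] by (cases vs; cases p) (auto simp: entries_def)
qed (simp add: entries_def)

text \<open>\<open>D\<close> divides every power of \<open>B\<close> with positive exponent, so only
  entries of kind 0 count modulo \<open>D\<close>. Divisibility thus becomes a property of the
  label.\<close>

lemma code_val_mod:
  assumes "int D dvd int B" "length l \<le> length t"
  shows "int D dvd code_val B M l t \<longleftrightarrow> int D dvd (\<Sum>(\<epsilon>, ty) \<leftarrow> l. if ty = 0 then \<epsilon> else 0)"
proof -
  have "int D dvd code_val B M l t - (\<Sum>(\<epsilon>, ty) \<leftarrow> l. if ty = 0 then \<epsilon> else 0)"
    using assms(2)
  proof (induction l t rule: list_induct2')
    case (4 p l a t)
    obtain \<epsilon> ty where p: "p = (\<epsilon>, ty)" by fastforce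
    have "int D dvd \<epsilon> * int B ^ expo M ty a - (if ty = 0 then \<epsilon> else 0)"
      using assms(1) by (auto simp: expo_def intro: dvd_mult)
    moreover have "int D dvd code_val B M l t - (\<Sum>(\<epsilon>, ty) \<leftarrow> l. if ty = 0 then \<epsilon> else 0)"
      using 4 by simp
    ultimately have "int D dvd (\<epsilon> * int B ^ expo M ty a - (if ty = 0 then \<epsilon> else 0)) +
      (code_val B M l t - (\<Sum>(\<epsilon>, ty) \<leftarrow> l. if ty = 0 then \<epsilon> else 0))" by (rule dvd_add)
    then show ?case by (simp add: p code_val_def algebra_simps)
  qed (auto simp: code_val_def)
  then show ?thesis by (metis dvd_diff_right_iff dvd_diff_left_iff diff_add_cancel dvd_add_right_iff)
qed

text \<open>Multiplied by the common denominator \<open>den R 0\<close>, a quotient with denominator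
  \<open>den R k\<close> is \<open>\<mu>\<close> times a sum of signed powers, hence the
  coefficients.\<close>

definition codes :: "nat \<Rightarrow> nat \<Rightarrow> code set" where
  "codes R k = (let \<mu> = int (den R 0 div den R k) in
     {l. length l = cnt R k \<and> set l \<subseteq> {-\<mu>, 0, \<mu>} \<times> {0, 1, 2}})"

lemma finite_codes: "finite (codes R k)"
proof -
  define \<mu> where "\<mu> = int (den R 0 div den R k)"
  have "codes R k = {l. set l \<subseteq> {-\<mu>, 0, \<mu>} \<times> {0, 1, 2} \<and> length l = cnt R k}"
    by (auto simp: codes_def \<mu>_def Let_def)
  then show ?thesis by (simp add: finite_lists_length_eq)
qed

text \<open>The exponents 1 to \<open>n\<close> name elements of \<open>M\<close>; 0 and
  \<open>n + 1\<close> are kinds 0 and 2. Divisibility by \<open>D\<close> and the two bounds select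
  the codes whose quotient by \<open>D\<close> is an integer in the range of the padded
  model.\<close>

lemma reps_eq_codes:
  fixes M :: "'a br_struct" and R :: nat
  defines "D \<equiv> den R 0" and "n \<equiv> card (Dom M)"
  assumes M: "br_model \<tau> M" and d: "cnt R k \<le> d"
  shows "(*) (int D) ` reps B n R k = {code_val B M l t | l t. l \<in> codes R k \<and> t \<in> tuples (Dom M) d \<and>
    (int D dvd code_val B M l t \<and> 0 \<le> code_val B M l t \<and> code_val B M l t < int D * int B ^ Suc n)}"
    (is "_ = ?C")
proof -
  define \<mu> where "\<mu> = int (D div den R k)"
  have D0: "0 < D" by (simp add: D_def den_pos)
  have \<mu>: "\<mu> * int (den R k) = int D"
    unfolding \<mu>_def D_def using den_dvd[of R k] by (metis dvd_div_mult_self of_nat_mult)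
  have \<mu>0: "0 < \<mu>" using \<mu> D0 den_pos[of R k]
    by (metis of_nat_0_less_iff zero_less_mult_pos2)
  have codes: "l \<in> codes R k \<longleftrightarrow> length l = cnt R k \<and> set l \<subseteq> {-\<mu>, 0, \<mu>} \<times> {0, 1, 2}" for l
    by (simp add: codes_def \<mu>_def D_def Let_def)
  obtain a\<^sub>0 where a\<^sub>0: "a\<^sub>0 \<in> Dom M" using br_modelD(2)[OF M] by auto
  show ?thesis
  proof (intro set_eqI iffI)
    fix y assume "y \<in> (*) (int D) ` reps B n R k"
    then obtain x f where x: "y = int D * x" "0 \<le> x" "x < int B ^ Suc n"
      and f: "int (den R k) * x = form_val B (\<lambda>_. 0) f" "form_ok n f" "length f \<le> cnt R k"
      by (auto simp: reps_def pow_sums_def)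
    define kind where "kind e = (if e = 0 then 0 else if e \<le> n then 1 else 2 :: nat)" for e
    have "\<exists>a \<in> Dom M. e \<le> Suc n \<longrightarrow> expo M (kind e) a = e" for e
    proof (cases "e = 0 \<or> n < e")
      case False
      then have "e - 1 \<in> rank M ` Dom M"
        using br_modelD(3)[OF M] unfolding bij_betw_def n_def by auto
      then obtain a where "a \<in> Dom M" "rank M a = e - 1" by auto
      then show ?thesis using False by (intro bexI[of _ a]) (auto simp: expo_def kind_def)
    qed (use a\<^sub>0 in \<open>auto simp: expo_def kind_def n_def\<close>)
    then obtain el where el: "\<And>e. el e \<in> Dom M" "\<And>e. e \<le> Suc n \<Longrightarrow> expo M (kind e) (el e) = e"
      by metis
    define c where "c p = (case p of (\<epsilon>, Base e) \<Rightarrow> (\<mu> * \<epsilon>, kind e) | (\<epsilon>, Var v) \<Rightarrow> (0, 0))" for p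
    define e where "e p = (case p of (\<epsilon>, Base e) \<Rightarrow> el e | (\<epsilon>, Var v) \<Rightarrow> a\<^sub>0)" for p :: "int \<times> atom"
    \<comment> \<open>Zero coefficients and an arbitrary element fill up the two lists to their
      prescribed lengths.\<close>
    define l where "l = map c f @ replicate (cnt R k - length f) (0, 0)"
    define t where "t = map e f @ replicate (d - length f) a\<^sub>0"
    have "code_val B M (map c f @ replicate i (0, 0)) (map e f @ u) = \<mu> * form_val B (\<lambda>_. 0) f" for i u
      using f(2)
    proof (induction f)
      case Nil
      have "code_val B M (replicate i (0, 0)) u = 0"
      proof (induction i arbitrary: u)
        case (Suc i)
        then show ?case by (cases u) (auto simp: code_val_def)
      qed (simp add: code_val_def)
      then show ?case by simp
    next
      case (Cons p f)
      obtain \<epsilon> a where "p = (\<epsilon>, a)" by fastforce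
      with Cons show ?case
        by (cases a) (auto simp: code_val_def c_def e_def el(2) algebra_simps)
    qed
    then have "code_val B M l t = y"
      unfolding l_def t_def using f(1) \<mu> x(1) by (metis mult.assoc)
    moreover have "c p \<in> {-\<mu>, 0, \<mu>} \<times> {0, 1, 2}" if "p \<in> set f" for p
      using f(2) that by (force simp: c_def form_ok_def kind_def split: prod.split atom.split)
    then have "c ` set f \<subseteq> {-\<mu>, 0, \<mu>} \<times> {0, 1, 2}" by blast
    moreover have "set l \<subseteq> c ` set f \<union> {(0, 0)}" "length l = cnt R k"
      using f(3) by (auto simp: l_def)
    ultimately have "code_val B M l t = y \<and> l \<in> codes R k" unfolding codes by blast
    moreover have "t \<in> tuples (Dom M) d"
      using f(3) d el(1) a\<^sub>0 by (auto simp: tuples_def t_def e_def split: prod.split atom.split)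
    moreover have "int D * x < int D * int B ^ Suc n"
      using x(3) D0 by (intro mult_strict_left_mono) auto
    moreover have "0 \<le> int D * x" using x(2) by simp
    ultimately show "y \<in> ?C" unfolding x(1)
      by (intro CollectI exI[of _ l] exI[of _ t]) simp
  next
    fix y assume "y \<in> ?C"
    then obtain l t where y: "y = code_val B M l t" "int D dvd y" "0 \<le> y" "y < int D * int B ^ Suc n"
      and l: "length l = cnt R k" "set l \<subseteq> {-\<mu>, 0, \<mu>} \<times> {0, 1, 2}" and t: "t \<in> tuples (Dom M) d"
      unfolding codes by blast
    obtain x where x: "y = int D * x" using y(2) by (elim dvdE)
    define f where "f = map (\<lambda>((\<epsilon>, ty), a). (sgn \<epsilon>, Base (expo M ty a))) (zip l t)"
    have "code_val B M l t = \<mu> * form_val B (\<lambda>_. 0) f"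
      unfolding f_def using l(2) \<mu>0
    proof (induction l t rule: list_induct2')
      case (4 p l a t)
      obtain \<epsilon> ty where p: "p = (\<epsilon>, ty)" by fastforce
      have "\<epsilon> = \<mu> * sgn \<epsilon>" using 4(2,3) by (auto simp: p)
      then have "\<epsilon> * int B ^ expo M ty a = \<mu> * (sgn \<epsilon> * int B ^ expo M ty a)" by simp
      moreover have "code_val B M l t = \<mu> * form_val B (\<lambda>_. 0) (map (\<lambda>((\<epsilon>, ty), a). (sgn \<epsilon>, Base (expo M ty a))) (zip l t))"
        using 4 by simp
      ultimately show ?case by (simp add: p code_val_def distrib_left)
    qed (auto simp: code_val_def)
    then have "\<mu> * (int (den R k) * x) = \<mu> * form_val B (\<lambda>_. 0) f"
      using \<mu> x y(1) by (metis mult.assoc)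
    then have "int (den R k) * x = form_val B (\<lambda>_. 0) f" using \<mu>0 by simp
    moreover have "form_ok n f"
    proof -
      have "expo M ty a \<le> Suc n" if "a \<in> Dom M" for ty a
        using br_modelD(6)[OF M that] by (auto simp: expo_def n_def)
      moreover have "sgn \<epsilon> \<in> {-1, 0, 1}" for \<epsilon> :: int by (cases \<epsilon> "0 :: int" rule: linorder_cases) auto
      moreover have "a \<in> Dom M" if "(p, a) \<in> set (zip l t)" for p a
        using t set_zip_rightD[OF that] by (auto simp: tuples_def)
      ultimately show ?thesis unfolding form_ok_def f_def by fastforce
    qed
    moreover have "length f \<le> cnt R k" using l(1) by (simp add: f_def)
    moreover have "0 \<le> x" "x < int B ^ Suc n" using x y(3,4) D0 by (auto simp: zero_le_mult_iff)
    ultimately show "y \<in> (*) (int D) ` reps B n R k"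
      unfolding reps_def pow_sums_def x by blast
  qed
qed


theorem collapse_plus:
  fixes \<phi> :: "'a fm"
  assumes \<phi>: "wf_fm {plus_rel} {} \<tau> \<phi>"
  shows "\<exists>p. strict_mono p \<and> definable_pred \<tau> (\<lambda>(M :: 'a br_struct) s. padded_sat p M \<phi>)"
proof -
  define R where "R = qd \<phi>"
  define D where "D = den R 0"
  define FF where "FF = (\<Union>k \<in> {..R}. codes R k)"
  define d where "d = (\<Sum>k \<in> {..R}. cnt R k)"
  define size where "size l = (\<Sum>(\<epsilon>, ty) \<leftarrow> l. \<bar>\<epsilon>\<bar>)" for l :: code
  have D0: "0 < D" by (simp add: D_def den_pos)
  have "finite FF" by (simp add: FF_def finite_codes)
  then have "finite (nat ` size ` FF)" by simp
  then obtain W where W: "\<And>l. l \<in> FF \<Longrightarrow> nat (size l) \<le> W"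
    using finite_nat_set_iff_bounded_le by (metis imageI)
  have cnt_le: "cnt R k \<le> d" if "k \<le> R" for k
    unfolding d_def using that by (intro member_le_sum) auto
  have len: "length l \<le> d" if "l \<in> FF" for l
    using that cnt_le by (auto simp: FF_def codes_def Let_def)
  \<comment> \<open>\<open>W\<close> bounds the weight of every code. The weights that occur are at
    most \<open>3 * W\<close>, for \<open>x + y = z\<close>, and \<open>W + D\<close>, for
    comparisons with \<open>D\<close> times a power; both must stay below \<open>B\<close>. The
    factor \<open>D\<close> settles the residues, and the summand 2 makes \<open>p\<close> strictly
    increasing.\<close>
  define B where "B = D * (3 * W + D + 2)"
  have "1 * (3 * W + D + 2) \<le> B" unfolding B_def using D0 by (intro mult_le_mono1) simp
  then have B: "2 \<le> B" "3 * int W < int B" "int W + int D < int B" by simp_all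
  have DB: "int D dvd int B" by (simp add: B_def)
  define p where "p i = B ^ Suc i" for i
  have p: "strict_mono p"
    unfolding strict_mono_Suc_iff p_def using B(1) by simp
  define ent where "ent l v = entries l [v * d..<v * d + d]" for l v
  have val: "code_val B M l (map s [v * d..<v * d + d]) = ent_val B M s (ent l v)"
    for M :: "'a br_struct" and l s v
    by (simp only: code_val_map ent_def)
  have w: "weight (ent l v) \<le> int W" if "l \<in> FF" for l v
    using W[OF that] weight_entries[of l "[v * d..<v * d + d]"] by (simp add: ent_def size_def)
  define bound where "bound M = int D * int B ^ Suc (card (Dom M))" for M :: "'a br_struct"
  define valid where "valid M l t \<longleftrightarrow> int D dvd code_val B M l t \<and> 0 \<le> code_val B M l t \<and>
    code_val B M l t < bound M" for M :: "'a br_struct" and l t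
  define U where "U M k = (*) (int D) ` reps B (card (Dom M)) R k" for M :: "'a br_struct" and k
  define R' where "R' M i t \<longleftrightarrow> t \<in> map (\<lambda>a. int D * int B ^ Suc (rank M a)) ` (rels M ! i)"
    for M :: "'a br_struct" and i t
  define N' where "N' = (\<lambda>(S :: numrel) t. \<exists>x y :: int. t = [x, y, x + y])"
  have padded: "padded_sat p M \<phi> \<longleftrightarrow> isat (U M) (R' M) N' (\<lambda>_. 0) \<phi>" if M: "br_model \<tau> M" for M
  proof -
    have "isat (\<lambda>_. {..<B ^ Suc (card (Dom M))}) (\<lambda>i t. t \<in> map (\<lambda>j. B ^ Suc j) ` map (rank M) ` (rels M ! i))
        (\<lambda>S t. t \<in> snd S) (\<lambda>_. 0) \<phi> \<longleftrightarrow>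
      isat (\<lambda>k. (*) (int D) ` reps B (card (Dom M)) (qd \<phi>) k)
        (\<lambda>i t. t \<in> map (\<lambda>j. int D * int B ^ Suc j) ` map (rank M) ` (rels M ! i))
        (\<lambda>S t. \<exists>x y. t = [x, y, x + y]) (\<lambda>_. 0) \<phi>"
    proof (rule plus_equiv_reps[OF _ D0 _ \<phi>])
      fix i t assume "i < length \<tau>" "t \<in> map (rank M) ` (rels M ! i)"
      then show "set t \<subseteq> {..<card (Dom M)}"
        using br_modelD(5,6)[OF M] by (fastforce simp: tuples_def)
    qed (use B(1) in simp)
    moreover have "U M = (\<lambda>k. (*) (int D) ` reps B (card (Dom M)) (qd \<phi>) k)"
      "R' M = (\<lambda>i t. t \<in> map (\<lambda>j. int D * int B ^ Suc j) ` map (rank M) ` (rels M ! i))"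
      by (simp_all add: U_def R'_def R_def fun_eq_iff image_image comp_def)
    ultimately show ?thesis
      by (simp add: padded_sat_def p_def N'_def image_image comp_def)
  qed
  have zero: "definable_pred \<tau> (\<lambda>(M :: 'a br_struct) s. ent_val B M s (ent l v) = ent_val B M s (ent l' v'))"
    if "l \<in> FF" "l' \<in> FF" for l l' v v'
  proof (rule definable_pred_cong)
    show "definable_pred \<tau> (\<lambda>(M :: 'a br_struct) s. ent_val B M s (ent l v @ neg (ent l' v')) = 0)"
      using w[OF that(1), of v] w[OF that(2), of v'] B(2) by (intro definable_ent_zero) simp
  qed auto
  have valid: "definable_pred \<tau> (\<lambda>(M :: 'a br_struct) s. valid M l (map s [v * d..<v * d + d]))" if l: "l \<in> FF" for l v
  proof (rule definable_pred_cong)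
    \<comment> \<open>Divisibility is constant for a fixed label. The entry
      \<open>(int D, 2, 0)\<close> is the upper bound; kind 2 ignores its variable.\<close>
    show "definable_pred \<tau> (\<lambda>(M :: 'a br_struct) s. int D dvd (\<Sum>(\<epsilon>, ty) \<leftarrow> l. if ty = 0 then \<epsilon> else 0) \<and>
        \<not> 0 < ent_val B M s (neg (ent l v)) \<and> 0 < ent_val B M s (neg (ent l v) @ [(int D, 2, 0)]))"
      using w[OF l, of v] B(2,3)
      by (intro definable_Conj definable_const definable_Neg definable_ent_pos) simp_all
  next
    fix M :: "'a br_struct" and s
    have "int D dvd code_val B M l (map s [v * d..<v * d + d]) \<longleftrightarrow>
        int D dvd (\<Sum>(\<epsilon>, ty) \<leftarrow> l. if ty = 0 then \<epsilon> else 0)"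
      using len[OF l] by (intro code_val_mod[OF DB]) simp
    then show "(int D dvd (\<Sum>(\<epsilon>, ty) \<leftarrow> l. if ty = 0 then \<epsilon> else 0) \<and>
        \<not> 0 < ent_val B M s (neg (ent l v)) \<and> 0 < ent_val B M s (neg (ent l v) @ [(int D, 2, 0)])) \<longleftrightarrow>
        valid M l (map s [v * d..<v * d + d])"
      by (auto simp: valid_def val bound_def expo_def)
  qed
  define \<rho>\<^sub>0 where "\<rho>\<^sub>0 = (\<lambda>_ :: nat. [(0, 0)] :: code)"
  \<comment> \<open>Initially every variable has the code with the single coefficient 0, which
    denotes 0 whatever its block contains. It belongs to depth \<open>R\<close>, where codes have
    length 1.\<close>
  have "cnt R R = 1" by (simp add: cnt.simps)
  then have "[(0, 0)] \<in> codes R R" by (simp add: codes_def Let_def)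
  then have \<rho>\<^sub>0: "range \<rho>\<^sub>0 \<subseteq> FF" by (auto simp: \<rho>\<^sub>0_def FF_def)
  have "definable_pred \<tau> (\<lambda>(M :: 'a br_struct) s. isat (U M) (R' M) N'
      (\<lambda>v. code_val B M (\<rho>\<^sub>0 v) (map s [v * d..<v * d + d])) \<phi>)"
  proof (rule definable_isat[where m = R and F = "codes R" and FF = FF and valid = valid and B = "{plus_rel}"])
    fix M :: "'a br_struct" and r assume M: "br_model \<tau> M" and "r < R"
    then show "U M r = {code_val B M l t | l t. l \<in> codes R r \<and> t \<in> tuples (Dom M) d \<and> valid M l t}"
      unfolding U_def valid_def bound_def D_def using cnt_le[of r] by (intro reps_eq_codes[OF M]) simp
  next
    fix \<rho> :: "nat \<Rightarrow> code" and x y assume "range \<rho> \<subseteq> FF"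
    then show "definable_pred \<tau> (\<lambda>(M :: 'a br_struct) s. code_val B M (\<rho> x) (map s [x * d..<x * d + d]) =
        code_val B M (\<rho> y) (map s [y * d..<y * d + d]))"
      unfolding val by (intro zero) auto
  next
    fix \<rho> :: "nat \<Rightarrow> code" and i and xs :: "nat list"
    assume \<rho>: "range \<rho> \<subseteq> FF" and i: "i < length \<tau>" "length xs = \<tau> ! i"
    define k where "k = length xs"
    \<comment> \<open>The variables from \<open>m\<close> on lie beyond all blocks of
      \<open>xs\<close>. They hold a guessed tuple of the relation, which is compared entry by entry
      with the coded values.\<close>
    obtain m where m: "\<And>x. x \<in> set xs \<Longrightarrow> x * d + d \<le> m"
      using finite_nat_set_iff_bounded_le[of "(\<lambda>x. x * d + d) ` set xs"] by auto
    have "definable_pred \<tau> (\<lambda>(M :: 'a br_struct) s. (\<forall>j \<in> {..<k}. ent_val B M s (ent (\<rho> (xs ! j)) (xs ! j) @ [(- int D, 1, m + j)]) = 0) \<and>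
        map s [m..<m + k] \<in> rels M ! i)"
    proof (intro definable_Conj definable_finite_Conj definable_Rel i definable_ent_zero)
      fix j
      have "\<rho> (xs ! j) \<in> FF" using \<rho> by auto
      then show "weight (ent (\<rho> (xs ! j)) (xs ! j) @ [(- int D, 1, m + j)]) < int B"
        using w[of "\<rho> (xs ! j)" "xs ! j"] B(3) by simp
    qed (simp_all add: k_def i)
    then have "definable_pred \<tau> (\<lambda>(M :: 'a br_struct) s. \<exists>t \<in> tuples (Dom M) k.
        (\<forall>j \<in> {..<k}. ent_val B M (block_upd s m t) (ent (\<rho> (xs ! j)) (xs ! j) @ [(- int D, 1, m + j)]) = 0) \<and>
        map (block_upd s m t) [m..<m + k] \<in> rels M ! i)"
      by (rule definable_Ex_block)
    then show "definable_pred \<tau> (\<lambda>(M :: 'a br_struct) s. R' M i (map (\<lambda>v. code_val B M (\<rho> v) (map s [v * d..<v * d + d])) xs))"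
    proof (rule definable_pred_cong)
      fix M :: "'a br_struct" and s :: "nat \<Rightarrow> 'a" assume M: "br_model \<tau> M"
      let ?val = "\<lambda>v. code_val B M (\<rho> v) (map s [v * d..<v * d + d])"
      have "(\<forall>j \<in> {..<k}. ent_val B M (block_upd s m t) (ent (\<rho> (xs ! j)) (xs ! j) @ [(- int D, 1, m + j)]) = 0) \<and>
          map (block_upd s m t) [m..<m + k] \<in> rels M ! i \<longleftrightarrow>
        map ?val xs = map (\<lambda>a. int D * int B ^ Suc (rank M a)) t \<and> t \<in> rels M ! i"
        if t: "length t = k" for t
      proof -
        have self: "map (block_upd s m t) [m..<m + k] = t"
          using t by (intro nth_equalityI) (auto simp: block_upd_def)
        have entry: "ent_val B M (block_upd s m t) (ent (\<rho> (xs ! j)) (xs ! j) @ [(- int D, 1, m + j)]) = 0 \<longleftrightarrow>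
            ?val (xs ! j) = int D * int B ^ Suc (rank M (t ! j))" if j: "j < k" for j
        proof -
          have "xs ! j * d + d \<le> m" using m j by (simp add: k_def)
          then have "map (block_upd s m t) [xs ! j * d..<xs ! j * d + d] = map s [xs ! j * d..<xs ! j * d + d]"
            by (intro map_cong) (auto simp: block_upd_def)
          then have "ent_val B M (block_upd s m t) (ent (\<rho> (xs ! j)) (xs ! j)) = ?val (xs ! j)"
            by (metis val)
          moreover have "block_upd s m t (m + j) = t ! j" using j t by (simp add: block_upd_def)
          ultimately show ?thesis by (simp add: expo_def)
        qed
        have "(\<forall>j \<in> {..<k}. ent_val B M (block_upd s m t) (ent (\<rho> (xs ! j)) (xs ! j) @ [(- int D, 1, m + j)]) = 0) \<longleftrightarrow>
            (\<forall>j \<in> {..<k}. ?val (xs ! j) = int D * int B ^ Suc (rank M (t ! j)))"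
          by (intro ball_cong refl entry) simp
        also have "\<dots> \<longleftrightarrow> map ?val xs = map (\<lambda>a. int D * int B ^ Suc (rank M a)) t"
        proof -
          have len: "length xs = length t" using t by (simp add: k_def)
          then show ?thesis
            unfolding list_eq_iff_nth_eq t[symmetric] length_map by (simp only: Ball_def lessThan_iff nth_map len simp_thms cong: imp_cong)
        qed
        finally show ?thesis by (simp only: self)
      qed
      then have "(\<exists>t \<in> tuples (Dom M) k.
        (\<forall>j \<in> {..<k}. ent_val B M (block_upd s m t) (ent (\<rho> (xs ! j)) (xs ! j) @ [(- int D, 1, m + j)]) = 0) \<and>
        map (block_upd s m t) [m..<m + k] \<in> rels M ! i) \<longleftrightarrow>
        (\<exists>t \<in> tuples (Dom M) k. map ?val xs = map (\<lambda>a. int D * int B ^ Suc (rank M a)) t \<and> t \<in> rels M ! i)"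
        by (intro bex_cong refl) (simp add: tuples_def)
      also have "\<dots> \<longleftrightarrow> R' M i (map ?val xs)"
        using br_modelD(5)[OF M i(1)] i(2) unfolding R'_def k_def image_iff by (metis subsetD)
      finally show "(\<exists>t \<in> tuples (Dom M) k.
        (\<forall>j \<in> {..<k}. ent_val B M (block_upd s m t) (ent (\<rho> (xs ! j)) (xs ! j) @ [(- int D, 1, m + j)]) = 0) \<and>
        map (block_upd s m t) [m..<m + k] \<in> rels M ! i) \<longleftrightarrow> R' M i (map ?val xs)" .
    qed
  next
    fix \<rho> :: "nat \<Rightarrow> code" and S and xs :: "nat list"
    assume \<rho>: "range \<rho> \<subseteq> FF" and S: "S \<in> {plus_rel}" "length xs = fst S"
    obtain x y z where xs: "xs = [x, y, z]"
      using S by (auto simp: plus_rel_def length_Suc_conv numeral_3_eq_3)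
    have FF: "\<rho> v \<in> FF" for v using \<rho> by auto
    have "definable_pred \<tau> (\<lambda>(M :: 'a br_struct) s. ent_val B M s (ent (\<rho> x) x @ ent (\<rho> y) y @ neg (ent (\<rho> z) z)) = 0)"
      using w[OF FF, of x x] w[OF FF, of y y] w[OF FF, of z z] B(2) by (intro definable_ent_zero) simp
    then show "definable_pred \<tau> (\<lambda>(M :: 'a br_struct) s. N' S (map (\<lambda>v. code_val B M (\<rho> v) (map s [v * d..<v * d + d])) xs))"
      by (rule definable_pred_cong) (auto simp: N'_def xs val)
  next
    show "codes R r \<subseteq> FF" if "r < R" for r unfolding FF_def using that by (intro UN_upper) simp
  qed (auto simp: finite_codes valid \<phi> R_def \<rho>\<^sub>0[unfolded image_subset_iff] intro: \<rho>\<^sub>0)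
  then have "definable_pred \<tau> (\<lambda>(M :: 'a br_struct) s. padded_sat p M \<phi>)"
  proof (rule definable_pred_cong)
    fix M :: "'a br_struct" and s :: "nat \<Rightarrow> 'a" assume M: "br_model \<tau> M"
    have "code_val B M [(0, 0)] t = 0" for t by (cases t) (auto simp: code_val_def)
    then show "isat (U M) (R' M) N' (\<lambda>v. code_val B M (\<rho>\<^sub>0 v) (map s [v * d..<v * d + d])) \<phi> \<longleftrightarrow> padded_sat p M \<phi>"
      by (simp add: padded[OF M] \<rho>\<^sub>0_def)
  qed
  then show ?thesis using p by blast
qed

theorem theorem5p11:
  shows "logic_equiv (RI (FO (unary_rels \<union> {le_rel}) {} :: 'a::infinite logic)) (FO {le_rel} {}) \<and>
         logic_equiv (RI (FO {plus_rel} {} :: 'a::infinite logic)) (FO {le_rel} {})"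
  using RI_equiv_FO_le[OF collapse_unary] RI_equiv_FO_le[OF collapse_plus] by blast

end
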